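(* Let $G$ be a real Lie group with a $C^\infty$ action on a $C^\infty$ real manifold $M$. Assume that the $G$-action on $M$ is fixpoint rare. Let $n := \dim G$. Then there exists a $G$-invariant meager subset $Z$ of the $n$th order frame bundle $\mathcal{F}^n M$ such that the $G$-action on $(\mathcal{F}^n M)\setminus Z$ is free.
   Context: Manifolds are finite-dimensional $C^\infty$ real manifolds and Lie groups are finite-dimensional real Lie groups (not necessarily connected); both are Hausdorff and second countable. An action of $G$ on $M$ is $C^\infty$ if the action map $G\times M\to M$ is $C^\infty$. Let $1_G$ be the identity element of $G$. An action of a group $G$ on a topological space $X$ is fixpoint rare if, for all $g\in G\setminus\{1_G\}$, the set $\{x\in X \mid gx=x\}$ has empty interior in $X$. For $k\ge 0$, $\mathcal{F}^kM$ denotes the $k$th order frame bundle of $M$: with $d:=\dim M$, its points are the $k$-jets at $0\in\mathbb{R}^d$ of local $C^\infty$ diffeomorphisms $\varphi$ from a neighborhood of $0$ in $\mathbb{R}^d$ onto an open subset of $M$; the fiber over $x\in M$ consists of the jets with $\varphi(0)=x$; $\mathcal{F}^0M=M$. It carries its usual manifold structure. A $C^\infty$ action of $G$ on $M$ induces (by differentiation, i.e. prolongation) a $G$-action on $\mathcal{F}^kM$: $g$ sends the $k$-jet of $\varphi$ at $0$ to the $k$-jet at $0$ of $u\mapsto g\,\varphi(u)$. A subset of a topological space is meager if it is a countable union of nowhere dense subsets. A subset $Z$ is $G$-invariant if $gZ=Z$ for all $g\in G$. An action is free if only $1_G$ fixes any point. *)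

theory Defs
  imports "HOL-Analysis.Analysis" "HOL-Algebra.Group_Action"
begin

section \<open>Model spaces\<close>

text \<open>
  The class \<open>euclidean_space\<close> excludes dimension zero, which must be allowed here (discrete Lie
  groups, zero-dimensional manifolds). The class below consists of exactly the finite-dimensional
  real inner product spaces; a type \<open>'e\<close> of this class plays the role of \<open>\<real>\<^sup>d\<close> with
  \<open>d = dim (UNIV :: 'e set)\<close>, and \<open>unit\<close> is made the instance of dimension \<open>0\<close>.
\<close>

class findim_inner = real_inner +
  assumes finite_spanning_sum: "\<exists>B. finite B \<and> (\<forall>x. \<exists>c. x = (\<Sum>b\<in>B. c b *\<^sub>R b))"

lemma finite_spanning_iff:
  "(\<exists>B::'a::real_vector set. finite B \<and> (\<forall>x. \<exists>c. x = (\<Sum>b\<in>B. c b *\<^sub>R b))) \<longleftrightarrow>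
   (\<exists>B::'a set. finite B \<and> span B = UNIV)"
  by (rule ex_cong1) (auto simp: span_finite image_def set_eq_iff surj_def)

lemma finite_spanning: "\<exists>B::'a::findim_inner set. finite B \<and> span B = UNIV"
  using finite_spanning_sum finite_spanning_iff by blast

instance euclidean_space \<subseteq> findim_inner
  by standard (unfold finite_spanning_iff, use finite_Basis span_Basis in blast)

instance prod :: (findim_inner, findim_inner) findim_inner
proof
  obtain B :: "'a set" where B: "finite B" "span B = UNIV"
    using finite_spanning by blast
  obtain C :: "'b set" where C: "finite C" "span C = UNIV"
    using finite_spanning by blast
  define D where "D = (\<lambda>x. (x, 0::'b)) ` B \<union> (\<lambda>y. (0::'a, y)) ` C"
  have "p \<in> span D" for p
  proof -
    have lin1: "linear (\<lambda>x. (x, 0::'b))" and lin2: "linear (\<lambda>y. (0::'a, y))"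
      by (auto intro!: linearI)
    have "(fst p, 0) \<in> span ((\<lambda>x. (x, 0::'b)) ` B)"
      using B linear_span_image[OF lin1, of B] by auto
    moreover have "(0, snd p) \<in> span ((\<lambda>y. (0::'a, y)) ` C)"
      using C linear_span_image[OF lin2, of C] by auto
    ultimately have "(fst p, 0) + (0, snd p) \<in> span D"
      unfolding D_def by (meson span_add span_mono subsetD sup_ge1 sup_ge2)
    then show ?thesis by simp
  qed
  moreover have "finite D" using B C by (simp add: D_def)
  ultimately show "\<exists>B::('a \<times> 'b) set. finite B \<and> (\<forall>x. \<exists>c. x = (\<Sum>b\<in>B. c b *\<^sub>R b))"
    unfolding finite_spanning_iff by blast
qed

instantiation unit :: real_inner
begin

definition zero_unit :: unit where "zero_unit = ()"
definition plus_unit :: "unit \<Rightarrow> unit \<Rightarrow> unit" where "plus_unit x y = ()"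
definition scaleR_unit :: "real \<Rightarrow> unit \<Rightarrow> unit" where "scaleR_unit r x = ()"
definition inner_unit :: "unit \<Rightarrow> unit \<Rightarrow> real" where "inner_unit x y = 0"
definition norm_unit :: "unit \<Rightarrow> real" where "norm_unit x = 0"
definition sgn_unit :: "unit \<Rightarrow> unit" where "sgn_unit x = ()"
definition dist_unit :: "unit \<Rightarrow> unit \<Rightarrow> real" where "dist_unit x y = 0"
definition uniformity_unit :: "(unit \<times> unit) filter"
  where "uniformity_unit = (INF e\<in>{0<..}. principal {(x, y). dist x y < e})"
definition open_unit :: "unit set \<Rightarrow> bool"
  where "open_unit U = (\<forall>x\<in>U. \<forall>\<^sub>F (x', y) in uniformity. x' = x \<longrightarrow> y \<in> U)"

instance
  by standard
    (auto simp: inner_unit_def norm_unit_def dist_unit_def uniformity_unit_def open_unit_def)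

end

instance unit :: findim_inner
  by standard (rule exI[of _ "{}"], auto)


section \<open>Smooth maps between model spaces\<close>

text \<open>
  Only used for open \<open>S\<close>. As the domain is finite-dimensional, continuity of all iterated
  directional derivatives is continuity of the iterated Frechet derivatives.
\<close>

primrec Ck_on :: "nat \<Rightarrow> 'a::findim_inner set \<Rightarrow> ('a \<Rightarrow> 'b::findim_inner) \<Rightarrow> bool" where
  "Ck_on 0 S f \<longleftrightarrow> continuous_on S f"
| "Ck_on (Suc k) S f \<longleftrightarrow>
     (\<forall>x\<in>S. f differentiable (at x)) \<and> (\<forall>v. Ck_on k S (\<lambda>x. frechet_derivative f (at x) v))"

definition smooth_on :: "'a::findim_inner set \<Rightarrow> ('a \<Rightarrow> 'b::findim_inner) \<Rightarrow> bool" where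
  "smooth_on S f \<longleftrightarrow> (\<forall>k. Ck_on k S f)"

text \<open>
  \<open>iter_deriv [v\<^sub>1, \<dots>, v\<^sub>r] f x\<close> is the iterated directional derivative of \<open>f\<close> at \<open>x\<close> in the
  directions \<open>v\<^sub>1, \<dots>, v\<^sub>r\<close>, i.e. the value of the \<open>r\<close>-th derivative of \<open>f\<close> at \<open>x\<close> on them.
\<close>

primrec iter_deriv :: "'a::findim_inner list \<Rightarrow> ('a \<Rightarrow> 'b::findim_inner) \<Rightarrow> 'a \<Rightarrow> 'b" where
  "iter_deriv [] f = f"
| "iter_deriv (v # vs) f = iter_deriv vs (\<lambda>x. frechet_derivative f (at x) v)"


section \<open>Smooth manifolds\<close>

text \<open>
  A manifold is given by a topology and a (not necessarily maximal) smooth atlas; a chart is an open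
  domain together with a map to the model space, irrelevant outside that domain.
\<close>

record ('m, 'e) manifold =
  mtop :: "'m topology"
  charts :: "('m set \<times> ('m \<Rightarrow> 'e)) set"

abbreviation mspace :: "('m, 'e) manifold \<Rightarrow> 'm set" where
  "mspace M \<equiv> topspace (mtop M)"

definition mdim :: "('m, 'e::findim_inner) manifold \<Rightarrow> nat" where
  "mdim M = dim (UNIV :: 'e set)"

locale smooth_manifold =
  fixes M :: "('m, 'e::findim_inner) manifold"
  assumes Hausdorff: "Hausdorff_space (mtop M)"
    and second_countable: "second_countable (mtop M)"
    and chart_domain: "(U, \<psi>) \<in> charts M \<Longrightarrow> openin (mtop M) U"
    and chart_range: "(U, \<psi>) \<in> charts M \<Longrightarrow> open (\<psi> ` U)"
    and chart_homeomorphic: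
      "(U, \<psi>) \<in> charts M \<Longrightarrow>
        homeomorphic_map (subtopology (mtop M) U) (top_of_set (\<psi> ` U)) \<psi>"
    and chart_cover: "x \<in> mspace M \<Longrightarrow> \<exists>(U, \<psi>) \<in> charts M. x \<in> U"
    and chart_compatible:
      "(U, \<psi>) \<in> charts M \<Longrightarrow> (V, \<eta>) \<in> charts M \<Longrightarrow>
        smooth_on (\<psi> ` (U \<inter> V)) (\<eta> \<circ> inv_into U \<psi>)"

definition smooth_map ::
    "('m, 'e::findim_inner) manifold \<Rightarrow> ('n, 'f::findim_inner) manifold \<Rightarrow> ('m \<Rightarrow> 'n) \<Rightarrow> bool" where
  "smooth_map M N f \<longleftrightarrow>
     continuous_map (mtop M) (mtop N) f \<and>
     (\<forall>(U, \<psi>) \<in> charts M. \<forall>(V, \<eta>) \<in> charts N.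
        smooth_on (\<psi> ` {x \<in> U. f x \<in> V}) (\<eta> \<circ> f \<circ> inv_into U \<psi>))"

definition diffeomorphism ::
    "('m, 'e::findim_inner) manifold \<Rightarrow> ('n, 'f::findim_inner) manifold \<Rightarrow> ('m \<Rightarrow> 'n) \<Rightarrow> bool" where
  "diffeomorphism M N f \<longleftrightarrow>
     smooth_map M N f \<and>
     (\<exists>g. smooth_map N M g \<and> (\<forall>x\<in>mspace M. g (f x) = x) \<and> (\<forall>y\<in>mspace N. f (g y) = y))"

definition model_manifold :: "('e, 'e::findim_inner) manifold" where
  "model_manifold = \<lparr>mtop = euclidean, charts = {(UNIV, id)}\<rparr>"

definition open_submanifold :: "('m, 'e) manifold \<Rightarrow> 'm set \<Rightarrow> ('m, 'e) manifold" where
  "open_submanifold M W =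
     \<lparr>mtop = subtopology (mtop M) W, charts = {(U \<inter> W, \<psi>) |U \<psi>. (U, \<psi>) \<in> charts M}\<rparr>"

definition prod_manifold ::
    "('m, 'e) manifold \<Rightarrow> ('n, 'f) manifold \<Rightarrow> ('m \<times> 'n, 'e \<times> 'f) manifold" where
  "prod_manifold M N =
     \<lparr>mtop = prod_topology (mtop M) (mtop N),
      charts = {(U \<times> V, map_prod \<psi> \<eta>) |U \<psi> V \<eta>. (U, \<psi>) \<in> charts M \<and> (V, \<eta>) \<in> charts N}\<rparr>"


section \<open>Lie groups and their actions\<close>

locale lie_group = group G + smooth_manifold \<G>
  for G :: "('g, 'b) monoid_scheme" (structure) and \<G> :: "('g, 'v::findim_inner) manifold" +
  assumes mspace_eq_carrier: "mspace \<G> = carrier G"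
    and smooth_mult: "smooth_map (prod_manifold \<G> \<G>) \<G> (\<lambda>(x, y). x \<otimes> y)"
    and smooth_inv: "smooth_map \<G> \<G> (\<lambda>x. inv x)"

locale smooth_action = lie_group G \<G> + smooth_manifold M + group_action G "mspace M" act
  for G :: "('g, 'b) monoid_scheme" (structure) and \<G> :: "('g, 'v::findim_inner) manifold"
    and M :: "('m, 'e::findim_inner) manifold" and act :: "'g \<Rightarrow> 'm \<Rightarrow> 'm" +
  assumes smooth_act: "smooth_map (prod_manifold \<G> M) M (\<lambda>(g, x). act g x)"

definition fixpoint_rare ::
    "('g, 'b) monoid_scheme \<Rightarrow> 'x topology \<Rightarrow> ('g \<Rightarrow> 'x \<Rightarrow> 'x) \<Rightarrow> bool" where
  "fixpoint_rare G X act \<longleftrightarrow>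
     (\<forall>g \<in> carrier G - {\<one>\<^bsub>G\<^esub>}. X interior_of {x \<in> topspace X. act g x = x} = {})"

definition free_on :: "('g, 'b) monoid_scheme \<Rightarrow> 'x set \<Rightarrow> ('g \<Rightarrow> 'x \<Rightarrow> 'x) \<Rightarrow> bool" where
  "free_on G S act \<longleftrightarrow> (\<forall>g \<in> carrier G. \<forall>x \<in> S. act g x = x \<longrightarrow> g = \<one>\<^bsub>G\<^esub>)"

definition invariant_under :: "('g, 'b) monoid_scheme \<Rightarrow> ('g \<Rightarrow> 'x \<Rightarrow> 'x) \<Rightarrow> 'x set \<Rightarrow> bool" where
  "invariant_under G act Z \<longleftrightarrow> (\<forall>g \<in> carrier G. act g ` Z = Z)"


section \<open>Meager sets\<close>

definition nowhere_dense_in :: "'a topology \<Rightarrow> 'a set \<Rightarrow> bool" where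
  "nowhere_dense_in X S \<longleftrightarrow> S \<subseteq> topspace X \<and> X interior_of (X closure_of S) = {}"

definition meager_in :: "'a topology \<Rightarrow> 'a set \<Rightarrow> bool" where
  "meager_in X Z \<longleftrightarrow> (\<exists>\<N>. countable \<N> \<and> (\<forall>N\<in>\<N>. nowhere_dense_in X N) \<and> Z = \<Union>\<N>)"


section \<open>Frame bundles\<close>

text \<open>
  Local diffeomorphisms at \<open>0\<close> are represented by total functions that are diffeomorphisms on
  some open neighbourhood of \<open>0\<close>; their values elsewhere are arbitrary and do not affect the jet.
\<close>

definition local_diffeos :: "('m, 'e::findim_inner) manifold \<Rightarrow> ('e \<Rightarrow> 'm) set" where
  "local_diffeos M =
     {\<phi>. \<exists>W. open W \<and> 0 \<in> W \<and> openin (mtop M) (\<phi> ` W) \<and>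
        diffeomorphism (open_submanifold model_manifold W) (open_submanifold M (\<phi> ` W)) \<phi>}"

text \<open>
  The derivatives of \<open>\<psi> \<circ> \<phi>\<close> at \<open>0\<close> up to order \<open>k\<close>. For \<open>r \<le> k\<close> the restriction to lists of
  length \<open>r\<close> is the \<open>r\<close>-th derivative as a symmetric multilinear map.
\<close>

definition jet_coord ::
    "nat \<Rightarrow> ('m \<Rightarrow> 'e) \<Rightarrow> ('e::findim_inner \<Rightarrow> 'm) \<Rightarrow> 'e list \<Rightarrow> 'e" where
  "jet_coord k \<psi> \<phi> = (\<lambda>vs. if length vs \<le> k then iter_deriv vs (\<psi> \<circ> \<phi>) 0 else 0)"

definition jet_rel ::
    "nat \<Rightarrow> ('m, 'e::findim_inner) manifold \<Rightarrow> (('e \<Rightarrow> 'm) \<times> ('e \<Rightarrow> 'm)) set" where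
  "jet_rel k M =
     {(\<phi>, \<phi>'). \<phi> \<in> local_diffeos M \<and> \<phi>' \<in> local_diffeos M \<and> \<phi> 0 = \<phi>' 0 \<and>
        (\<forall>(U, \<psi>) \<in> charts M. \<phi> 0 \<in> U \<longrightarrow> jet_coord k \<psi> \<phi> = jet_coord k \<psi> \<phi>')}"

definition jet :: "nat \<Rightarrow> ('m, 'e::findim_inner) manifold \<Rightarrow> ('e \<Rightarrow> 'm) \<Rightarrow> ('e \<Rightarrow> 'm) set" where
  "jet k M \<phi> = jet_rel k M `` {\<phi>}"

definition frames :: "nat \<Rightarrow> ('m, 'e::findim_inner) manifold \<Rightarrow> ('e \<Rightarrow> 'm) set set" where
  "frames k M = local_diffeos M // jet_rel k M"

text \<open>
  The manifold topology of the frame bundle: every chart \<open>\<psi>\<close> of \<open>M\<close>, with domain \<open>U\<close>, induces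
  the chart \<open>jet \<phi> \<mapsto> jet_coord k \<psi> \<phi>\<close> on the frames over \<open>U\<close>. The open sets \<open>T\<close> below
  refer to the product topology on the function space, and this induces the usual topology on the
  finite-dimensional space of \<open>k\<close>-tuples of derivatives.
\<close>

definition frame_bundle :: "nat \<Rightarrow> ('m, 'e::findim_inner) manifold \<Rightarrow> ('e \<Rightarrow> 'm) set topology" where
  "frame_bundle k M =
     topology_generated_by
       {{jet k M \<phi> |\<phi>. \<phi> \<in> local_diffeos M \<and> \<phi> 0 \<in> U \<and> jet_coord k \<psi> \<phi> \<in> T} |U \<psi> T.
          (U, \<psi>) \<in> charts M \<and> open T}"

text \<open>
  The prolonged action: a representative \<open>\<phi>\<close> of a jet is sent to \<open>u \<mapsto> g \<cdot> \<phi> u\<close>. The union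
  is the usual lifting of a map to equivalence classes; all members of the union coincide.
\<close>

definition frame_act ::
    "nat \<Rightarrow> ('m, 'e::findim_inner) manifold \<Rightarrow> ('g \<Rightarrow> 'm \<Rightarrow> 'm) \<Rightarrow>
      'g \<Rightarrow> ('e \<Rightarrow> 'm) set \<Rightarrow> ('e \<Rightarrow> 'm) set" where
  "frame_act k M act g J = (\<Union>\<phi>\<in>J. jet k M (\<lambda>u. act g (\<phi> u)))"

lemma equiv_jet_rel: "equiv (local_diffeos M) (jet_rel k M)"
  unfolding jet_rel_def by (rule equivI) (auto simp: refl_on_def sym_def trans_def, fastforce+)

lemma (in smooth_manifold) topspace_frame_bundle: "topspace (frame_bundle k M) = frames k M"
proof -
  have base: "\<exists>(U, \<psi>) \<in> charts M. \<phi> 0 \<in> U" if "\<phi> \<in> local_diffeos M" for \<phi>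
  proof -
    from that have "\<phi> 0 \<in> mspace M"
      unfolding local_diffeos_def using openin_subset by fastforce
    then show ?thesis by (rule chart_cover)
  qed
  show ?thesis
  proof
    show "topspace (frame_bundle k M) \<subseteq> frames k M"
      by (auto simp: frame_bundle_def topology_generated_by_topspace frames_def jet_def
          intro: quotientI)
    show "frames k M \<subseteq> topspace (frame_bundle k M)"
    proof
      fix J assume "J \<in> frames k M"
      then obtain \<phi> where \<phi>: "\<phi> \<in> local_diffeos M" "J = jet k M \<phi>"
        by (auto simp: frames_def jet_def quotient_def)
      then obtain U \<psi> where "(U, \<psi>) \<in> charts M" "\<phi> 0 \<in> U"
        using base by blast
      with \<phi> have "J \<in> {jet k M \<phi> |\<phi>. \<phi> \<in> local_diffeos M \<and> \<phi> 0 \<in> U \<and> jet_coord k \<psi> \<phi> \<in> UNIV}"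
        by blast
      with \<open>(U, \<psi>) \<in> charts M\<close> show "J \<in> topspace (frame_bundle k M)"
        unfolding frame_bundle_def topology_generated_by_topspace by blast
    qed
  qed
qed

end

theory Submission
  imports Defs
begin

text \<open>
  An element \<open>g\<close> fixes a \<open>k\<close>-frame over \<open>x\<close> iff it fixes \<open>x\<close> and agrees with the identity to
  order \<open>k\<close> at \<open>x\<close>, so only the set of such \<open>x\<close> in \<open>M\<close> matters; preimages of nowhere dense sets
  in the frame bundle are nowhere dense because the projection is open and continuous.

  For \<open>x\<close> in \<open>M\<close> let \<open>\<delta>\<^sub>k(x)\<close> be the dimension of the space of tangent vectors of \<open>G\<close> at \<open>g\<close>
  whose infinitesimal action vanishes to order \<open>k\<close> at \<open>x\<close> (all derivatives of order less than
  \<open>k\<close> are zero); by translation it does not depend on \<open>g\<close>. Each \<open>\<delta>\<^sub>k\<close> is upper semicontinuous,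
  hence locally constant on a dense open set, and \<open>n = \<delta>\<^sub>0 \<ge> \<dots> \<ge> \<delta>\<^bsub>n+1\<^esub> \<ge> 0\<close> forces
  \<open>\<delta>\<^sub>k = \<delta>\<^bsub>k+1\<^esub>\<close> near a given point for some \<open>k \<le> n\<close>. There the elements near \<open>g\<close> which agree
  with the identity to order \<open>k\<close> at \<open>x\<close> form a submanifold of constant dimension. If such
  elements exist for all \<open>x\<close> of an open set, they can be chosen in a fixed transversal, and the
  choice \<open>g(x)\<close> has derivative zero in \<open>x\<close>, because one more derivative vanishes than is needed to
  pin it down. So \<open>g(x)\<close> is locally constant, and a single \<open>g\<close> fixes an open set pointwise; this
  is impossible unless \<open>g\<close> is the identity.
\<close>

section \<open>Finite-dimensional inner product spaces\<close>

text \<open>There are uncountably many elements of G, and a union of nowhere dense sets over all of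
  them need not be meager. The argument therefore treats a box of elements and points at once. For a
  compact ball of parameters around \<open>g\<close>, the points at which some parameter has
  vanishing jet form a relatively closed set by compactness, and this set has empty interior because
  the parameters over an open set can be chosen constant. Second countability of G and M leaves
  countably many boxes. The identity must be kept out of the parameters, since it is always a
  possible constant choice.

  The equations for a vanishing jet are overdetermined, and their rank is controlled only through
  kernel dimensions. Instead of selecting independent equations, all of them are combined by an
  adjoint into one map \<open>H\<close> with values in the parameter space, which near the base
  point is a small perturbation of the identity in \<open>g\<close>. Semicontinuity, the motion to
  the transversal and the vanishing derivative of the choice are all read off from
  \<open>H\<close>.\<close>

definition onb :: "'a::findim_inner set" where
  "onb = (SOME B. finite B \<and> pairwise orthogonal B \<and> (\<forall>b\<in>B. norm b = 1) \<and> span B = UNIV)"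

lemma onb_exists:
  "\<exists>B::'a::findim_inner set. finite B \<and> pairwise orthogonal B \<and> (\<forall>b\<in>B. norm b = 1) \<and> span B = UNIV"
proof -
  obtain C :: "'a set" where C: "finite C" "span C = UNIV"
    using finite_spanning by blast
  from basis_orthogonal[OF C(1)] obtain B :: "'a set" where
    B: "finite B" "span B = UNIV" "pairwise orthogonal B"
    unfolding C(2) by blast
  let ?B = "sgn ` (B - {0})"
  have "b \<in> span ?B" if "b \<in> B" for b
  proof (cases "b = 0")
    case False
    then have "sgn b \<in> ?B" using that by auto
    then have "norm b *\<^sub>R sgn b \<in> span ?B"
      by (intro span_scale span_base)
    then show ?thesis using False by (simp add: sgn_div_norm)
  qed (simp add: span_zero)
  then have "span B \<subseteq> span ?B"
    by (intro span_minimal) auto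
  moreover have "pairwise orthogonal ?B"
    using B(3) by (auto simp: pairwise_def orthogonal_def sgn_div_norm)
  ultimately show ?thesis
    using B by (intro exI[of _ ?B]) (auto simp: norm_sgn)
qed

lemma finite_onb [simp]: "finite (onb :: 'a::findim_inner set)"
  and norm_onb: "b \<in> onb \<Longrightarrow> norm (b::'a) = 1"
  and span_onb [simp]: "span (onb :: 'a set) = UNIV"
  and pairwise_onb: "pairwise orthogonal (onb :: 'a set)"
  using someI_ex[OF onb_exists] unfolding onb_def[symmetric] by auto

lemma inner_onb: "b \<in> onb \<Longrightarrow> c \<in> onb \<Longrightarrow> inner b c = (if b = c then 1 else 0)"
  using pairwise_onb norm_onb[of b]
  by (cases "b = c") (auto simp: pairwise_def orthogonal_def norm_eq_1)

lemma onb_expand: "(\<Sum>b\<in>onb. (x \<bullet> b) *\<^sub>R b) = (x :: 'a::findim_inner)"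
proof -
  obtain u where u: "x = (\<Sum>b\<in>onb. u b *\<^sub>R b)"
    using span_finite[OF finite_onb, symmetric] span_onb by (auto simp: image_def)
  have "x \<bullet> c = u c" if "c \<in> onb" for c
    using that by (simp add: u inner_sum_left inner_onb if_distrib cong: if_cong)
  then show ?thesis by (simp add: u cong: sum.cong)
qed

lemma linear_onb:
  assumes "linear f" shows "f x = (\<Sum>b\<in>onb. (x \<bullet> b) *\<^sub>R f b)"
proof -
  have "f x = f (\<Sum>b\<in>onb. (x \<bullet> b) *\<^sub>R b)" by (simp add: onb_expand)
  then show ?thesis
    using assms by (simp add: linear_sum linear_cmul)
qed

lemma linear_bounded_findim:
  assumes "linear (f :: 'a::findim_inner \<Rightarrow> 'b::real_normed_vector)" shows "bounded_linear f"
proof -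
  interpret linear f by fact
  show ?thesis
  proof
    show "\<exists>K. \<forall>x. norm (f x) \<le> norm x * K"
    proof (intro exI allI)
      fix x
      have "norm (f x) \<le> (\<Sum>b\<in>onb. norm x * norm (f b))"
        unfolding linear_onb[OF assms, of x]
      proof (rule sum_norm_le)
        fix b :: 'a assume b: "b \<in> onb"
        have "\<bar>x \<bullet> b\<bar> \<le> norm x"
          using Cauchy_Schwarz_ineq2[of x b] norm_onb[OF b] by simp
        then show "norm ((x \<bullet> b) *\<^sub>R f b) \<le> norm x * norm (f b)"
          by (simp add: mult_right_mono)
      qed
      then show "norm (f x) \<le> norm x * (\<Sum>b\<in>onb. norm (f b))"
        by (simp add: sum_distrib_left)
    qed
  qed
qed

lemma independent_onb: "independent (onb :: 'a::findim_inner set)"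
  using pairwise_onb norm_onb by (intro pairwise_orthogonal_independent) fastforce+

text \<open>Dimension theory for the class; the rewrites phrase it in the constants of real vector
  spaces.\<close>

interpretation findim: finite_dimensional_vector_space
    "scaleR :: real \<Rightarrow> 'a \<Rightarrow> 'a::findim_inner" onb
  rewrites "module.dependent (*\<^sub>R) = dependent"
    and "module.representation (*\<^sub>R) = representation"
    and "module.subspace (*\<^sub>R) = subspace"
    and "module.span (*\<^sub>R) = span"
    and "vector_space.extend_basis (*\<^sub>R) = extend_basis"
    and "vector_space.dim (*\<^sub>R) = dim"
    and "Vector_Spaces.linear (*\<^sub>R) (*\<^sub>R) = linear"
    and "Vector_Spaces.linear (*) (*\<^sub>R) = linear"
proof -
  show "finite_dimensional_vector_space (*\<^sub>R) (onb::'a set)"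
    by unfold_locales
      (use independent_onb span_onb in \<open>auto simp: dependent_raw_def span_raw_def\<close>)
qed (auto simp add: dependent_raw_def representation_raw_def
      subspace_raw_def span_raw_def extend_basis_raw_def dim_raw_def linear_def
      real_scaleR_def[abs_def])

text \<open>Supplies compactness of closed balls, used in projecting along the parameters, and
  completeness, used for the contraction in \<open>local_inverse\<close>.\<close>

instance findim_inner \<subseteq> heine_borel
proof
  fix f :: "nat \<Rightarrow> 'a"
  assume bd: "bounded (range f)"
  have "bounded ((\<lambda>x. x \<bullet> b) ` range f)" for b
    by (rule bounded_linear_image[OF bd bounded_linear_inner_left])
  moreover have "(\<Sum>c\<in>onb. u c *\<^sub>R c) \<bullet> b = u b" if "b \<in> onb" for u and b :: 'a
    using that by (simp add: inner_sum_left inner_onb if_distrib cong: if_cong)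
  ultimately have "\<forall>d\<subseteq>(onb::'a set). \<exists>l::'a. \<exists>r::nat\<Rightarrow>nat. strict_mono r \<and>
    (\<forall>e>0. eventually (\<lambda>n. \<forall>b\<in>d. dist (f (r n) \<bullet> b) (l \<bullet> b) < e) sequentially)"
    by (intro compact_lemma_general[where unproj = "\<lambda>u. \<Sum>b\<in>onb. u b *\<^sub>R b" and proj = "(\<bullet>)"])
      (auto simp: onb_expand)
  then obtain l :: 'a and r where r: "strict_mono r"
    and l: "\<And>e. e > 0 \<Longrightarrow> eventually (\<lambda>n. \<forall>b\<in>onb. dist (f (r n) \<bullet> b) (l \<bullet> b) < e) sequentially"
    by blast
  have "((\<lambda>n. f (r n) \<bullet> b) \<longlongrightarrow> l \<bullet> b) sequentially" if "b \<in> onb" for b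
    using that by (intro tendstoI eventually_mono[OF l]) auto
  then have "((\<lambda>n. \<Sum>b\<in>onb. (f (r n) \<bullet> b) *\<^sub>R b) \<longlongrightarrow> (\<Sum>b\<in>onb. (l \<bullet> b) *\<^sub>R b)) sequentially"
    by (intro tendsto_sum tendsto_scaleR tendsto_const)
  then show "\<exists>l r. strict_mono (r::nat\<Rightarrow>nat) \<and> ((f \<circ> r) \<longlongrightarrow> l) sequentially"
    using r by (auto simp: onb_expand o_def)
qed

section \<open>Calculus of \<open>Ck_on\<close>\<close>

abbreviation dd :: "'a::findim_inner \<Rightarrow> ('a \<Rightarrow> 'b::findim_inner) \<Rightarrow> 'a \<Rightarrow> 'b" where
  "dd v f \<equiv> \<lambda>x. frechet_derivative f (at x) v"

text \<open>Both sides are choices made from the same predicate, so they coincide even where no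
  derivative exists.\<close>

lemma frechet_derivative_cong_open:
  assumes "open S" "x \<in> S" "\<And>y. y \<in> S \<Longrightarrow> f y = g y"
  shows "frechet_derivative f (at x) = frechet_derivative g (at x)"
proof -
  have "(f has_derivative f') (at x) \<longleftrightarrow> (g has_derivative f') (at x)" for f'
    using assms by (metis has_derivative_transform_within_open)
  then show ?thesis by (simp add: frechet_derivative_def)
qed

lemma differentiable_cong_open:
  assumes "open S" "x \<in> S" "\<And>y. y \<in> S \<Longrightarrow> f y = g y"
  shows "f differentiable (at x) \<longleftrightarrow> g differentiable (at x)"
  using assms unfolding differentiable_def by (metis has_derivative_transform_within_open)

lemma dd_eqI: "(f has_derivative f') (at x) \<Longrightarrow> dd v f x = f' v"
  by (simp add: frechet_derivative_at[symmetric])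

lemma has_derivative_dd:
  "f differentiable (at x) \<Longrightarrow> (f has_derivative (\<lambda>v. dd v f x)) (at x)"
  by (simp add: frechet_derivative_works)

lemma linear_dd: "f differentiable (at x) \<Longrightarrow> linear (\<lambda>v. dd v f x)"
  using has_derivative_dd has_derivative_linear by blast

lemma Ck_on_cong:
  assumes "open S" "\<And>y. y \<in> S \<Longrightarrow> f y = g y"
  shows "Ck_on k S f \<longleftrightarrow> Ck_on k S g"
  using assms(2)
proof (induction k arbitrary: f g)
  case 0
  then show ?case by (simp cong: continuous_on_cong)
next
  case (Suc k)
  have "f differentiable (at x) \<longleftrightarrow> g differentiable (at x)" if "x \<in> S" for x
    using differentiable_cong_open[OF assms(1) that] Suc.prems by blast
  moreover have "Ck_on k S (dd v f) \<longleftrightarrow> Ck_on k S (dd v g)" for v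
    by (rule Suc.IH) (simp add: frechet_derivative_cong_open[OF assms(1), of _ f g] Suc.prems)
  ultimately show ?case by auto
qed

lemma iter_deriv_cong:
  assumes "open S" "x \<in> S" "\<And>y. y \<in> S \<Longrightarrow> f y = g y"
  shows "iter_deriv vs f x = iter_deriv vs g x"
  using assms(2,3)
proof (induction vs arbitrary: f g x)
  case (Cons v vs)
  have "dd v f y = dd v g y" if "y \<in> S" for y
    by (rule fun_cong[OF frechet_derivative_cong_open[OF assms(1) that]]) (rule Cons.prems)
  then have "iter_deriv vs (dd v f) x = iter_deriv vs (dd v g) x"
    using Cons.prems by (intro Cons.IH)
  then show ?case by simp
qed auto

lemma Ck_on_SucD: "Ck_on (Suc k) S f \<Longrightarrow> Ck_on k S f"
proof (induction k arbitrary: f)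
  case 0
  then show ?case
    by (auto intro!: continuous_at_imp_continuous_on differentiable_imp_continuous_within)
qed auto

lemma Ck_on_subset: "Ck_on k S f \<Longrightarrow> T \<subseteq> S \<Longrightarrow> Ck_on k T f"
  by (induction k arbitrary: f) (auto intro: continuous_on_subset)

text \<open>The derivatives in \<open>Ck_on\<close> are taken \<open>at x\<close>, not within
  \<open>S\<close>, so each clause of the definition is a condition at single points that an open
  neighbourhood decides.\<close>

lemma Ck_on_local:
  "(\<And>x. x \<in> S \<Longrightarrow> \<exists>T. open T \<and> x \<in> T \<and> Ck_on k T f) \<Longrightarrow> Ck_on k S f"
proof (induction k arbitrary: f)
  case 0
  have "isCont f x" if "x \<in> S" for x
    using "0.prems"[OF that] by (auto simp: continuous_on_eq_continuous_at)
  then show ?case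
    by (simp add: continuous_at_imp_continuous_on)
next
  case (Suc k)
  have "f differentiable (at x)" if "x \<in> S" for x
    using Suc.prems[OF that] by auto
  moreover have "Ck_on k S (dd v f)" for v
  proof (rule Suc.IH)
    fix x assume "x \<in> S"
    from Suc.prems[OF this] show "\<exists>T. open T \<and> x \<in> T \<and> Ck_on k T (dd v f)" by auto
  qed
  ultimately show ?case by simp
qed

lemma Ck_on_linear:
  assumes "open S" "linear L" "Ck_on k S f"
  shows "Ck_on k S (\<lambda>x. L (f x))"
  using assms(3)
proof (induction k arbitrary: f)
  case 0
  then show ?case
    using linear_bounded_findim[OF assms(2)] by (auto intro: bounded_linear.continuous_on)
next
  case (Suc k)
  have d: "((\<lambda>x. L (f x)) has_derivative (\<lambda>v. L (dd v f x))) (at x)" if "x \<in> S" for x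
    by (rule bounded_linear.has_derivative[OF linear_bounded_findim[OF assms(2)] has_derivative_dd])
      (use that Suc.prems in auto)
  have "Ck_on k S (dd v (\<lambda>x. L (f x))) \<longleftrightarrow> Ck_on k S (\<lambda>x. L (dd v f x))" for v
    by (rule Ck_on_cong[OF assms(1)]) (rule dd_eqI[OF d])
  then show ?case
    using d Suc by (auto simp: differentiable_def)
qed

lemma Ck_on_const: "open S \<Longrightarrow> Ck_on k S (\<lambda>x. c)"
  by (induction k arbitrary: c) auto

lemma Ck_on_id: "open S \<Longrightarrow> Ck_on k S (\<lambda>x. x)"
  by (cases k) (auto simp: frechet_derivative_id Ck_on_const)

lemma Ck_on_add:
  assumes "open S" "Ck_on k S f" "Ck_on k S g"
  shows "Ck_on k S (\<lambda>x. f x + g x)"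
  using assms(2,3)
proof (induction k arbitrary: f g)
  case 0
  then show ?case by (auto intro: continuous_on_add)
next
  case (Suc k)
  have d: "((\<lambda>x. f x + g x) has_derivative (\<lambda>v. dd v f x + dd v g x)) (at x)" if "x \<in> S" for x
    using that Suc.prems by (auto intro!: has_derivative_add has_derivative_dd)
  have "Ck_on k S (dd v (\<lambda>x. f x + g x)) \<longleftrightarrow> Ck_on k S (\<lambda>x. dd v f x + dd v g x)" for v
    by (rule Ck_on_cong[OF assms(1)]) (rule dd_eqI[OF d])
  then show ?case
    using d Suc by (auto simp: differentiable_def)
qed

lemma Ck_on_sum:
  assumes "open S" "finite I" "\<And>i. i \<in> I \<Longrightarrow> Ck_on k S (f i)"
  shows "Ck_on k S (\<lambda>x. \<Sum>i\<in>I. f i x)"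
  using assms(2,3) by (induction rule: finite_induct) (auto intro: Ck_on_const Ck_on_add assms(1))

lemma Ck_on_scaleR:
  assumes "open S" "Ck_on k S c" "Ck_on k S f"
  shows "Ck_on k S (\<lambda>x. c x *\<^sub>R f x)"
  using assms(2,3)
proof (induction k arbitrary: c f)
  case 0
  then show ?case by (auto intro: continuous_on_scaleR)
next
  case (Suc k)
  have d: "((\<lambda>x. c x *\<^sub>R f x) has_derivative (\<lambda>v. c x *\<^sub>R dd v f x + dd v c x *\<^sub>R f x)) (at x)"
    if "x \<in> S" for x
    using that Suc.prems by (auto intro!: has_derivative_scaleR has_derivative_dd)
  have "Ck_on k S (dd v (\<lambda>x. c x *\<^sub>R f x)) \<longleftrightarrow>
      Ck_on k S (\<lambda>x. c x *\<^sub>R dd v f x + dd v c x *\<^sub>R f x)" for v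
    by (rule Ck_on_cong[OF assms(1)]) (rule dd_eqI[OF d])
  moreover have "Ck_on k S (\<lambda>x. c x *\<^sub>R dd v f x + dd v c x *\<^sub>R f x)" for v
    using Suc.prems Suc.prems[THEN Ck_on_SucD] by (intro Ck_on_add Suc.IH assms(1)) auto
  ultimately show ?case
    using d by (auto simp: differentiable_def)
qed

lemma dd_onb:
  "f differentiable (at x) \<Longrightarrow> dd v f x = (\<Sum>b\<in>onb. (v \<bullet> b) *\<^sub>R dd b f x)"
  by (rule linear_onb[OF linear_dd])

lemma dd_compose:
  assumes "f differentiable (at x)" "g differentiable (at (f x))"
  shows "dd v (\<lambda>x. g (f x)) x = (\<Sum>b\<in>onb. (dd v f x \<bullet> b) *\<^sub>R dd b g (f x))"
    and "(\<lambda>x. g (f x)) differentiable (at x)"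
    and "dd v (\<lambda>x. g (f x)) x = dd (dd v f x) g (f x)"
proof -
  have d: "((\<lambda>x. g (f x)) has_derivative (\<lambda>v. dd (dd v f x) g (f x))) (at x)"
    using diff_chain_at[OF has_derivative_dd[OF assms(1)] has_derivative_dd[OF assms(2)]]
    by (simp add: o_def)
  show 1: "dd v (\<lambda>x. g (f x)) x = dd (dd v f x) g (f x)" by (rule dd_eqI[OF d])
  show "dd v (\<lambda>x. g (f x)) x = (\<Sum>b\<in>onb. (dd v f x \<bullet> b) *\<^sub>R dd b g (f x))"
    unfolding 1 by (rule dd_onb[OF assms(2)])
  show "(\<lambda>x. g (f x)) differentiable (at x)" using d by (auto simp: differentiable_def)
qed

lemma linear_inner_right_const: "linear (\<lambda>x. x \<bullet> b)"
  by (intro linearI) (auto simp: inner_add_left)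

text \<open>The direction \<open>dd v f x\<close> in the chain rule varies with \<open>x\<close>.
  Expanding it over \<open>onb\<close> leaves products of scalar functions with derivatives of
  \<open>g\<close> in fixed directions, to which the induction hypothesis applies with the same
  \<open>f\<close>.\<close>

lemma Ck_on_compose:
  assumes "open S" "open T" "Ck_on k S f" "Ck_on k T g" "f ` S \<subseteq> T"
  shows "Ck_on k S (\<lambda>x. g (f x))"
  using assms(3,4)
proof (induction k arbitrary: g)
  case 0
  then show ?case using assms(5) by (auto intro: continuous_on_compose2)
next
  case (Suc k)
  have df: "f differentiable (at x)" "g differentiable (at (f x))" if "x \<in> S" for x
    using that Suc.prems assms(5) by auto
  have "Ck_on k S (dd v (\<lambda>x. g (f x))) \<longleftrightarrow>
      Ck_on k S (\<lambda>x. \<Sum>b\<in>onb. (dd v f x \<bullet> b) *\<^sub>R dd b g (f x))" for v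
    by (rule Ck_on_cong[OF assms(1)]) (rule dd_compose(1)[OF df])
  moreover have "Ck_on k S (\<lambda>x. \<Sum>b\<in>onb. (dd v f x \<bullet> b) *\<^sub>R dd b g (f x))" for v
  proof (intro Ck_on_sum Ck_on_scaleR assms finite_onb)
    show "Ck_on k S (\<lambda>x. dd v f x \<bullet> b)" for b
      by (rule Ck_on_linear[OF assms(1) linear_inner_right_const]) (use Suc.prems in auto)
    show "Ck_on k S (\<lambda>x. dd b g (f x))" for b
      using Suc.prems Ck_on_SucD[of k S f] by (intro Suc.IH) auto
  qed
  ultimately show ?case
    using dd_compose(2)[OF df] by auto
qed

section \<open>Smooth maps and jets\<close>

lemma smooth_onD: "smooth_on S f \<Longrightarrow> Ck_on k S f"
  by (simp add: smooth_on_def)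

lemma smooth_on_dd: "smooth_on S f \<Longrightarrow> smooth_on S (dd v f)"
  unfolding smooth_on_def by (metis Ck_on.simps(2))

lemma smooth_on_differentiable: "smooth_on S f \<Longrightarrow> x \<in> S \<Longrightarrow> f differentiable (at x)"
  using smooth_onD[of S f 1] by auto

lemma smooth_on_continuous: "smooth_on S f \<Longrightarrow> continuous_on S f"
  using smooth_onD[of S f 0] by auto

lemma smooth_on_iter_deriv: "smooth_on S f \<Longrightarrow> smooth_on S (iter_deriv vs f)"
  by (induction vs arbitrary: f) (auto intro: smooth_on_dd)

lemma smooth_on_cong: "open S \<Longrightarrow> (\<And>y. y \<in> S \<Longrightarrow> f y = g y) \<Longrightarrow> smooth_on S f \<longleftrightarrow> smooth_on S g"
  unfolding smooth_on_def using Ck_on_cong by metis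

lemma smooth_on_transform:
  "open S \<Longrightarrow> smooth_on S f \<Longrightarrow> (\<And>y. y \<in> S \<Longrightarrow> f y = g y) \<Longrightarrow> smooth_on S g"
  using smooth_on_cong by blast

lemma smooth_on_subset: "smooth_on S f \<Longrightarrow> T \<subseteq> S \<Longrightarrow> smooth_on T f"
  unfolding smooth_on_def using Ck_on_subset by metis

lemma smooth_on_local:
  "(\<And>x. x \<in> S \<Longrightarrow> \<exists>T. open T \<and> x \<in> T \<and> smooth_on T f) \<Longrightarrow> smooth_on S f"
  unfolding smooth_on_def by (intro allI Ck_on_local) blast

lemma smooth_on_linear: "open S \<Longrightarrow> linear L \<Longrightarrow> smooth_on S f \<Longrightarrow> smooth_on S (\<lambda>x. L (f x))"
  unfolding smooth_on_def using Ck_on_linear by blast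

lemma smooth_on_const: "open S \<Longrightarrow> smooth_on S (\<lambda>x. c)"
  unfolding smooth_on_def using Ck_on_const by blast

lemma smooth_on_id: "open S \<Longrightarrow> smooth_on S (\<lambda>x. x)"
  unfolding smooth_on_def using Ck_on_id by blast

lemma smooth_on_add:
  "open S \<Longrightarrow> smooth_on S f \<Longrightarrow> smooth_on S g \<Longrightarrow> smooth_on S (\<lambda>x. f x + g x)"
  unfolding smooth_on_def using Ck_on_add by blast

lemma smooth_on_sum:
  "open S \<Longrightarrow> finite I \<Longrightarrow> (\<And>i. i \<in> I \<Longrightarrow> smooth_on S (f i)) \<Longrightarrow> smooth_on S (\<lambda>x. \<Sum>i\<in>I. f i x)"
  unfolding smooth_on_def using Ck_on_sum by blast

lemma smooth_on_scaleR:
  "open S \<Longrightarrow> smooth_on S c \<Longrightarrow> smooth_on S f \<Longrightarrow> smooth_on S (\<lambda>x. c x *\<^sub>R f x)"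
  unfolding smooth_on_def using Ck_on_scaleR by blast

lemma smooth_on_compose:
  "open S \<Longrightarrow> open T \<Longrightarrow> smooth_on S f \<Longrightarrow> smooth_on T g \<Longrightarrow> f ` S \<subseteq> T \<Longrightarrow>
    smooth_on S (\<lambda>x. g (f x))"
  unfolding smooth_on_def using Ck_on_compose by blast

lemma smooth_on_inner_const:
  "open S \<Longrightarrow> smooth_on S f \<Longrightarrow> smooth_on S (\<lambda>x. f x \<bullet> c)"
  by (rule smooth_on_linear[OF _ linear_inner_right_const])

lemma smooth_on_diff:
  assumes "open S" "smooth_on S f" "smooth_on S g"
  shows "smooth_on S (\<lambda>x. f x - g x)"
proof -
  have "smooth_on S (\<lambda>x. f x + (- g x))"
    by (intro smooth_on_add assms smooth_on_linear[OF _ _ assms(3)] linearI) auto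
  then show ?thesis by simp
qed

lemma smooth_on_Pair:
  assumes "open S" "smooth_on S f" "smooth_on S g"
  shows "smooth_on S (\<lambda>x. (f x, g x))"
proof -
  have "smooth_on S (\<lambda>x. (f x, 0) + (0, g x))"
    by (intro smooth_on_add assms smooth_on_linear[OF assms(1) _ assms(2)]
        smooth_on_linear[OF assms(1) _ assms(3)] linearI) auto
  then show ?thesis by simp
qed

lemma open_slice: "open S \<Longrightarrow> open {y. (c, y) \<in> S}"
  using open_vimage[of S "Pair c"] by (simp add: vimage_def continuous_on_Pair)

lemma smooth_on_slice:
  assumes "open S" "smooth_on S f"
  shows "smooth_on {y. (c, y) \<in> S} (\<lambda>y. f (c, y))"
  by (intro smooth_on_compose[OF _ assms(1) _ assms(2)] smooth_on_Pair smooth_on_const smooth_on_id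
      open_slice assms) auto

lemma dd_slice:
  assumes "f differentiable (at (c, x))"
  shows "dd v (\<lambda>y. f (c, y)) x = dd (0, v) f (c, x)"
proof -
  have "((\<lambda>y. f (c, y)) has_derivative (\<lambda>v. dd (0, v) f (c, x))) (at x)"
    using diff_chain_at[OF has_derivative_Pair[OF has_derivative_const has_derivative_ident]
        has_derivative_dd[OF assms]] by (simp add: o_def)
  then show ?thesis by (rule dd_eqI)
qed

lemma dd_slice':
  assumes "f differentiable (at (x, c))"
  shows "dd v (\<lambda>y. f (y, c)) x = dd (v, 0) f (x, c)"
    and "(\<lambda>y. f (y, c)) differentiable (at x)"
proof -
  have *: "((\<lambda>y. f (y, c)) has_derivative (\<lambda>v. dd (v, 0) f (x, c))) (at x)"
    using diff_chain_at[OF has_derivative_Pair[OF has_derivative_ident has_derivative_const]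
        has_derivative_dd[OF assms]] by (simp add: o_def)
  then show "dd v (\<lambda>y. f (y, c)) x = dd (v, 0) f (x, c)" by (rule dd_eqI)
  show "(\<lambda>y. f (y, c)) differentiable (at x)"
    using * by (auto simp: differentiable_def)
qed

lemma iter_deriv_slice:
  assumes "open S" "smooth_on S f" "(c, x) \<in> S"
  shows "iter_deriv vs (\<lambda>y. f (c, y)) x = iter_deriv (map (Pair 0) vs) f (c, x)"
  using assms(2)
proof (induction vs arbitrary: f)
  case (Cons v vs)
  have "iter_deriv vs (dd v (\<lambda>y. f (c, y))) x = iter_deriv vs (\<lambda>y. dd (0, v) f (c, y)) x"
    by (rule iter_deriv_cong[OF open_slice[OF assms(1), of c]])
      (use assms(3) smooth_on_differentiable[OF Cons.prems] dd_slice[of f c] in auto)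
  also have "\<dots> = iter_deriv (map (Pair 0) vs) (dd (0, v) f) (c, x)"
    by (rule Cons.IH[OF smooth_on_dd[OF Cons.prems]])
  finally show ?case by simp
qed auto

lemma frechet_derivative_translate:
  "frechet_derivative (\<lambda>u. f (u + y)) (at x) = frechet_derivative f (at (x + y))"
proof -
  have shift: "((\<lambda>u. h (u + z)) has_derivative h') (at w)"
    if "(h has_derivative h') (at (w + z))" for h :: "'a \<Rightarrow> 'b" and h' w z
    using diff_chain_at[OF has_derivative_add[OF has_derivative_ident has_derivative_const] that]
    by (simp add: o_def)
  have "((\<lambda>u. f (u + y)) has_derivative f') (at x) \<longleftrightarrow> (f has_derivative f') (at (x + y))" for f'
    using shift[of f f' x y] shift[of "\<lambda>u. f (u + y)" f' "x + y" "- y"] by auto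
  then show ?thesis by (simp add: frechet_derivative_def)
qed

lemma iter_deriv_translate: "iter_deriv vs (\<lambda>u. f (u + y)) x = iter_deriv vs f (x + y)"
  by (induction vs arbitrary: f) (auto simp: frechet_derivative_translate)

lemma iter_deriv_snoc: "iter_deriv (vs @ [w]) f = dd w (iter_deriv vs f)"
  by (induction vs arbitrary: f) auto

section \<open>Equality of jets of maps between model spaces\<close>

definition agree :: "nat \<Rightarrow> ('a::findim_inner \<Rightarrow> 'b::findim_inner) \<Rightarrow> ('a \<Rightarrow> 'b) \<Rightarrow> 'a \<Rightarrow> bool" where
  "agree k f g x \<longleftrightarrow> (\<forall>vs. length vs \<le> k \<longrightarrow> iter_deriv vs f x = iter_deriv vs g x)"

lemma agree_0: "agree 0 f g x \<longleftrightarrow> f x = g x"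
  by (simp add: agree_def)

lemma agree_Suc: "agree (Suc k) f g x \<longleftrightarrow> f x = g x \<and> (\<forall>v. agree k (dd v f) (dd v g) x)"
proof
  assume "agree (Suc k) f g x"
  then have "iter_deriv vs f x = iter_deriv vs g x" if "length vs \<le> Suc k" for vs
    using that by (auto simp: agree_def)
  from this[of "[]"] this[of "_ # _"] show "f x = g x \<and> (\<forall>v. agree k (dd v f) (dd v g) x)"
    by (auto simp: agree_def)
next
  assume *: "f x = g x \<and> (\<forall>v. agree k (dd v f) (dd v g) x)"
  show "agree (Suc k) f g x"
    unfolding agree_def
  proof (intro allI impI)
    fix vs :: "'a list" assume "length vs \<le> Suc k"
    then show "iter_deriv vs f x = iter_deriv vs g x"
      using * by (cases vs) (auto simp: agree_def)
  qed
qed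

lemma agree_mono: "agree k f g x \<Longrightarrow> j \<le> k \<Longrightarrow> agree j f g x"
  by (auto simp: agree_def)

lemma agree_refl [simp]: "agree k f f x"
  by (simp add: agree_def)

lemma agree_cong:
  assumes "open S" "x \<in> S" "\<And>y. y \<in> S \<Longrightarrow> f y = f' y" "\<And>y. y \<in> S \<Longrightarrow> g y = g' y"
  shows "agree k f g x \<longleftrightarrow> agree k f' g' x"
  using iter_deriv_cong[OF assms(1,2), of f f'] iter_deriv_cong[OF assms(1,2), of g g'] assms(3,4)
  by (simp add: agree_def)

lemma dd_add: "f differentiable (at x) \<Longrightarrow> g differentiable (at x) \<Longrightarrow>
    dd v (\<lambda>x. f x + g x) x = dd v f x + dd v g x"
  by (rule dd_eqI[OF has_derivative_add[OF has_derivative_dd has_derivative_dd]])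

lemma dd_scaleR: "c differentiable (at x) \<Longrightarrow> f differentiable (at x) \<Longrightarrow>
    dd v (\<lambda>x. c x *\<^sub>R f x) x = c x *\<^sub>R dd v f x + dd v c x *\<^sub>R f x"
  by (rule dd_eqI[OF has_derivative_scaleR[OF has_derivative_dd has_derivative_dd]])

lemma dd_linear: "linear L \<Longrightarrow> f differentiable (at x) \<Longrightarrow> dd v (\<lambda>x. L (f x)) x = L (dd v f x)"
  by (rule dd_eqI[OF bounded_linear.has_derivative[OF linear_bounded_findim has_derivative_dd]])

lemma agree_linear:
  assumes "linear L" "open S" "x \<in> S" "smooth_on S f" "smooth_on S g" "agree k f g x"
  shows "agree k (\<lambda>x. L (f x)) (\<lambda>x. L (g x)) x"
  using assms(4-)
proof (induction k arbitrary: f g)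
  case (Suc k)
  note diff = Suc.prems(1,2)[THEN smooth_on_differentiable]
  have "agree k (dd v (\<lambda>x. L (f x))) (dd v (\<lambda>x. L (g x))) x" for v
  proof -
    have "agree k (\<lambda>x. L (dd v f x)) (\<lambda>x. L (dd v g x)) x"
      using Suc.prems by (intro Suc.IH smooth_on_dd) (auto simp: agree_Suc)
    then show ?thesis
      by (subst agree_cong[OF assms(2,3) dd_linear[OF assms(1) diff(1)] dd_linear[OF assms(1) diff(2)]])
  qed
  then show ?case using Suc.prems by (simp add: agree_Suc)
qed (simp add: agree_0)

lemma agree_add:
  assumes "open S" "x \<in> S" "smooth_on S f" "smooth_on S f'" "smooth_on S g" "smooth_on S g'"
    "agree k f f' x" "agree k g g' x"
  shows "agree k (\<lambda>x. f x + g x) (\<lambda>x. f' x + g' x) x"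
  using assms(3-)
proof (induction k arbitrary: f f' g g')
  case (Suc k)
  note diff = Suc.prems(1-4)[THEN smooth_on_differentiable]
  have "agree k (dd v (\<lambda>x. f x + g x)) (dd v (\<lambda>x. f' x + g' x)) x" for v
  proof -
    have "agree k (\<lambda>x. dd v f x + dd v g x) (\<lambda>x. dd v f' x + dd v g' x) x"
      using Suc.prems by (intro Suc.IH smooth_on_dd) (auto simp: agree_Suc)
    then show ?thesis
      by (subst agree_cong[OF assms(1,2) dd_add[OF diff(1) diff(3)] dd_add[OF diff(2) diff(4)]])
  qed
  then show ?case using Suc.prems by (simp add: agree_Suc)
qed (simp add: agree_0)

lemma agree_sum:
  assumes "open S" "x \<in> S" "finite I" "\<And>i. i \<in> I \<Longrightarrow> smooth_on S (f i)"
    "\<And>i. i \<in> I \<Longrightarrow> smooth_on S (g i)" "\<And>i. i \<in> I \<Longrightarrow> agree k (f i) (g i) x"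
  shows "agree k (\<lambda>x. \<Sum>i\<in>I. f i x) (\<lambda>x. \<Sum>i\<in>I. g i x) x"
  using assms(3-)
proof (induction rule: finite_induct)
  case (insert i I)
  then show ?case
    by (simp, intro agree_add[OF assms(1,2)] smooth_on_sum[OF assms(1)]) auto
qed simp

lemma agree_scaleR:
  assumes "open S" "x \<in> S" "smooth_on S c" "smooth_on S c'" "smooth_on S f" "smooth_on S f'"
    "agree k c c' x" "agree k f f' x"
  shows "agree k (\<lambda>x. c x *\<^sub>R f x) (\<lambda>x. c' x *\<^sub>R f' x) x"
  using assms(3-)
proof (induction k arbitrary: c c' f f')
  case (Suc k)
  note diff = Suc.prems(1-4)[THEN smooth_on_differentiable]
  note low = Suc.prems(5,6)[THEN agree_mono[of _ _ _ _ k]]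
  have "agree k (dd v (\<lambda>x. c x *\<^sub>R f x)) (dd v (\<lambda>x. c' x *\<^sub>R f' x)) x" for v
  proof -
    have "agree k (\<lambda>x. c x *\<^sub>R dd v f x + dd v c x *\<^sub>R f x)
        (\<lambda>x. c' x *\<^sub>R dd v f' x + dd v c' x *\<^sub>R f' x) x"
      using Suc.prems low
      by (intro agree_add[OF assms(1,2)] Suc.IH smooth_on_scaleR[OF assms(1)] smooth_on_dd)
        (auto simp: agree_Suc)
    then show ?thesis
      by (subst agree_cong[OF assms(1,2) dd_scaleR[OF diff(1) diff(3)] dd_scaleR[OF diff(2) diff(4)]])
  qed
  then show ?case using Suc.prems by (simp add: agree_Suc)
qed (simp add: agree_0)

text \<open>Induction through the chain rule expanded over \<open>onb\<close>. The factor
  \<open>dd b g (f x)\<close> is covered by the induction hypothesis, since \<open>f\<close> and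
  \<open>f'\<close> agree to order \<open>Suc k\<close> and hence to order \<open>k\<close>.\<close>

lemma agree_compose:
  assumes "open S" "x \<in> S" "smooth_on S f" "smooth_on S f'" "f ` S \<subseteq> T" "f' ` S \<subseteq> T"
    "open T" "smooth_on T g" "smooth_on T g'" "agree k f f' x" "agree k g g' (f x)"
  shows "agree k (\<lambda>x. g (f x)) (\<lambda>x. g' (f' x)) x"
  using assms(8-)
proof (induction k arbitrary: g g')
  case 0
  then show ?case by (simp add: agree_0)
next
  case (Suc k)
  have diff: "f differentiable (at y)" "g differentiable (at (f y))"
      "f' differentiable (at y)" "g' differentiable (at (f' y))" if "y \<in> S" for y
    using smooth_on_differentiable that assms(3-6) Suc.prems(1,2) by blast+
  have "agree k (dd v (\<lambda>x. g (f x))) (dd v (\<lambda>x. g' (f' x))) x" for v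
  proof -
    have f: "smooth_on S (dd v f)" "smooth_on S (dd v f')" "agree k (dd v f) (dd v f') x"
      using Suc.prems assms(3,4) by (auto simp: agree_Suc intro: smooth_on_dd)
    have "agree k (\<lambda>x. \<Sum>b\<in>onb. (dd v f x \<bullet> b) *\<^sub>R dd b g (f x))
        (\<lambda>x. \<Sum>b\<in>onb. (dd v f' x \<bullet> b) *\<^sub>R dd b g' (f' x)) x"
    proof (intro agree_sum[OF assms(1,2)] agree_scaleR[OF assms(1,2)] smooth_on_scaleR[OF assms(1)]
          smooth_on_inner_const[OF assms(1)] f finite_onb)
      fix b :: 'b
      show "agree k (\<lambda>x. dd v f x \<bullet> b) (\<lambda>x. dd v f' x \<bullet> b) x"
        by (rule agree_linear[OF linear_inner_right_const assms(1,2) f])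
      show "agree k (\<lambda>x. dd b g (f x)) (\<lambda>x. dd b g' (f' x)) x"
        using Suc.prems agree_mono[of "Suc k" f f' x k]
        by (intro Suc.IH smooth_on_dd) (auto simp: agree_Suc)
    qed (rule smooth_on_compose[OF assms(1,7,3) smooth_on_dd[OF Suc.prems(1)] assms(5)]
        smooth_on_compose[OF assms(1,7,4) smooth_on_dd[OF Suc.prems(2)] assms(6)])+
    then show ?thesis
      by (subst agree_cong[OF assms(1,2) dd_compose(1)[OF diff(1,2)] dd_compose(1)[OF diff(3,4)]])
  qed
  then show ?case using Suc.prems by (simp add: agree_Suc agree_0)
qed

text \<open>For smooth maps, iterated derivatives are linear in each direction, so lists of basis
  vectors decide about the whole jet.\<close>

lemma agree_onbI:
  assumes "open S" "x \<in> S" "smooth_on S f" "smooth_on S g"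
    "\<And>vs. set vs \<subseteq> onb \<Longrightarrow> length vs \<le> k \<Longrightarrow> iter_deriv vs f x = iter_deriv vs g x"
  shows "agree k f g x"
  using assms(3-)
proof (induction k arbitrary: f g)
  case 0
  from "0.prems"(3)[of "[]"] show ?case by (simp add: agree_0)
next
  case (Suc k)
  note diff = Suc.prems(1,2)[THEN smooth_on_differentiable]
  have *: "agree k (dd b f) (dd b g) x" if "b \<in> onb" for b
    using Suc.prems(3)[of "b # _"] that by (intro Suc.IH smooth_on_dd Suc.prems) auto
  have "agree k (dd v f) (dd v g) x" for v
  proof -
    have "agree k (\<lambda>x. \<Sum>b\<in>onb. (v \<bullet> b) *\<^sub>R dd b f x) (\<lambda>x. \<Sum>b\<in>onb. (v \<bullet> b) *\<^sub>R dd b g x) x"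
      using * by (intro agree_sum[OF assms(1,2)] agree_scaleR[OF assms(1,2)] smooth_on_scaleR[OF assms(1)]
          smooth_on_const[OF assms(1)] smooth_on_dd Suc.prems) auto
    then show ?thesis
      by (subst agree_cong[OF assms(1,2) dd_onb[OF diff(1)] dd_onb[OF diff(2)]])
  qed
  then show ?case using Suc.prems(3)[of "[]"] by (simp add: agree_Suc)
qed

section \<open>Symmetry of second derivatives\<close>

lemma norm_diff_le_of_vector_derivative:
  fixes h :: "real \<Rightarrow> 'a::real_normed_vector"
  assumes "convex S" "\<And>s. s \<in> S \<Longrightarrow> (h has_vector_derivative h' s) (at s within S)"
    "\<And>s. s \<in> S \<Longrightarrow> norm (h' s) \<le> B" "x \<in> S" "y \<in> S"
  shows "norm (h x - h y) \<le> B * norm (x - y)"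
proof (rule differentiable_bound[OF assms(1)])
  show "(h has_derivative (\<lambda>r. r *\<^sub>R h' s)) (at s within S)" if "s \<in> S" for s
    using assms(2)[OF that] by (simp add: has_vector_derivative_def)
  show "onorm (\<lambda>r. r *\<^sub>R h' s) \<le> B" if "s \<in> S" for s
    using assms(3)[OF that] order_trans[OF norm_ge_zero assms(3)[OF that]]
    by (intro onorm_bound) (auto simp: mult.commute[of B] intro: mult_left_mono)
qed (use assms in auto)

text \<open>
  The left-hand side apart from the derivative is symmetric in \<open>v\<close> and \<open>w\<close>, which gives the
  symmetry of second derivatives.
\<close>

lemma second_difference_bound:
  assumes "open S" "x \<in> S" "\<And>y. y \<in> S \<Longrightarrow> f differentiable (at y)"
    and d2: "dd v f differentiable (at x)" and "e > 0"
  shows "\<exists>d>0. \<forall>t. 0 < t \<and> t < d \<longrightarrow>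
    norm (f (x + t *\<^sub>R v + t *\<^sub>R w) - f (x + t *\<^sub>R v) - f (x + t *\<^sub>R w) + f x - (t * t) *\<^sub>R dd w (dd v f) x)
      \<le> e * (t * t)"
proof -
  \<comment> \<open>Two remainders below are each at most e / c times t (norm v + norm w); with this
    \<open>c\<close> their sum is at most e t. The 1 keeps \<open>c\<close> positive if both vectors
    vanish.\<close>
  define c where "c = 2 * (norm v + norm w) + 1"
  have c: "c > 0" by (simp add: c_def add_nonneg_pos)
  let ?A = "\<lambda>h. dd h (dd v f) x"
  have "(dd v f has_derivative ?A) (at x)"
    by (rule has_derivative_dd[OF d2])
  then obtain d1 where d1: "d1 > 0" and
    A: "\<And>y. norm (y - x) < d1 \<Longrightarrow> norm (dd v f y - dd v f x - ?A (y - x)) \<le> e / c * norm (y - x)"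
    using \<open>e > 0\<close> c unfolding has_derivative_at_alt by (meson divide_pos_pos)
  obtain d2 where d2: "d2 > 0" "ball x d2 \<subseteq> S"
    using assms(1,2) open_contains_ball by blast
  define d where "d = min d1 d2 / c"
  have d: "d > 0" using d1 d2 c by (simp add: d_def)
  have lin: "linear ?A" using linear_dd[OF \<open>dd v f differentiable (at x)\<close>] .
  show ?thesis
  proof (intro exI[of _ d] conjI allI impI d)
    fix t :: real assume t: "0 < t \<and> t < d"
    have small: "norm (s *\<^sub>R v + r *\<^sub>R w) \<le> t * (norm v + norm w)" and
      small': "norm (s *\<^sub>R v + r *\<^sub>R w) < min d1 d2" if "0 \<le> s" "s \<le> t" "0 \<le> r" "r \<le> t" for s r
    proof -
      have "norm (s *\<^sub>R v + r *\<^sub>R w) \<le> s * norm v + r * norm w"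
        using norm_triangle_ineq[of "s *\<^sub>R v" "r *\<^sub>R w"] that by simp
      also have "\<dots> \<le> t * norm v + t * norm w"
        using that by (intro add_mono mult_right_mono) auto
      finally show 1: "norm (s *\<^sub>R v + r *\<^sub>R w) \<le> t * (norm v + norm w)"
        by (simp add: algebra_simps)
      also have "\<dots> \<le> t * c" using t by (intro mult_left_mono) (auto simp: c_def)
      also have "\<dots> < d * c" using t c by simp
      finally show "norm (s *\<^sub>R v + r *\<^sub>R w) < min d1 d2" using c by (simp add: d_def)
    qed
    have inS: "x + s *\<^sub>R v + r *\<^sub>R w \<in> S" if "0 \<le> s" "s \<le> t" "0 \<le> r" "r \<le> t" for s r
    proof -
      have "x + s *\<^sub>R v + r *\<^sub>R w \<in> ball x d2"
        using small'[OF that] by (simp add: dist_norm norm_minus_commute algebra_simps)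
      then show ?thesis using d2 by blast
    qed
    \<comment> \<open>The quantity to be estimated is h t - h 0, and \<open>h'\<close> is a
      difference of two first order remainders of \<open>dd v f\<close> at \<open>x\<close>.\<close>
    define h where "h = (\<lambda>s. f (x + s *\<^sub>R v + t *\<^sub>R w) - f (x + s *\<^sub>R v) - (s * t) *\<^sub>R ?A w)"
    define h' where "h' = (\<lambda>s. dd v f (x + s *\<^sub>R v + t *\<^sub>R w) - dd v f (x + s *\<^sub>R v) - t *\<^sub>R ?A w)"
    have line: "((\<lambda>s. f (x + s *\<^sub>R v + z)) has_vector_derivative dd v f (x + s *\<^sub>R v + z)) (at s within {0..t})"
      if "x + s *\<^sub>R v + z \<in> S" for s z
    proof -
      have "((\<lambda>s. x + s *\<^sub>R v + z) has_derivative (\<lambda>s. s *\<^sub>R v)) (at s within {0..t})"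
        by (auto intro!: derivative_eq_intros)
      from has_derivative_compose[OF this has_derivative_dd[OF assms(3)[OF that]]]
      show ?thesis
        using linear_cmul[OF linear_dd[OF assms(3)[OF that]]]
        by (simp add: has_vector_derivative_def)
    qed
    have "(h has_vector_derivative h' s) (at s within {0..t})" if "s \<in> {0..t}" for s
    proof -
      have "((\<lambda>s. (s * t) *\<^sub>R ?A w) has_vector_derivative t *\<^sub>R ?A w) (at s within {0..t})"
        by (auto intro!: derivative_eq_intros simp: has_vector_derivative_def)
      with line[of s "t *\<^sub>R w"] line[of s 0] show ?thesis
        unfolding h_def h'_def using inS[of s t] inS[of s 0] that t
        by (auto intro!: has_vector_derivative_diff)
    qed
    moreover have "norm (h' s) \<le> e * t" if "s \<in> {0..t}" for s
    proof -
      have s: "0 \<le> s" "s \<le> t" using that by auto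
      have 1: "norm (dd v f (x + s *\<^sub>R v + t *\<^sub>R w) - dd v f x - ?A (s *\<^sub>R v + t *\<^sub>R w))
          \<le> e / c * (t * (norm v + norm w))"
      proof -
        have eq: "x + s *\<^sub>R v + t *\<^sub>R w - x = s *\<^sub>R v + t *\<^sub>R w" by simp
        show ?thesis
          using A[of "x + s *\<^sub>R v + t *\<^sub>R w", unfolded eq] small'[of s t] s t \<open>e > 0\<close> c
            mult_left_mono[OF small[of s t], of "e / c"] by simp
      qed
      have 2: "norm (dd v f (x + s *\<^sub>R v) - dd v f x - ?A (s *\<^sub>R v)) \<le> e / c * (t * (norm v + norm w))"
      proof -
        have eq: "x + s *\<^sub>R v - x = s *\<^sub>R v" by simp
        show ?thesis
          using A[of "x + s *\<^sub>R v", unfolded eq] small'[of s 0] s t \<open>e > 0\<close> c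
            mult_left_mono[OF small[of s 0], of "e / c"] by simp
      qed
      have "h' s = (dd v f (x + s *\<^sub>R v + t *\<^sub>R w) - dd v f x - ?A (s *\<^sub>R v + t *\<^sub>R w))
          - (dd v f (x + s *\<^sub>R v) - dd v f x - ?A (s *\<^sub>R v))"
        using linear_add[OF lin, of "s *\<^sub>R v" "t *\<^sub>R w"] linear_cmul[OF lin, of t w]
        by (simp add: h'_def)
      then have "norm (h' s) \<le> e / c * (t * (norm v + norm w)) + e / c * (t * (norm v + norm w))"
        using norm_triangle_ineq4 1 2 by (smt (verit, ccfv_threshold))
      also have "\<dots> = e * t * ((2 * (norm v + norm w)) / c)"
        by (simp add: field_simps)
      also have "\<dots> \<le> e * t * 1"
        using \<open>e > 0\<close> t c by (intro mult_left_mono) (auto simp: c_def)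
      finally show ?thesis by simp
    qed
    ultimately have "norm (h t - h 0) \<le> e * t * norm (t - 0)"
      using t by (intro norm_diff_le_of_vector_derivative[of "{0..t}"]) auto
    then show "norm (f (x + t *\<^sub>R v + t *\<^sub>R w) - f (x + t *\<^sub>R v) - f (x + t *\<^sub>R w) + f x
        - (t * t) *\<^sub>R dd w (dd v f) x) \<le> e * (t * t)"
      using t by (simp add: h_def algebra_simps)
  qed
qed

lemma dd_commute:
  assumes "open S" "x \<in> S" "smooth_on S f"
  shows "dd v (dd w f) x = dd w (dd v f) x"
proof (rule ccontr)
  assume ne: "dd v (dd w f) x \<noteq> dd w (dd v f) x"
  \<comment> \<open>Both mixed derivatives approximate the same second difference up to e t^2, so
    their distance 3 e would be at most 2 e.\<close>
  define e where "e = norm (dd v (dd w f) x - dd w (dd v f) x) / 3"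
  have e: "e > 0" using ne by (simp add: e_def)
  note diff = smooth_on_differentiable[OF assms(3)]
    smooth_on_differentiable[OF smooth_on_dd[OF assms(3)] assms(2)]
  from second_difference_bound[OF assms(1,2) diff(1) diff(2) e, of v w]
  obtain d1 where d1: "d1 > 0" "\<And>t. 0 < t \<Longrightarrow> t < d1 \<Longrightarrow>
    norm (f (x + t *\<^sub>R v + t *\<^sub>R w) - f (x + t *\<^sub>R v) - f (x + t *\<^sub>R w) + f x - (t * t) *\<^sub>R dd w (dd v f) x)
      \<le> e * (t * t)" by blast
  from second_difference_bound[OF assms(1,2) diff(1) diff(2) e, of w v]
  obtain d2 where d2: "d2 > 0" "\<And>t. 0 < t \<Longrightarrow> t < d2 \<Longrightarrow>
    norm (f (x + t *\<^sub>R w + t *\<^sub>R v) - f (x + t *\<^sub>R w) - f (x + t *\<^sub>R v) + f x - (t * t) *\<^sub>R dd v (dd w f) x)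
      \<le> e * (t * t)" by blast
  define t where "t = min d1 d2 / 2"
  have t: "0 < t" "t < d1" "t < d2" using d1 d2 by (auto simp: t_def)
  define D where "D = f (x + t *\<^sub>R v + t *\<^sub>R w) - f (x + t *\<^sub>R v) - f (x + t *\<^sub>R w) + f x"
  have 1: "norm (D - (t * t) *\<^sub>R dd w (dd v f) x) \<le> e * (t * t)"
    using d1(2)[OF t(1,2)] by (simp add: D_def)
  have 2: "norm (D - (t * t) *\<^sub>R dd v (dd w f) x) \<le> e * (t * t)"
    using d2(2)[OF t(1,3)] by (simp add: D_def add.commute add.left_commute algebra_simps)
  have "(t * t) * (3 * e) = norm ((D - (t * t) *\<^sub>R dd w (dd v f) x) - (D - (t * t) *\<^sub>R dd v (dd w f) x))"
    using t by (simp add: e_def flip: scaleR_diff_right)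
  also have "\<dots> \<le> 2 * (e * (t * t))"
    using norm_triangle_ineq4[of "D - (t * t) *\<^sub>R dd w (dd v f) x" "D - (t * t) *\<^sub>R dd v (dd w f) x"] 1 2
    by linarith
  finally show False using e t by (simp add: algebra_simps)
qed

text \<open>Used to exchange a derivative in the parameter with derivatives in the point.\<close>

lemma dd_iter_deriv:
  assumes "open S" "x \<in> S" "smooth_on S f"
  shows "dd w (iter_deriv vs f) x = iter_deriv vs (dd w f) x"
  using assms(3)
proof (induction vs arbitrary: f)
  case (Cons v vs)
  have "iter_deriv vs (dd w (dd v f)) x = iter_deriv vs (dd v (dd w f)) x"
    by (rule iter_deriv_cong[OF assms(1,2)]) (rule dd_commute[OF assms(1) _ Cons.prems])
  then show ?case using Cons.IH[OF smooth_on_dd[OF Cons.prems]] by simp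
qed auto

section \<open>Families of constant rank\<close>

interpretation findim_pair: finite_dimensional_vector_space_pair_1
  "scaleR :: real \<Rightarrow> 'a::findim_inner \<Rightarrow> 'a" onb "scaleR :: real \<Rightarrow> 'b::real_vector \<Rightarrow> 'b"
  by unfold_locales

abbreviation xderiv :: "'e list \<Rightarrow> ('v::findim_inner \<times> 'e::findim_inner \<Rightarrow> 'f::findim_inner) \<Rightarrow> 'v \<times> 'e \<Rightarrow> 'f" where
  "xderiv vs \<equiv> iter_deriv (map (Pair 0) vs)"

text \<open>
  The kernel of the derivative of \<open>g \<mapsto> (\<partial>\<^sub>x\<^sup>\<alpha> f (g, x))\<close>, \<open>|\<alpha>| < k\<close>. Differentiating first in
  \<open>g\<close>, it consists of the \<open>v\<close> for which \<open>\<partial>\<^sub>v f (g, \<cdot>)\<close> vanishes to order \<open>k\<close> at \<open>x\<close>.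
\<close>

definition jker :: "nat \<Rightarrow> ('v::findim_inner \<times> 'e::findim_inner \<Rightarrow> 'f::findim_inner) \<Rightarrow> 'v \<times> 'e \<Rightarrow> 'v set" where
  "jker k f p = {v. \<forall>vs. length vs < k \<longrightarrow> dd (v, 0) (xderiv vs f) p = 0}"

lemma jker_0 [simp]: "jker 0 f p = UNIV"
  by (simp add: jker_def)

lemma jker_mono: "j \<le> k \<Longrightarrow> jker k f p \<subseteq> jker j f p"
  by (auto simp: jker_def)

lemma subspace_jker:
  assumes "smooth_on S f" "p \<in> S"
  shows "subspace (jker k f p)"
proof -
  have lin: "linear (\<lambda>u. dd u (xderiv vs f) p)" for vs
    by (rule linear_dd[OF smooth_on_differentiable[OF smooth_on_iter_deriv[OF assms(1)] assms(2)]])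
  show ?thesis
    unfolding jker_def
    using linear_0[OF lin] linear_add[OF lin, of _ "(_, 0)" "(_, 0)"] linear_cmul[OF lin, of _ _ "(_, 0)"]
    by (auto intro!: subspaceI simp: zero_prod_def)
qed

lemma iter_deriv_zero: "iter_deriv vs (\<lambda>x. 0) x = 0"
  by (induction vs) auto

text \<open>Symmetry of derivatives moves the parameter derivative inside. Note the shift:
  \<open>jker (Suc k)\<close> tests lists shorter than \<open>Suc k\<close>, which are those of
  length at most \<open>k\<close> tested by \<open>agree k\<close>.\<close>

lemma jker_Suc_iff:
  assumes "open S" "smooth_on S f" "(c, x) \<in> S"
  shows "v \<in> jker (Suc k) f (c, x) \<longleftrightarrow> agree k (\<lambda>y. dd (v, 0) f (c, y)) (\<lambda>y. 0) x"
proof -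
  have "dd (v, 0) (xderiv vs f) (c, x) = iter_deriv vs (\<lambda>y. dd (v, 0) f (c, y)) x" for vs
    using dd_iter_deriv[OF assms(1,3,2)] iter_deriv_slice[OF assms(1) smooth_on_dd[OF assms(2)] assms(3)]
    by metis
  then show ?thesis
    by (simp add: jker_def agree_def iter_deriv_zero less_Suc_eq_le)
qed

text \<open>Finitely many conditions that still determine the kernel, by \<open>jker_onbI\<close>;
  finiteness permits the sum over them in \<open>normal_form\<close>.\<close>

definition onb_lists :: "nat \<Rightarrow> 'a::findim_inner list set" where
  "onb_lists k = {vs. set vs \<subseteq> onb \<and> length vs < k}"

lemma finite_onb_lists [simp]: "finite (onb_lists k)"
  by (rule finite_subset[OF _ finite_lists_length_le[OF finite_onb, of k]]) (auto simp: onb_lists_def)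

lemma jker_onbI:
  assumes "open S" "smooth_on S f" "p \<in> S"
    "\<And>vs. vs \<in> onb_lists k \<Longrightarrow> dd (v, 0) (xderiv vs f) p = 0"
  shows "v \<in> jker k f p"
proof (cases k)
  case (Suc j)
  obtain c x where p: "p = (c, x)" by (cases p)
  note sl = smooth_on_slice[OF assms(1) smooth_on_dd[OF assms(2)], of c]
  have "agree j (\<lambda>y. dd (v, 0) f (c, y)) (\<lambda>y. 0) x"
  proof (rule agree_onbI[OF open_slice[OF assms(1)] _ sl smooth_on_const])
    fix vs :: "'b list" assume "set vs \<subseteq> onb" "length vs \<le> j"
    then have "dd (v, 0) (xderiv vs f) p = 0"
      by (intro assms) (auto simp: onb_lists_def Suc)
    then show "iter_deriv vs (\<lambda>y. dd (v, 0) f (c, y)) x = iter_deriv vs (\<lambda>y. 0) x"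
      using dd_iter_deriv[OF assms(1,3,2)] iter_deriv_slice[OF assms(1) smooth_on_dd[OF assms(2)], of c x]
        assms(3)
      by (simp add: p iter_deriv_zero)
  qed (use assms(1,3) open_slice p in auto)
  then show ?thesis
    unfolding Suc p using jker_Suc_iff[OF assms(1,2), of c x] assms(3) p by blast
qed simp

text \<open>
  With \<open>P\<close> a projection onto the kernel of \<open>T\<close>, the derivative of \<open>f\<close>'s jet in \<open>g\<close>, the map
  \<open>P + T\<^sup>*T\<close> is injective, as the range of \<open>T\<^sup>*T\<close> is orthogonal to the kernel of \<open>T\<close>. So
  \<open>H = (P + T\<^sup>*T)\<^sup>-\<^sup>1 (P g + T\<^sup>* (jet of f))\<close> is tangent to the identity in \<open>g\<close>.
\<close>

lemma normal_form:
  fixes f :: "'v::findim_inner \<times> 'e::findim_inner \<Rightarrow> 'f::findim_inner"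
  assumes "open S" "smooth_on S f" "p0 \<in> S"
  obtains P :: "'v \<Rightarrow> 'v" and H where "linear P" "\<And>v. P v \<in> jker k f p0"
    "smooth_on S H" "\<And>v. dd (v, 0) H p0 = v"
    "\<And>p v. p \<in> S \<Longrightarrow> v \<in> jker k f p \<Longrightarrow> dd (v, 0) H p = P v"
    "\<And>p. p \<in> S \<Longrightarrow> (\<And>vs. length vs < k \<Longrightarrow> xderiv vs f p = 0) \<Longrightarrow> H p = P (fst p)"
    "\<And>p w. p \<in> S \<Longrightarrow> (\<And>vs. length vs \<le> k \<Longrightarrow> xderiv vs f p = 0) \<Longrightarrow> dd (0, w) H p = 0"
proof -
  let ?K = "jker k f p0"
  note sub = subspace_jker[OF assms(2,3)]
  \<comment> \<open>A linear retraction onto the kernel, obtained as a left inverse of the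
    inclusion.\<close>
  have "\<exists>P. P ` UNIV \<subseteq> ?K \<and> linear P \<and> (\<forall>v\<in>?K. P (id v) = v)"
    by (rule linear_exists_left_inverse_on) (auto simp: sub linear_ident)
  then obtain P where P: "linear P" "\<And>v. P v \<in> ?K" "\<And>v. v \<in> ?K \<Longrightarrow> P v = v"
    by (auto simp: image_subset_iff)
  have smooth: "smooth_on S (xderiv vs f)" for vs
    by (rule smooth_on_iter_deriv[OF assms(2)])
  have diff: "xderiv vs f differentiable (at p)" if "p \<in> S" for vs p
    by (rule smooth_on_differentiable[OF smooth that])
  define T where "T = (\<lambda>vs v. dd (v, 0) (xderiv vs f) p0)"
  have linT: "linear (T vs)" for vs
    using linear_compose[OF _ linear_dd[OF diff[OF assms(3)]], of "\<lambda>v. (v, 0)"]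
    by (simp add: T_def o_def linear_iff)
  \<comment> \<open>The adjoint of \<open>T\<close> on families indexed by
    \<open>onb_lists k\<close>; \<open>A_inner\<close> is the adjoint identity.\<close>
  define A where "A = (\<lambda>F::'e list \<Rightarrow> 'f. \<Sum>vs\<in>onb_lists k. \<Sum>b\<in>onb. (F vs \<bullet> T vs b) *\<^sub>R b)"
  have A_inner: "A F \<bullet> v = (\<Sum>vs\<in>onb_lists k. F vs \<bullet> T vs v)" for F v
  proof -
    have "(\<Sum>b\<in>onb. (F vs \<bullet> T vs b) *\<^sub>R b) \<bullet> v = F vs \<bullet> T vs v" for vs
      by (subst (2) linear_onb[OF linT])
        (simp add: inner_sum_left inner_sum_right inner_commute mult.commute)
    then show ?thesis by (simp add: A_def inner_sum_left)
  qed
  define Q where "Q = (\<lambda>v. P v + A (\<lambda>vs. T vs v))"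
  have linQ: "linear Q"
    unfolding Q_def A_def
    by (intro linearI)
      (simp_all add: linear_add[OF P(1)] linear_cmul[OF P(1)] linear_add[OF linT] linear_cmul[OF linT]
        inner_add_left scaleR_add_left sum.distrib scaleR_sum_right algebra_simps)
  have kerT: "T vs v = 0" if "v \<in> ?K" "vs \<in> onb_lists k" for v vs
    using that by (auto simp: jker_def onb_lists_def T_def)
  \<comment> \<open>Pairing with \<open>P v\<close>, which \<open>T\<close> annihilates, kills the
    adjoint term and gives P v = 0. Pairing with \<open>v\<close> then gives a vanishing sum of
    squares, so \<open>v\<close> lies in the kernel, where \<open>P\<close> is the identity.\<close>
  have "v = 0" if "Q v = 0" for v
  proof -
    have "A (\<lambda>vs. T vs v) \<bullet> P v = 0"
      using kerT[OF P(2)] by (simp add: A_inner)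
    then have "P v \<bullet> P v = 0"
      using arg_cong[OF that, of "\<lambda>z. z \<bullet> P v"] by (simp add: Q_def inner_add_left)
    then have Pv: "P v = 0" by simp
    then have "A (\<lambda>vs. T vs v) \<bullet> v = 0" using that by (simp add: Q_def)
    then have "T vs v = 0" if "vs \<in> onb_lists k" for vs
      using that by (simp add: A_inner sum_nonneg_eq_0_iff)
    then have "v \<in> ?K"
      unfolding T_def by (intro jker_onbI[OF assms(1-3)])
    then show "v = 0" using P(3) Pv by simp
  qed
  then have "inj Q" using linear_injective_0[OF linQ] by blast
  then obtain L where L: "linear L" "\<And>v. L (Q v) = v"
    using linear_injective_left_inverse[OF linQ] by (metis comp_apply id_apply)
  \<comment> \<open>\<open>Q\<close> is the identity on the kernel, hence so is its left
    inverse.\<close>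
  have LP: "L (P v) = P v" for v
  proof -
    have "Q (P v) = P v" using kerT[OF P(2)] P(3)[OF P(2)] by (simp add: Q_def A_def)
    then show ?thesis using L(2)[of "P v"] by simp
  qed
  define H where "H = (\<lambda>p. L (P (fst p) + A (\<lambda>vs. xderiv vs f p)))"
  have dH: "dd u H p = L (P (fst u) + A (\<lambda>vs. dd u (xderiv vs f) p))" if "p \<in> S" for u p
  proof (rule dd_eqI)
    have "((\<lambda>p. (xderiv vs f p \<bullet> T vs b) *\<^sub>R b) has_derivative
        (\<lambda>u. (dd u (xderiv vs f) p \<bullet> T vs b) *\<^sub>R b)) (at p)" for vs b
      by (rule has_derivative_scaleR_left[OF bounded_linear.has_derivative[OF bounded_linear_inner_left
              has_derivative_dd[OF diff[OF that]]]])
    then have "((\<lambda>p. A (\<lambda>vs. xderiv vs f p)) has_derivative (\<lambda>u. A (\<lambda>vs. dd u (xderiv vs f) p))) (at p)"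
      unfolding A_def by (intro has_derivative_sum)
    moreover have "((\<lambda>p. P (fst p)) has_derivative (\<lambda>u. P (fst u))) (at p)"
      by (rule bounded_linear.has_derivative[OF linear_bounded_findim[OF P(1)]
            has_derivative_fst[OF has_derivative_ident]])
    ultimately show "(H has_derivative (\<lambda>u. L (P (fst u) + A (\<lambda>vs. dd u (xderiv vs f) p)))) (at p)"
      unfolding H_def
      by (intro bounded_linear.has_derivative[OF linear_bounded_findim[OF L(1)]] has_derivative_add)
  qed
  have A0: "A F = 0" if "\<And>vs. vs \<in> onb_lists k \<Longrightarrow> F vs = 0" for F
    using that by (simp add: A_def)
  show ?thesis
  proof (rule that[of P H])
    show "smooth_on S H"
      unfolding H_def A_def
      by (rule smooth_on_linear[OF assms(1) L(1)],
          intro smooth_on_add smooth_on_sum smooth_on_scaleR smooth_on_inner_const smooth_on_const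
          finite_onb finite_onb_lists smooth assms(1) smooth_on_linear[OF assms(1) P(1)]
          smooth_on_linear[OF assms(1) linear_fst smooth_on_id])
    show "dd (v, 0) H p0 = v" for v
      using L(2)[of v] by (simp add: dH[OF assms(3)] Q_def T_def)
    show "dd (v, 0) H p = P v" if "p \<in> S" "v \<in> jker k f p" for p v
    proof -
      have "A (\<lambda>vs. dd (v, 0) (xderiv vs f) p) = 0"
        using that(2) by (intro A0) (auto simp: jker_def onb_lists_def)
      then show ?thesis by (simp add: dH[OF that(1)] LP)
    qed
    show "H p = P (fst p)" if "p \<in> S" "\<And>vs. length vs < k \<Longrightarrow> xderiv vs f p = 0" for p
    proof -
      have "A (\<lambda>vs. xderiv vs f p) = 0"
        using that(2) by (intro A0) (auto simp: onb_lists_def)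
      then show ?thesis by (simp add: H_def LP)
    qed
    show "dd (0, w) H p = 0" if "p \<in> S" "\<And>vs. length vs \<le> k \<Longrightarrow> xderiv vs f p = 0" for p w
    proof -
      \<comment> \<open>\<open>H\<close> contains derivatives of order less than \<open>k\<close>;
        their derivatives in \<open>x\<close> have order at most \<open>k\<close> and vanish by the
        one additional order assumed.\<close>
      have "dd (0, w) (xderiv vs f) p = 0" if "vs \<in> onb_lists k" for vs
        using \<open>\<And>vs. length vs \<le> k \<Longrightarrow> xderiv vs f p = 0\<close>[of "vs @ [w]"] that
        by (simp add: iter_deriv_snoc onb_lists_def)
      then have "A (\<lambda>vs. dd (0, w) (xderiv vs f) p) = 0" by (rule A0)
      then show ?thesis
        by (simp add: dH[OF that(1)] linear_0[OF P(1)] linear_0[OF L(1)])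
    qed
  qed (use P in auto)
qed

text \<open>Linearity in \<open>v\<close> reduces the estimate to finitely many basis directions,
  where it is continuity at the base point. The factor 1/2 becomes the contraction constant in
  \<open>local_inverse\<close>.\<close>

lemma near_identity:
  fixes H :: "'v::findim_inner \<times> 'e::findim_inner \<Rightarrow> 'v"
  assumes "open S" "smooth_on S H" "(g0, x0) \<in> S" "\<And>v. dd (v, 0) H (g0, x0) = v"
  shows "\<exists>r>0. cball g0 r \<times> cball x0 r \<subseteq> S \<and>
    (\<forall>g\<in>cball g0 r. \<forall>x\<in>cball x0 r. \<forall>v. norm (dd (v, 0) H (g, x) - v) \<le> norm v / 2)"
proof -
  \<comment> \<open>The \<open>card onb\<close> summands, each at most e norm v, must add up to at
    most norm v / 2; the added 1 covers dimension zero.\<close>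
  define e where "e = 1 / (2 * (real (card (onb :: 'v set)) + 1))"
  have e: "e > 0" "real (card (onb :: 'v set)) * e \<le> 1 / 2"
    by (auto simp: e_def field_simps)
  have "\<forall>\<^sub>F p in nhds (g0, x0). norm (dd (b, 0) H p - b) < e" for b
  proof -
    have "isCont (dd (b, 0) H) (g0, x0)"
      using smooth_on_continuous[OF smooth_on_dd[OF assms(2)]] assms(1,3)
      by (simp add: continuous_on_eq_continuous_at)
    then have "((\<lambda>p. dd (b, 0) H p) \<longlongrightarrow> b) (nhds (g0, x0))"
      using assms(4)[of b] by (simp add: isCont_def tendsto_nhds_iff)
    then show ?thesis
      using e(1) by (simp add: tendsto_iff dist_norm)
  qed
  then have "\<forall>\<^sub>F p in nhds (g0, x0). p \<in> S \<and> (\<forall>b\<in>onb. norm (dd (b, 0) H p - b) < e)"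
    using eventually_nhds_in_open[OF assms(1,3)]
    by (intro eventually_conj) (simp_all add: eventually_ball_finite_distrib)
  then obtain U where U: "open U" "(g0, x0) \<in> U" "U \<subseteq> S"
    "\<And>p b. p \<in> U \<Longrightarrow> b \<in> onb \<Longrightarrow> norm (dd (b, 0) H p - b) < e"
    unfolding eventually_nhds by blast
  obtain A B where AB: "open A" "open B" "(g0, x0) \<in> A \<times> B" "A \<times> B \<subseteq> U"
    using open_prod_elim[OF U(1,2)] by blast
  obtain r1 r2 where r: "r1 > 0" "r2 > 0" "cball g0 r1 \<subseteq> A" "cball x0 r2 \<subseteq> B"
    using AB open_contains_cball by (metis SigmaD1 SigmaD2)
  let ?r = "min r1 r2"
  have in_U: "(g, x) \<in> U" if "g \<in> cball g0 ?r" "x \<in> cball x0 ?r" for g x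
    using that r AB(4) by (auto simp: subset_iff)
  have "norm (dd (v, 0) H (g, x) - v) \<le> norm v / 2" if "(g, x) \<in> U" for g x v
  proof -
    have lin: "linear (\<lambda>v. dd (v, 0) H (g, x) - v)"
      using linear_compose[OF _ linear_dd[OF smooth_on_differentiable[OF assms(2)]], of "\<lambda>v. (v, 0)"]
        that U(3) by (intro linear_compose_sub linear_ident) (auto simp: o_def linear_iff)
    have "norm (dd (v, 0) H (g, x) - v) \<le> (\<Sum>b\<in>(onb :: 'v set). norm v * e)"
      unfolding linear_onb[OF lin, of v]
    proof (rule sum_norm_le)
      fix b :: 'v assume b: "b \<in> onb"
      have "\<bar>v \<bullet> b\<bar> \<le> norm v"
        using Cauchy_Schwarz_ineq2[of v b] norm_onb[OF b] by simp
      then show "norm ((v \<bullet> b) *\<^sub>R (dd (b, 0) H (g, x) - b)) \<le> norm v * e"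
        using U(4)[OF that b] by (simp add: mult_mono)
    qed
    also have "\<dots> = norm v * (real (card (onb :: 'v set)) * e)" by simp
    also have "\<dots> \<le> norm v * (1 / 2)" by (intro mult_left_mono e) simp
    finally show ?thesis by simp
  qed
  then show ?thesis
    using in_U r U(3) by (intro exI[of _ ?r]) auto
qed

text \<open>\<open>D\<close> stands for the derivative in \<open>g\<close> of the map
  \<open>H\<close> from \<open>normal_form\<close> at \<open>p\<close>. Being close to the identity
  it has no kernel, and on \<open>jker k f p\<close> it equals \<open>P\<close>. So \<open>P\<close>
  embeds this kernel into the one at \<open>p0\<close>, and equal dimensions make the embedding
  onto.\<close>

lemma jker_dim_near:
  fixes f :: "'v::findim_inner \<times> 'e::findim_inner \<Rightarrow> 'f::findim_inner" and P :: "'v \<Rightarrow> 'v"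
  assumes "smooth_on S f" "p0 \<in> S" "p \<in> S" "linear P" "\<And>v. P v \<in> jker k f p0"
    "\<And>v. v \<in> jker k f p \<Longrightarrow> D v = P v" "\<And>v. norm (D v - v) \<le> norm v / 2"
  shows "dim (jker k f p) \<le> dim (jker k f p0)"
    and "dim (jker k f p) = dim (jker k f p0) \<Longrightarrow> P ` jker k f p = jker k f p0"
proof -
  note sub = subspace_jker[OF assms(1,3), of k] subspace_jker[OF assms(1,2), of k]
  have "v = 0" if "v \<in> jker k f p" "P v = 0" for v
    using assms(6)[OF that(1)] assms(7)[of v] that(2) by simp
  then have inj: "inj_on P (span (jker k f p))"
    using linear_inj_on_iff_eq_0[OF assms(4) subspace_span] span_eq_iff[THEN iffD2, OF sub(1)] by metis
  have dim: "dim (P ` jker k f p) = dim (jker k f p)"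
    by (rule findim_pair.dim_image_eq[OF assms(4) inj])
  have sp: "P ` jker k f p \<subseteq> jker k f p0" using assms(5) by auto
  show "dim (jker k f p) \<le> dim (jker k f p0)"
    using findim.dim_subset[OF sp] dim by simp
  show "P ` jker k f p = jker k f p0" if "dim (jker k f p) = dim (jker k f p0)"
    by (rule findim.subspace_dim_equal[OF linear_subspace_image[OF assms(4) sub(1)] sub(2) sp])
      (use that dim in simp)
qed

lemma jker_dim_upper_semicontinuous:
  assumes "open S" "smooth_on S f" "(g0, x0) \<in> S"
  shows "\<exists>r>0. cball g0 r \<times> cball x0 r \<subseteq> S \<and>
    (\<forall>g\<in>cball g0 r. \<forall>x\<in>cball x0 r. dim (jker k f (g, x)) \<le> dim (jker k f (g0, x0)))"
proof -
  obtain P H where PH: "linear P" "\<And>v. P v \<in> jker k f (g0, x0)"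
    "smooth_on S H" "\<And>v. dd (v, 0) H (g0, x0) = v"
    "\<And>p v. p \<in> S \<Longrightarrow> v \<in> jker k f p \<Longrightarrow> dd (v, 0) H p = P v"
    by (rule normal_form[OF assms, of k]) blast
  from near_identity[OF assms(1) PH(3) assms(3) PH(4)] obtain r where
    r: "r > 0" "cball g0 r \<times> cball x0 r \<subseteq> S"
    "\<And>g x v. g \<in> cball g0 r \<Longrightarrow> x \<in> cball x0 r \<Longrightarrow> norm (dd (v, 0) H (g, x) - v) \<le> norm v / 2"
    by blast
  show ?thesis
  proof (intro exI[of _ r] conjI ballI r)
    fix g x assume gx: "g \<in> cball g0 r" "x \<in> cball x0 r"
    then have p: "(g, x) \<in> S" using r(2) by blast
    show "dim (jker k f (g, x)) \<le> dim (jker k f (g0, x0))"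
      by (rule jker_dim_near(1)[OF assms(2,3) p PH(1,2) PH(5)[OF p] r(3)[OF gx]])
  qed
qed

text \<open>A solution of h y = p is a fixed point of y - h y + p, a map with Lipschitz constant 1/2
  that preserves the ball: the centre moves by at most r/2 and the contraction contributes at most
  r/2. The hypothesis also gives norm (y - z) <= 2 norm (h y - h z), hence uniqueness and a
  Lipschitz inverse.\<close>

lemma local_inverse:
  fixes h :: "'v::findim_inner \<Rightarrow> 'v"
  assumes lip: "\<And>y z. y \<in> cball c r \<Longrightarrow> z \<in> cball c r \<Longrightarrow> norm ((h y - h z) - (y - z)) \<le> norm (y - z) / 2"
    and "r > 0"
  obtains \<Gamma> where "\<And>p. p \<in> ball (h c) (r / 2) \<Longrightarrow> \<Gamma> p \<in> cball c r \<and> h (\<Gamma> p) = p"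
    "continuous_on (ball (h c) (r / 2)) \<Gamma>" "\<Gamma> (h c) = c"
proof -
  have low: "norm (y - z) \<le> 2 * norm (h y - h z)" if "y \<in> cball c r" "z \<in> cball c r" for y z
    using lip[OF that] norm_triangle_ineq3[of "h y - h z" "y - z"] by linarith
  have ex: "\<exists>y\<in>cball c r. h y = p" if p: "p \<in> ball (h c) (r / 2)" for p
  proof -
    have "\<exists>!y\<in>cball c r. y - h y + p = y"
    proof (rule Banach_fix[where c = "1/2"])
      have "norm (y - h y + p - c) \<le> r" if "y \<in> cball c r" for y
      proof -
        have "norm (y - h y + p - c) = norm ((p - h c) - ((h y - h c) - (y - c)))"
          by (simp add: algebra_simps)
        also have "\<dots> \<le> norm (p - h c) + norm ((h y - h c) - (y - c))" by (rule norm_triangle_ineq4)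
        also have "\<dots> \<le> r / 2 + norm (y - c) / 2"
          using lip[OF that, of c] p \<open>r > 0\<close> by (intro add_mono) (auto simp: dist_norm norm_minus_commute)
        also have "\<dots> \<le> r" using that by (simp add: dist_norm norm_minus_commute)
        finally show ?thesis .
      qed
      then show "(\<lambda>y. y - h y + p) ` cball c r \<subseteq> cball c r"
        by (auto simp: dist_norm norm_minus_commute)
      show "dist (y - h y + p) (z - h z + p) \<le> 1 / 2 * dist y z"
        if "y \<in> cball c r" "z \<in> cball c r" for y z
        using lip[OF that] norm_minus_commute[of "h y - h z" "y - z"] by (simp add: dist_norm algebra_simps)
    qed (use \<open>r > 0\<close> in \<open>auto simp: complete_eq_closed\<close>)
    then obtain y where y: "y \<in> cball c r" "y - h y + p = y" by blast
    then have "p = h y" by (metis add_diff_cancel_left' diff_add_eq diff_diff_eq2)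
    then show ?thesis using y(1) by blast
  qed
  define \<Gamma> where "\<Gamma> = (\<lambda>p. SOME y. y \<in> cball c r \<and> h y = p)"
  have \<Gamma>: "\<Gamma> p \<in> cball c r \<and> h (\<Gamma> p) = p" if "p \<in> ball (h c) (r / 2)" for p
    unfolding \<Gamma>_def by (rule someI_ex) (use ex[OF that] in auto)
  show ?thesis
  proof (rule that[of \<Gamma>])
    have "2-lipschitz_on (ball (h c) (r / 2)) \<Gamma>"
      using low \<Gamma> by (intro lipschitz_onI) (metis dist_norm, simp)
    then show "continuous_on (ball (h c) (r / 2)) \<Gamma>"
      by (rule lipschitz_on_continuous_on)
    show "\<Gamma> (h c) = c"
      using \<Gamma>[of "h c"] low[of "\<Gamma> (h c)" c] \<open>r > 0\<close> by simp
  qed (rule \<Gamma>)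
qed

text \<open>\<open>dim_eq\<close> is the constant rank of the jet of order below \<open>k\<close> as
  a function of the parameter. \<open>stable\<close> says that the derivatives of order
  \<open>k\<close> impose no further condition on tangent vectors.\<close>

locale constant_rank =
  fixes A :: "'v::findim_inner set" and B :: "'e::findim_inner set"
    and f :: "'v \<times> 'e \<Rightarrow> 'f::findim_inner" and k :: nat
  assumes open_A: "open A" and open_B: "open B" and smooth: "smooth_on (A \<times> B) f"
    and dim_eq: "p \<in> A \<times> B \<Longrightarrow> q \<in> A \<times> B \<Longrightarrow> dim (jker k f p) = dim (jker k f q)"
    and stable: "p \<in> A \<times> B \<Longrightarrow> jker (Suc k) f p = jker k f p"
begin

text \<open>
  The solution \<open>g\<close> of \<open>H (g, x) = P (g\<^sub>1 + t (g\<^sub>0 - g\<^sub>1))\<close> moves in the directions of \<open>jker k f\<close>,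
  hence of \<open>jker (Suc k) f\<close>, so the derivatives of order at most \<open>k\<close> stay zero along it.
\<close>

lemma move_to_transversal:
  assumes "g0 \<in> A" "x0 \<in> B" "linear P" "\<And>v. P v \<in> jker k f (g0, x0)" "smooth_on (A \<times> B) H"
    and H_jker: "\<And>p v. p \<in> A \<times> B \<Longrightarrow> v \<in> jker k f p \<Longrightarrow> dd (v, 0) H p = P v"
    and H_zero: "\<And>p. p \<in> A \<times> B \<Longrightarrow> (\<And>vs. length vs < k \<Longrightarrow> xderiv vs f p = 0) \<Longrightarrow> H p = P (fst p)"
    and R: "R > 0" "cball g0 R \<subseteq> A" "x \<in> B"
    and near: "\<And>g v. g \<in> cball g0 R \<Longrightarrow> norm (dd (v, 0) H (g, x) - v) \<le> norm v / 2"
    and lip: "\<And>g g'. g \<in> cball g0 R \<Longrightarrow> g' \<in> cball g0 R \<Longrightarrow>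
      norm ((H (g, x) - H (g', x)) - (g - g')) \<le> norm (g - g') / 2"
    and M: "M \<ge> 1" "\<And>v. norm (P v) \<le> M * norm v" "g1 \<in> cball g0 (R / (8 * M))"
    and zero: "\<And>vs. length vs \<le> k \<Longrightarrow> xderiv vs f (g1, x) = 0"
  shows "\<exists>g\<in>cball g0 R. H (g, x) = P g0 \<and> (\<forall>vs. length vs \<le> k \<longrightarrow> xderiv vs f (g, x) = 0)"
proof -
  \<comment> \<open>The radius R / (8 M) serves two purposes: the ball of radius R/2 around
    \<open>g1\<close> stays in the one of radius R around \<open>g0\<close>, and \<open>q\<close>
    below has norm at most R/8, within the radius R/4 on which \<open>local_inverse\<close>
    solves.\<close>
  have R8: "R / (8 * M) \<le> R / 8" using M(1) R(1) by (intro divide_left_mono) auto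
  have sub: "cball g1 (R / 2) \<subseteq> cball g0 R"
  proof
    fix y assume "y \<in> cball g1 (R / 2)"
    then show "y \<in> cball g0 R"
      using M(3) R(1) R8 dist_triangle[of g0 y g1] by simp
  qed
  have "g1 \<in> cball g1 (R / 2)" using R(1) by simp
  then have g1: "g1 \<in> A" using sub R(2) by blast
  obtain \<Gamma> where \<Gamma>: "\<And>p. p \<in> ball (H (g1, x)) (R / 4) \<Longrightarrow> \<Gamma> p \<in> cball g1 (R / 2) \<and> H (\<Gamma> p, x) = p"
    "continuous_on (ball (H (g1, x)) (R / 4)) \<Gamma>" "\<Gamma> (H (g1, x)) = g1"
    using local_inverse[of g1 "R / 2" "\<lambda>g. H (g, x)"] lip sub R(1) by (auto simp: subset_iff)
  have Hg1: "H (g1, x) = P g1"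
    using H_zero[of "(g1, x)"] zero g1 R(3) by simp
  define q where "q = P (g0 - g1)"
  have "norm q \<le> M * norm (g0 - g1)" unfolding q_def by (rule M)
  also have "\<dots> \<le> M * (R / (8 * M))"
    using M(1,3) by (intro mult_left_mono) (auto simp: dist_norm)
  also have "\<dots> < R / 4" using M(1) R(1) by simp
  finally have q: "norm q < R / 4" .
  \<comment> \<open>The prescribed value of \<open>H\<close> runs along the segment from
    \<open>P g1\<close> to \<open>P g0\<close>, with constant velocity \<open>q\<close> in the range
    of \<open>P\<close>.\<close>
  define s where "s = (\<lambda>t. P g1 + t *\<^sub>R q)"
  have s: "s t \<in> ball (H (g1, x)) (R / 4)" if "t \<in> {0..1}" for t
  proof -
    have "norm (t *\<^sub>R q) \<le> 1 * norm q"
      using that unfolding norm_scaleR by (intro mult_right_mono) auto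
    then show ?thesis using q by (simp add: s_def Hg1 dist_norm)
  qed
  define \<gamma> where "\<gamma> = (\<lambda>t. \<Gamma> (s t))"
  have \<gamma>: "\<gamma> t \<in> cball g0 R" "\<gamma> t \<in> A" "H (\<gamma> t, x) = s t" if "t \<in> {0..1}" for t
    using \<Gamma>(1)[OF s[OF that]] sub R(2) by (auto simp: \<gamma>_def)
  have deriv: "\<exists>w\<in>jker k f (\<gamma> t, x). (\<gamma> has_vector_derivative w) (at t within {0..1})"
    if t: "t \<in> {0..1}" for t
  proof -
    let ?p = "(\<gamma> t, x)"
    let ?D = "\<lambda>v. dd v (\<lambda>g. H (g, x)) (\<gamma> t)"
    have p: "?p \<in> A \<times> B" using \<gamma>[OF t] R(3) by auto
    note diff = smooth_on_differentiable[OF assms(5) p]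
    have D: "?D v = dd (v, 0) H ?p" for v by (rule dd_slice'(1)[OF diff])
    have derH: "((\<lambda>g. H (g, x)) has_derivative ?D) (at (\<Gamma> (s t)))"
      using has_derivative_dd[OF dd_slice'(2)[OF diff]] by (simp add: \<gamma>_def)
    have "v = 0" if "?D v = 0" for v
      using near[OF \<gamma>(1)[OF t], of v] that by (simp add: D)
    then have "inj ?D"
      using linear_injective_0[OF linear_dd[OF dd_slice'(2)[OF diff]]] by blast
    then obtain D' where D': "linear D'" "D' \<circ> ?D = id"
      using linear_injective_left_inverse[OF linear_dd[OF dd_slice'(2)[OF diff]]] by blast
    have cont: "continuous (at (s t)) \<Gamma>"
      using \<Gamma>(2) s[OF t] by (simp add: continuous_on_eq_continuous_at)
    have "(\<Gamma> has_derivative D') (at (s t))"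
      by (rule has_derivative_inverse_basic[OF derH linear_bounded_findim[OF D'(1)] D'(2) cont open_ball
            s[OF t]]) (use \<Gamma>(1) in auto)
    moreover have "(s has_derivative (\<lambda>r. r *\<^sub>R q)) (at t within {0..1})"
      unfolding s_def by (auto intro!: derivative_eq_intros)
    ultimately have "(\<gamma> has_derivative (\<lambda>r. D' (r *\<^sub>R q))) (at t within {0..1})"
      unfolding \<gamma>_def by (rule has_derivative_compose[rotated])
    then have "(\<gamma> has_vector_derivative D' q) (at t within {0..1})"
      by (simp add: has_vector_derivative_def linear_cmul[OF D'(1)])
    \<comment> \<open>By constancy of the dimension, \<open>P\<close> maps the kernel at the current
      point onto the kernel at the base point, which contains \<open>q\<close>. As the derivative of
      \<open>H\<close> in \<open>g\<close> equals \<open>P\<close> on the former, its inverse sends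
      \<open>q\<close> into that kernel: this is the velocity of the curve.\<close>
    moreover have "q \<in> P ` jker k f ?p"
    proof -
      have "P ` jker k f ?p = jker k f (g0, x0)"
        by (rule jker_dim_near(2)[OF smooth _ p assms(3,4) H_jker[OF p] near[OF \<gamma>(1)[OF t]] dim_eq[OF p]])
          (use assms(1,2) in auto)
      then show ?thesis using assms(4) by (simp add: q_def)
    qed
    then obtain w where w: "w \<in> jker k f ?p" "q = P w" by blast
    then have "D' q = w"
      using H_jker[OF p w(1)] fun_cong[OF D'(2), of w] D by simp
    ultimately show ?thesis using w by blast
  qed
  have const: "xderiv vs f (\<gamma> t, x) = 0" if "t \<in> {0..1}" "length vs \<le> k" for vs t
  proof -
    have "((\<lambda>t. xderiv vs f (\<gamma> t, x)) has_derivative (\<lambda>r. 0)) (at t within {0..1})"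
      if t: "t \<in> {0..1}" for t
    proof -
      obtain w where w: "w \<in> jker k f (\<gamma> t, x)" "(\<gamma> has_vector_derivative w) (at t within {0..1})"
        using deriv[OF t] by blast
      have p: "(\<gamma> t, x) \<in> A \<times> B" using \<gamma>[OF t] R(3) by auto
      have "((\<lambda>t. (\<gamma> t, x)) has_derivative (\<lambda>r. (r *\<^sub>R w, 0))) (at t within {0..1})"
        using has_derivative_Pair[OF w(2)[unfolded has_vector_derivative_def] has_derivative_const] .
      from has_derivative_compose[OF this
          has_derivative_dd[OF smooth_on_differentiable[OF smooth_on_iter_deriv[OF smooth] p]]]
      have "((\<lambda>t. xderiv vs f (\<gamma> t, x)) has_derivative (\<lambda>r. dd (r *\<^sub>R w, 0) (xderiv vs f) (\<gamma> t, x)))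
        (at t within {0..1})" .
      \<comment> \<open>\<open>jker k\<close> controls only orders below \<open>k\<close>. That
        order \<open>k\<close> itself is preserved is due to \<open>stable\<close>.\<close>
      moreover have "r *\<^sub>R w \<in> jker (Suc k) f (\<gamma> t, x)" for r
        using w(1) subspace_scale[OF subspace_jker[OF smooth p]] by (simp add: stable[OF p])
      ultimately show ?thesis
        using \<open>length vs \<le> k\<close> by (simp add: jker_def less_Suc_eq_le)
    qed
    from has_derivative_zero_unique[OF convex_real_interval(5) this, of t 0]
    show ?thesis
      using that zero \<Gamma>(3) by (simp add: \<gamma>_def s_def Hg1)
  qed
  have "s 1 = P g0"
    using linear_diff[OF assms(3), of g0 g1] by (simp add: s_def q_def)
  then show ?thesis
    using \<gamma>(1,3)[of 1] const[of 1] by (intro bexI[of _ "\<gamma> 1"]) auto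
qed

text \<open>No regularity of the choice of parameters is known in advance. It comes from the common
  level \<open>H = P g0\<close>: comparing two points on it bounds the change of the parameter by
  the variation of \<open>H\<close> in \<open>x\<close> alone. The radius is fixed before
  \<open>U\<close>, so one box serves all open subsets.\<close>

lemma constant_parameter:
  assumes "g0 \<in> A" "x0 \<in> B"
  shows "\<exists>r>0. cball g0 r \<subseteq> A \<and> ball x0 r \<subseteq> B \<and>
    (\<forall>U. open U \<longrightarrow> U \<noteq> {} \<longrightarrow> U \<subseteq> ball x0 r \<longrightarrow>
      (\<forall>x\<in>U. \<exists>g\<in>cball g0 r. \<forall>vs. length vs \<le> k \<longrightarrow> xderiv vs f (g, x) = 0) \<longrightarrow>
      (\<exists>g\<in>A. \<exists>V\<subseteq>U. open V \<and> V \<noteq> {} \<and> (\<forall>x\<in>V. f (g, x) = 0)))"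
proof -
  have S: "open (A \<times> B)" "(g0, x0) \<in> A \<times> B"
    using assms open_A open_B by (auto intro: open_Times)
  obtain P H where P: "linear P" "\<And>v. P v \<in> jker k f (g0, x0)"
    and H: "smooth_on (A \<times> B) H" "\<And>v. dd (v, 0) H (g0, x0) = v"
    "\<And>p v. p \<in> A \<times> B \<Longrightarrow> v \<in> jker k f p \<Longrightarrow> dd (v, 0) H p = P v"
    "\<And>p. p \<in> A \<times> B \<Longrightarrow> (\<And>vs. length vs < k \<Longrightarrow> xderiv vs f p = 0) \<Longrightarrow> H p = P (fst p)"
    "\<And>p w. p \<in> A \<times> B \<Longrightarrow> (\<And>vs. length vs \<le> k \<Longrightarrow> xderiv vs f p = 0) \<Longrightarrow> dd (0, w) H p = 0"
    by (rule normal_form[OF S(1) smooth S(2), of k]) blast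
  from near_identity[OF S(1) H(1) S(2) H(2)] obtain R where
    R: "R > 0" "cball g0 R \<times> cball x0 R \<subseteq> A \<times> B"
    and near: "\<And>g x v. g \<in> cball g0 R \<Longrightarrow> x \<in> cball x0 R \<Longrightarrow> norm (dd (v, 0) H (g, x) - v) \<le> norm v / 2"
    by blast
  have RA: "cball g0 R \<subseteq> A" and RB: "cball x0 R \<subseteq> B"
    using R(1,2) by (auto simp: times_subset_iff)
  have lip: "norm ((H (g, x) - H (g', x)) - (g - g')) \<le> norm (g - g') / 2"
    if "g \<in> cball g0 R" "g' \<in> cball g0 R" "x \<in> cball x0 R" for g g' x
  proof -
    have "norm ((H (g, x) - g) - (H (g', x) - g')) \<le> 1 / 2 * norm (g - g')"
    proof (rule differentiable_bound[OF convex_cball])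
      fix y assume y: "y \<in> cball g0 R"
      then have p: "(y, x) \<in> A \<times> B" using R(2) that(3) by blast
      note d = dd_slice'[OF smooth_on_differentiable[OF H(1) p]]
      have "((\<lambda>g. H (g, x)) has_derivative (\<lambda>v. dd (v, 0) H (y, x))) (at y)"
        using has_derivative_dd[OF d(2)] d(1) by simp
      then show "((\<lambda>g. H (g, x) - g) has_derivative (\<lambda>v. dd (v, 0) H (y, x) - v)) (at y within cball g0 R)"
        by (intro has_derivative_diff has_derivative_ident) (rule has_derivative_at_withinI)
      show "onorm (\<lambda>v. dd (v, 0) H (y, x) - v) \<le> 1 / 2"
        using near[OF y that(3)] by (intro onorm_bound) auto
    qed (use that in auto)
    then show ?thesis by (simp add: algebra_simps)
  qed
  obtain M where M: "M \<ge> 1" "\<And>v. norm (P v) \<le> M * norm v"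
  proof -
    obtain K where K: "\<And>v. norm (P v) \<le> norm v * K"
      using bounded_linear.bounded[OF linear_bounded_findim[OF P(1)]] by blast
    show ?thesis
    proof (rule that[of "max 1 K"])
      show "norm (P v) \<le> max 1 K * norm v" for v
        using K[of v] mult_left_mono[of K "max 1 K" "norm v"] by (simp add: mult.commute)
    qed simp
  qed
  define r where "r = R / (8 * M)"
  have r: "r > 0" "r \<le> R" using M(1) R(1) by (auto simp: r_def divide_simps)
  show ?thesis
  proof (intro exI[of _ r] conjI allI impI r)
    show "cball g0 r \<subseteq> A" "ball x0 r \<subseteq> B"
      using RA RB r subset_cball[OF r(2)] ball_subset_cball by blast+
    fix U assume U: "open U" "U \<noteq> {}" "U \<subseteq> ball x0 r"
      and ex: "\<forall>x\<in>U. \<exists>g\<in>cball g0 r. \<forall>vs. length vs \<le> k \<longrightarrow> xderiv vs f (g, x) = 0"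
    have UR: "x \<in> cball x0 R" if "x \<in> U" for x using that U(3) r by auto
    have "\<exists>g\<in>cball g0 R. H (g, x) = P g0 \<and> (\<forall>vs. length vs \<le> k \<longrightarrow> xderiv vs f (g, x) = 0)"
      if x: "x \<in> U" for x
    proof -
      obtain g1 where "g1 \<in> cball g0 r" "\<And>vs. length vs \<le> k \<Longrightarrow> xderiv vs f (g1, x) = 0"
        using ex x by blast
      then show ?thesis
        using UR[OF x] RB
        by (intro move_to_transversal[OF assms P H(1,3,4) R(1) RA _ near lip M(1,2), of x g1])
          (auto simp: r_def)
    qed
    then obtain G where G: "\<And>x. x \<in> U \<Longrightarrow> G x \<in> cball g0 R" "\<And>x. x \<in> U \<Longrightarrow> H (G x, x) = P g0"
      "\<And>x vs. x \<in> U \<Longrightarrow> length vs \<le> k \<Longrightarrow> xderiv vs f (G x, x) = 0"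
      by metis
    obtain x1 e where e: "x1 \<in> U" "e > 0" "ball x1 e \<subseteq> U"
      using U(1,2) open_contains_ball by blast
    \<comment> \<open>\<open>H (G x, \<cdot>)\<close> is stationary at \<open>x\<close>, and \<open>H (\<cdot>, y)\<close> is expanding up to the factor \<open>1/2\<close>,
      so \<open>G y - G x = o(y - x)\<close>.\<close>
    have "(G has_derivative (\<lambda>h. 0)) (at x within ball x1 e)" if x: "x \<in> ball x1 e" for x
    proof -
      have xU: "x \<in> U" using x e by blast
      have p: "(G x, x) \<in> A \<times> B" using G(1)[OF xU] UR[OF xU] R(2) by blast
      have "((\<lambda>y. H (G x, y)) has_derivative (\<lambda>w. dd (0, w) H (G x, x))) (at x)"
        using has_derivative_compose[OF has_derivative_Pair[OF has_derivative_const has_derivative_ident]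
          has_derivative_dd[OF smooth_on_differentiable[OF H(1) p]]] .
      then have dH: "((\<lambda>y. H (G x, y)) has_derivative (\<lambda>w. 0)) (at x)"
        using H(5)[OF p] G(3)[OF xU] by simp
      have bound: "norm (G y - G x) \<le> 2 * norm (H (G x, y) - H (G x, x))" if y: "y \<in> U" for y
      proof -
        have "norm (G y - G x) \<le> 2 * norm (H (G y, y) - H (G x, y))"
          using lip[OF G(1)[OF y] G(1)[OF xU] UR[OF y]]
            norm_triangle_ineq3[of "H (G y, y) - H (G x, y)" "G y - G x"] by linarith
        then show ?thesis
          using G(2)[OF y] G(2)[OF xU] by (simp add: norm_minus_commute)
      qed
      show ?thesis
        unfolding has_derivative_within_alt
      proof (intro conjI allI impI bounded_linear_zero)
        fix d :: real assume "d > 0"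
        then obtain c where c: "c > 0"
          "\<And>y. norm (y - x) < c \<Longrightarrow> norm (H (G x, y) - H (G x, x)) \<le> d / 2 * norm (y - x)"
          using dH[unfolded has_derivative_at_alt] by (metis diff_zero half_gt_zero)
        show "\<exists>c>0. \<forall>y\<in>ball x1 e. norm (y - x) < c \<longrightarrow> norm (G y - G x - 0) \<le> d * norm (y - x)"
        proof (intro exI[of _ c] conjI ballI impI c)
          fix y assume "y \<in> ball x1 e" "norm (y - x) < c"
          then show "norm (G y - G x - 0) \<le> d * norm (y - x)"
            using bound[of y] c(2)[of y] e(3) by fastforce
        qed
      qed
    qed
    from has_derivative_zero_constant[OF convex_ball this]
    obtain g where g: "\<And>x. x \<in> ball x1 e \<Longrightarrow> G x = g" by blast
    show "\<exists>g\<in>A. \<exists>V\<subseteq>U. open V \<and> V \<noteq> {} \<and> (\<forall>x\<in>V. f (g, x) = 0)"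
    proof (intro bexI[of _ g] exI[of _ "ball x1 e"] conjI ballI)
      show "f (g, x) = 0" if "x \<in> ball x1 e" for x
        using G(3)[of x "[]"] g[OF that] that e(3) by auto
      show "g \<in> A" using G(1)[OF e(1)] g[of x1] e(2) RA by auto
    qed (use e in auto)
  qed
qed

end

section \<open>Translation of kernels and smooth manifolds\<close>

text \<open>Differentiating a'(\<tau> v, y) = c (a (v, y)) in \<open>v\<close> writes the parameter
  derivative of \<open>a'\<close> as a combination of components of that of \<open>a\<close>, with
  coefficients smooth in \<open>y\<close>. Such combinations still vanish to the same order in
  \<open>y\<close>.\<close>

lemma jker_translate_subset:
  fixes a a' :: "'v::findim_inner \<times> 'e::findim_inner \<Rightarrow> 'f::findim_inner"
  assumes a: "open S" "smooth_on S a" "(v0, y0) \<in> S"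
    and a': "open S'" "smooth_on S' a'"
    and \<tau>: "\<tau> differentiable (at v0)"
    and c: "open C" "smooth_on C c"
    and N: "open N" "(v0, y0) \<in> N"
    and rel: "\<And>v y. (v, y) \<in> N \<Longrightarrow>
      (v, y) \<in> S \<and> (\<tau> v, y) \<in> S' \<and> a (v, y) \<in> C \<and> a' (\<tau> v, y) = c (a (v, y))"
    and w: "w \<in> jker k a (v0, y0)"
  shows "dd w \<tau> v0 \<in> jker k a' (\<tau> v0, y0)"
proof (cases k)
  case (Suc j)
  let ?N0 = "{y. (v0, y) \<in> N}"
  note N0 = open_slice[OF N(1), of v0]
  have y0: "y0 \<in> ?N0" using N(2) by simp
  note relD = rel[THEN conjunct1] rel[THEN conjunct2, THEN conjunct1]
    rel[THEN conjunct2, THEN conjunct2, THEN conjunct1]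
    rel[THEN conjunct2, THEN conjunct2, THEN conjunct2]
  have smooth_b: "smooth_on ?N0 (\<lambda>y. dd (w, 0) a (v0, y))"
    by (rule smooth_on_subset[OF smooth_on_slice[OF a(1) smooth_on_dd[OF a(2)], of v0]])
      (use relD(1) in auto)
  have smooth_c: "smooth_on ?N0 (\<lambda>y. dd b c (a (v0, y)))" for b
    by (rule smooth_on_compose[OF N0 c(1) smooth_on_subset[OF smooth_on_slice[OF a(1,2), of v0]]
          smooth_on_dd[OF c(2)]])
      (use relD(1,3) in auto)
  have eq: "dd (dd w \<tau> v0, 0) a' (\<tau> v0, y) = (\<Sum>b\<in>onb. (dd (w, 0) a (v0, y) \<bullet> b) *\<^sub>R dd b c (a (v0, y)))"
    if y: "y \<in> ?N0" for y
  proof -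
    have y': "(v0, y) \<in> N" using y by simp
    note da = dd_slice'[OF smooth_on_differentiable[OF a(2) relD(1)[OF y']]]
    note da' = dd_slice'[OF smooth_on_differentiable[OF a'(2) relD(2)[OF y']]]
    note dc = smooth_on_differentiable[OF c(2) relD(3)[OF y']]
    have "open {v. (v, y) \<in> N}"
      using open_vimage[OF N(1), of "\<lambda>v. (v, y)"] by (simp add: vimage_def continuous_on_Pair)
    then have "dd w (\<lambda>v. a' (\<tau> v, y)) v0 = dd w (\<lambda>v. c (a (v, y))) v0"
      by (rule fun_cong[OF frechet_derivative_cong_open]) (use y' relD(4) in auto)
    moreover have "dd w (\<lambda>v. a' (\<tau> v, y)) v0 = dd (dd w \<tau> v0, 0) a' (\<tau> v0, y)"
      using dd_compose(3)[OF \<tau> da'(2)] da'(1) by simp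
    moreover have "dd w (\<lambda>v. c (a (v, y))) v0 =
        (\<Sum>b\<in>onb. (dd (w, 0) a (v0, y) \<bullet> b) *\<^sub>R dd b c (a (v0, y)))"
      using dd_compose(1)[OF da(2) dc] da(1) by simp
    ultimately show ?thesis by simp
  qed
  have "agree j (\<lambda>y. dd (w, 0) a (v0, y)) (\<lambda>y. 0) y0"
    using w jker_Suc_iff[OF a] by (simp add: Suc)
  from agree_linear[OF linear_inner_right_const N0 y0 smooth_b smooth_on_const[OF N0] this]
  have "agree j (\<lambda>y. dd (w, 0) a (v0, y) \<bullet> b) (\<lambda>y. 0) y0" for b by simp
  then have "agree j (\<lambda>y. (dd (w, 0) a (v0, y) \<bullet> b) *\<^sub>R dd b c (a (v0, y)))
      (\<lambda>y. 0 *\<^sub>R dd b c (a (v0, y))) y0" for b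
    by (intro agree_scaleR[OF N0 y0] smooth_on_inner_const[OF N0] smooth_on_const[OF N0] smooth_b smooth_c)
      auto
  then have "agree j (\<lambda>y. \<Sum>b\<in>onb. (dd (w, 0) a (v0, y) \<bullet> b) *\<^sub>R dd b c (a (v0, y)))
      (\<lambda>y. \<Sum>b\<in>onb. 0 *\<^sub>R dd b c (a (v0, y))) y0"
    by (intro agree_sum[OF N0 y0] smooth_on_scaleR[OF N0] smooth_on_inner_const[OF N0]
        smooth_on_const[OF N0] smooth_b smooth_c) auto
  then have "agree j (\<lambda>y. dd (dd w \<tau> v0, 0) a' (\<tau> v0, y)) (\<lambda>y. 0) y0"
    by (subst agree_cong[OF N0 y0 eq refl]) simp_all
  then show ?thesis
    using jker_Suc_iff[OF a', of "\<tau> v0" y0] relD(2)[OF N(2)] by (simp add: Suc)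
qed simp

text \<open>The left inverse \<mu> makes the derivative of \<tau> injective, so it embeds one kernel
  into the other.\<close>

lemma jker_translate_dim:
  fixes a a' :: "'v::findim_inner \<times> 'e::findim_inner \<Rightarrow> 'f::findim_inner"
  assumes "open S" "smooth_on S a" "(v0, y0) \<in> S" "open S'" "smooth_on S' a'"
    "\<tau> differentiable (at v0)" "open C" "smooth_on C c" "open N" "(v0, y0) \<in> N"
    "\<And>v y. (v, y) \<in> N \<Longrightarrow>
      (v, y) \<in> S \<and> (\<tau> v, y) \<in> S' \<and> a (v, y) \<in> C \<and> a' (\<tau> v, y) = c (a (v, y))"
    and \<mu>: "\<mu> differentiable (at (\<tau> v0))" "open W" "v0 \<in> W" "\<And>v. v \<in> W \<Longrightarrow> \<mu> (\<tau> v) = v"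
  shows "dim (jker k a (v0, y0)) \<le> dim (jker k a' (\<tau> v0, y0))"
proof -
  note lin = linear_dd[OF assms(6)]
  have "w = 0" if "dd w \<tau> v0 = 0" for w
  proof -
    have "dd w (\<lambda>v. \<mu> (\<tau> v)) v0 = dd w (\<lambda>v. v) v0"
      by (rule fun_cong[OF frechet_derivative_cong_open[OF \<mu>(2,3,4)]])
    then show ?thesis
      using dd_compose(3)[OF assms(6) \<mu>(1), of w] that linear_0[OF linear_dd[OF \<mu>(1)]]
      by (simp add: frechet_derivative_id)
  qed
  then have "inj (\<lambda>w. dd w \<tau> v0)"
    using linear_injective_0[OF lin] by simp
  then have inj: "inj_on (\<lambda>w. dd w \<tau> v0) (span (jker k a (v0, y0)))"
    by (rule inj_on_subset) simp
  have "(\<lambda>w. dd w \<tau> v0) ` jker k a (v0, y0) \<subseteq> jker k a' (\<tau> v0, y0)"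
    using jker_translate_subset[OF assms(1-11)] by blast
  from findim.dim_subset[OF this] show ?thesis
    using findim_pair.dim_image_eq[OF lin inj] by simp
qed

lemma agree_zero_iff:
  assumes "open S" "x \<in> S" "smooth_on S f" "smooth_on S g"
  shows "agree k (\<lambda>x. f x - g x) (\<lambda>x. 0) x \<longleftrightarrow> agree k f g x"
proof
  assume "agree k (\<lambda>x. f x - g x) (\<lambda>x. 0) x"
  then have "agree k (\<lambda>x. (f x - g x) + g x) (\<lambda>x. 0 + g x) x"
    by (intro agree_add[OF assms(1,2)] smooth_on_diff[OF assms(1)] smooth_on_const[OF assms(1)] assms) auto
  then show "agree k f g x" by simp
next
  assume "agree k f g x"
  then have "agree k (\<lambda>x. f x + (0 - g x)) (\<lambda>x. g x + (0 - g x)) x"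
    by (intro agree_add[OF assms(1,2)] smooth_on_diff[OF assms(1)] smooth_on_const[OF assms(1)] assms) auto
  then show "agree k (\<lambda>x. f x - g x) (\<lambda>x. 0) x" by simp
qed

text \<open>Fixed points are zeros of \<open>a - snd\<close>, while translation by group elements is
  formulated for \<open>a\<close>. The subtracted term does not depend on the parameter, so both
  have the same kernels.\<close>

lemma jker_diff_snd:
  fixes a :: "'v::findim_inner \<times> 'e::findim_inner \<Rightarrow> 'e"
  assumes "open S" "smooth_on S a" "p \<in> S"
  shows "jker k (\<lambda>p. a p - snd p) p = jker k a p"
proof (cases k)
  case (Suc j)
  obtain c x where p: "p = (c, x)" by (cases p)
  have sm: "smooth_on S (\<lambda>p. a p - snd p)"
    by (intro smooth_on_diff assms smooth_on_linear[OF assms(1) linear_snd smooth_on_id])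
  have "dd (v, 0) (\<lambda>p. a p - snd p) q = dd (v, 0) a q" if "q \<in> S" for v q
  proof -
    have "((\<lambda>p. a p - snd p) has_derivative (\<lambda>u. dd u a q - snd u)) (at q)"
      by (intro has_derivative_diff has_derivative_snd has_derivative_ident
          has_derivative_dd[OF smooth_on_differentiable[OF assms(2) that]])
    from dd_eqI[OF this, of "(v, 0)"] show ?thesis by simp
  qed
  then have "agree j (\<lambda>y. dd (v, 0) (\<lambda>p. a p - snd p) (c, y)) (\<lambda>y. 0) x \<longleftrightarrow>
      agree j (\<lambda>y. dd (v, 0) a (c, y)) (\<lambda>y. 0) x" for v
    using assms(3) p by (intro agree_cong[OF open_slice[OF assms(1), of c]]) auto
  then show ?thesis
    using jker_Suc_iff[OF assms(1) sm] jker_Suc_iff[OF assms(1,2)] assms(3) unfolding p Suc by blast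
qed simp

text \<open>The source of the order \<open>n\<close>: the n+1 steps from \<open>d 0\<close> to
  \<open>d (Suc n)\<close> cannot all be strict drops, since they start at most at
  \<open>n\<close>.\<close>

lemma antimono_nat_stabilizes:
  fixes d :: "nat \<Rightarrow> nat"
  assumes "\<And>k. k \<le> n \<Longrightarrow> d (Suc k) \<le> d k" "d 0 \<le> n"
  shows "\<exists>k\<le>n. d (Suc k) = d k"
proof (rule ccontr)
  assume "\<not> ?thesis"
  then have less: "d (Suc k) < d k" if "k \<le> n" for k using assms(1) that by (meson le_neq_implies_less)
  have "d k + k \<le> n" if "k \<le> Suc n" for k
    using that
  proof (induction k)
    case (Suc k)
    then show ?case using less[of k] by auto
  qed (use assms(2) in auto)
  from this[of "Suc n"] show False by simp
qed

text \<open>At a minimiser over \<open>V\<close> of the sum of all \<delta> k, no summand can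
  increase nearby and the sum cannot decrease, so every summand is constant. A minimiser exists
  because the values are natural numbers.\<close>

lemma upper_semicontinuous_locally_constant:
  fixes \<delta> :: "'k \<Rightarrow> 'e::metric_space \<Rightarrow> nat"
  assumes "finite K" "open E"
    and usc: "\<And>k x. k \<in> K \<Longrightarrow> x \<in> E \<Longrightarrow> \<forall>\<^sub>F y in nhds x. \<delta> k y \<le> \<delta> k x"
    and V: "open V" "V \<noteq> {}" "V \<subseteq> E"
  shows "\<exists>x\<in>V. \<forall>\<^sub>F y in nhds x. \<forall>k\<in>K. \<delta> k y = \<delta> k x"
proof -
  define D where "D = (\<lambda>x. \<Sum>k\<in>K. \<delta> k x)"
  obtain x where x: "x \<in> V" "\<And>y. y \<in> V \<Longrightarrow> D x \<le> D y"
    using ex_min_if_finite[of "{}"] ex_has_least_nat[of "\<lambda>x. x \<in> V" _ D] V(2) by blast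
  have "\<forall>\<^sub>F y in nhds x. y \<in> V \<and> (\<forall>k\<in>K. \<delta> k y \<le> \<delta> k x)"
    using usc x(1) V assms(1) eventually_nhds_in_open[OF V(1) x(1)]
    by (auto intro!: eventually_conj eventually_ball_finite)
  then have "\<forall>\<^sub>F y in nhds x. \<forall>k\<in>K. \<delta> k y = \<delta> k x"
  proof (rule eventually_mono)
    fix y assume y: "y \<in> V \<and> (\<forall>k\<in>K. \<delta> k y \<le> \<delta> k x)"
    show "\<forall>k\<in>K. \<delta> k y = \<delta> k x"
    proof (rule ccontr)
      assume "\<not> ?thesis"
      then have "\<exists>k\<in>K. \<delta> k y < \<delta> k x" using y by (metis le_neq_implies_less)
      then have "D y < D x"
        unfolding D_def using y assms(1) by (intro sum_strict_mono_ex1) auto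
      then show False using x(2) y by fastforce
    qed
  qed
  then show ?thesis using x(1) by blast
qed

section \<open>Charts and smooth maps in charts\<close>

context smooth_manifold
begin

lemma chart_subset: "(U, \<psi>) \<in> charts M \<Longrightarrow> U \<subseteq> mspace M"
  using chart_domain openin_subset by blast

lemma chart_inj: "(U, \<psi>) \<in> charts M \<Longrightarrow> inj_on \<psi> U"
  using chart_homeomorphic homeomorphic_imp_injective_map chart_subset
  by (metis inf.absorb2 topspace_subtopology)

lemma chart_inv:
  assumes "(U, \<psi>) \<in> charts M"
  shows "x \<in> U \<Longrightarrow> inv_into U \<psi> (\<psi> x) = x"
    and "y \<in> \<psi> ` U \<Longrightarrow> \<psi> (inv_into U \<psi> y) = y"
    and "y \<in> \<psi> ` U \<Longrightarrow> inv_into U \<psi> y \<in> U"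
  using chart_inj[OF assms] by (auto simp: f_inv_into_f inv_into_into)

lemma chart_continuous:
  assumes "(U, \<psi>) \<in> charts M"
  shows "continuous_map (subtopology (mtop M) U) (top_of_set (\<psi> ` U)) \<psi>"
  using chart_homeomorphic[OF assms] homeomorphic_imp_continuous_map by blast

lemma chart_open_preimage:
  assumes "(U, \<psi>) \<in> charts M" "open Y"
  shows "openin (mtop M) {x \<in> U. \<psi> x \<in> Y}"
proof -
  have "openin (subtopology (mtop M) U) {x \<in> topspace (subtopology (mtop M) U). \<psi> x \<in> Y}"
    using chart_continuous[OF assms(1)] assms(2)
    by (intro openin_continuous_map_preimage[of _ euclidean])
      (auto dest: continuous_map_into_fulltopology)
  moreover have "{x \<in> topspace (subtopology (mtop M) U). \<psi> x \<in> Y} = {x \<in> U. \<psi> x \<in> Y}"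
    using chart_subset[OF assms(1)] by auto
  ultimately show ?thesis
    using openin_open_subtopology[OF chart_domain[OF assms(1)]] by simp
qed

lemma chart_open_image:
  assumes "(U, \<psi>) \<in> charts M" "openin (mtop M) V" "V \<subseteq> U"
  shows "open (\<psi> ` V)"
proof -
  have "openin (subtopology (mtop M) U) V"
    using assms openin_open_subtopology[OF chart_domain[OF assms(1)]] by blast
  then have "openin (top_of_set (\<psi> ` U)) (\<psi> ` V)"
    using homeomorphic_map_openness_eq[OF chart_homeomorphic[OF assms(1)]] by blast
  then show ?thesis
    using openin_open_trans chart_range[OF assms(1)] by blast
qed

lemma chart_inv_continuous:
  assumes "(U, \<psi>) \<in> charts M"
  shows "continuous_map (top_of_set (\<psi> ` U)) (mtop M) (inv_into U \<psi>)"
proof -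
  have "openin (top_of_set (\<psi> ` U)) {y \<in> \<psi> ` U. inv_into U \<psi> y \<in> V}" if "openin (mtop M) V" for V
  proof -
    have "{y \<in> \<psi> ` U. inv_into U \<psi> y \<in> V} = \<psi> ` (V \<inter> U)"
      using chart_inv[OF assms] by (auto simp: image_iff)
    then show ?thesis
      using chart_open_image[OF assms openin_Int[OF that chart_domain[OF assms]]] that
      by (simp add: open_subset image_mono)
  qed
  then show ?thesis
    using chart_inv(3)[OF assms] chart_subset[OF assms] by (auto simp: continuous_map_def)
qed

text \<open>The closure in \<open>M\<close> may leave the chart, and \<open>T\<close> is closed only
  relative to \<open>B\<close>. But a nonempty open \<open>I\<close> inside the closure meets the
  set itself, so its part over \<open>B\<close> is nonempty; over \<open>B\<close> the closure adds
  no points, and the image of that part is an open subset of \<open>T\<close>.\<close>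

lemma nowhere_dense_in_chart:
  assumes "(U, \<psi>) \<in> charts M" "open B" "T \<subseteq> B" "open (B - T)"
    and no: "\<And>V. open V \<Longrightarrow> V \<noteq> {} \<Longrightarrow> V \<subseteq> T \<Longrightarrow> False"
  shows "nowhere_dense_in (mtop M) {x \<in> U. \<psi> x \<in> T}" (is "nowhere_dense_in _ ?S")
proof -
  have sub: "?S \<subseteq> mspace M" using chart_subset[OF assms(1)] by blast
  define C where "C = (mtop M) closure_of ?S"
  define I where "I = (mtop M) interior_of C"
  have I: "openin (mtop M) I" "I \<subseteq> C"
    by (auto simp: I_def openin_interior_of interior_of_subset)
  have meets: "V \<inter> ?S \<noteq> {}" if "x \<in> C" "x \<in> V" "openin (mtop M) V" for x V
    using that unfolding C_def in_closure_of by blast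
  have "I = {}"
  proof (rule ccontr)
    assume "I \<noteq> {}"
    then obtain x' where x': "x' \<in> ?S" "x' \<in> I"
      using I meets by blast
    define V where "V = {x \<in> U. \<psi> x \<in> B} \<inter> I"
    have V: "openin (mtop M) V"
      unfolding V_def by (intro openin_Int chart_open_preimage[OF assms(1,2)] I)
    have "V \<subseteq> ?S"
    proof
      fix z assume z: "z \<in> V"
      have "{x \<in> U. \<psi> x \<in> B - T} \<inter> ?S = {}" by blast
      then have "z \<notin> {x \<in> U. \<psi> x \<in> B - T}"
        using meets[OF _ _ chart_open_preimage[OF assms(1,4)], of z] z I(2) unfolding V_def by blast
      then show "z \<in> ?S" using z unfolding V_def by blast
    qed
    then have "\<psi> ` V \<subseteq> T" "V \<subseteq> U" by blast+
    moreover have "\<psi> ` V \<noteq> {}" using x' assms(3) unfolding V_def by blast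
    ultimately show False
      using no[OF chart_open_image[OF assms(1) V]] by blast
  qed
  then show ?thesis using sub by (simp add: nowhere_dense_in_def I_def C_def)
qed

end

text \<open>On \<open>S\<close> the inverse of a product chart is the pair of inverses of the factor
  charts, so later coordinate computations can work with the factors.\<close>

lemma smooth_map_prod_coordinates:
  assumes "smooth_manifold M1" "smooth_manifold M2" "smooth_manifold M3"
    and F: "smooth_map (prod_manifold M1 M2) M3 F"
    and c: "(U1, \<psi>1) \<in> charts M1" "(U2, \<psi>2) \<in> charts M2" "(U3, \<psi>3) \<in> charts M3"
  defines "S \<equiv> {p \<in> \<psi>1 ` U1 \<times> \<psi>2 ` U2. F (inv_into U1 \<psi>1 (fst p), inv_into U2 \<psi>2 (snd p)) \<in> U3}"
  shows "open S"
    and "smooth_on S (\<lambda>p. \<psi>3 (F (inv_into U1 \<psi>1 (fst p), inv_into U2 \<psi>2 (snd p))))"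
proof -
  interpret M1: smooth_manifold M1 by fact
  interpret M2: smooth_manifold M2 by fact
  interpret M3: smooth_manifold M3 by fact
  let ?i1 = "inv_into U1 \<psi>1" and ?i2 = "inv_into U2 \<psi>2"
  let ?E = "\<psi>1 ` U1 \<times> \<psi>2 ` U2"
  have E: "open ?E" by (intro open_Times M1.chart_range[OF c(1)] M2.chart_range[OF c(2)])
  have "continuous_map (top_of_set ?E) (mtop M1) (?i1 \<circ> fst)"
    by (rule continuous_map_compose[OF _ M1.chart_inv_continuous[OF c(1)]])
      (auto intro!: continuous_intros)
  moreover have "continuous_map (top_of_set ?E) (mtop M2) (?i2 \<circ> snd)"
    by (rule continuous_map_compose[OF _ M2.chart_inv_continuous[OF c(2)]])
      (auto intro!: continuous_intros)
  ultimately have "continuous_map (top_of_set ?E) (prod_topology (mtop M1) (mtop M2))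
      (\<lambda>p. (?i1 (fst p), ?i2 (snd p)))"
    by (simp add: continuous_map_pairwise o_def)
  moreover have "continuous_map (prod_topology (mtop M1) (mtop M2)) (mtop M3) F"
    using F by (simp add: smooth_map_def prod_manifold_def)
  ultimately have "continuous_map (top_of_set ?E) (mtop M3) (F \<circ> (\<lambda>p. (?i1 (fst p), ?i2 (snd p))))"
    by (rule continuous_map_compose)
  from openin_continuous_map_preimage[OF this M3.chart_domain[OF c(3)]]
  have "openin (top_of_set ?E) S" by (simp add: S_def)
  then show "open S" using E openin_open_trans by blast
  have inj: "inj_on (map_prod \<psi>1 \<psi>2) (U1 \<times> U2)"
    using M1.chart_inj[OF c(1)] M2.chart_inj[OF c(2)] by (simp add: map_prod_inj_on)
  have S: "map_prod \<psi>1 \<psi>2 ` {z \<in> U1 \<times> U2. F z \<in> U3} = S"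
  proof (intro equalityI subsetI)
    fix p assume "p \<in> S"
    then show "p \<in> map_prod \<psi>1 \<psi>2 ` {z \<in> U1 \<times> U2. F z \<in> U3}"
      using M1.chart_inv[OF c(1)] M2.chart_inv[OF c(2)]
      by (intro image_eqI[of _ _ "(?i1 (fst p), ?i2 (snd p))"]) (auto simp: S_def map_prod_def)
  next
    fix p assume "p \<in> map_prod \<psi>1 \<psi>2 ` {z \<in> U1 \<times> U2. F z \<in> U3}"
    then show "p \<in> S"
      using M1.chart_inv[OF c(1)] M2.chart_inv[OF c(2)] by (auto simp: S_def)
  qed
  have "(U1 \<times> U2, map_prod \<psi>1 \<psi>2) \<in> charts (prod_manifold M1 M2)"
    using c by (auto simp: prod_manifold_def)
  then have "smooth_on S (\<psi>3 \<circ> F \<circ> inv_into (U1 \<times> U2) (map_prod \<psi>1 \<psi>2))"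
    using F c(3) S unfolding smooth_map_def by fastforce
  moreover have "inv_into (U1 \<times> U2) (map_prod \<psi>1 \<psi>2) p = (?i1 (fst p), ?i2 (snd p))" if "p \<in> S" for p
    using that M1.chart_inv[OF c(1)] M2.chart_inv[OF c(2)]
    by (intro inv_into_f_eq[OF inj]) (auto simp: S_def)
  ultimately show "smooth_on S (\<lambda>p. \<psi>3 (F (?i1 (fst p), ?i2 (snd p))))"
    using smooth_on_cong[OF \<open>open S\<close>, of "\<psi>3 \<circ> F \<circ> inv_into (U1 \<times> U2) (map_prod \<psi>1 \<psi>2)"
        "\<lambda>p. \<psi>3 (F (?i1 (fst p), ?i2 (snd p)))"] by simp
qed

lemma smooth_map_prod_slice:
  assumes "smooth_manifold M1" "smooth_manifold M2" "smooth_manifold M3"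
    and F: "smooth_map (prod_manifold M1 M2) M3 F"
    and p: "p \<in> mspace M1" and c: "(U2, \<psi>2) \<in> charts M2" "(U3, \<psi>3) \<in> charts M3"
  shows "open {y \<in> \<psi>2 ` U2. F (p, inv_into U2 \<psi>2 y) \<in> U3}"
    and "smooth_on {y \<in> \<psi>2 ` U2. F (p, inv_into U2 \<psi>2 y) \<in> U3} (\<lambda>y. \<psi>3 (F (p, inv_into U2 \<psi>2 y)))"
proof -
  obtain U1 \<psi>1 where c1: "(U1, \<psi>1) \<in> charts M1" "p \<in> U1"
    using smooth_manifold.chart_cover[OF assms(1) p] by blast
  note i1 = smooth_manifold.chart_inv(1)[OF assms(1) c1]
  note coord = smooth_map_prod_coordinates[OF assms(1-3) F c1(1) c]
  show "open {y \<in> \<psi>2 ` U2. F (p, inv_into U2 \<psi>2 y) \<in> U3}"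
    using open_slice[OF coord(1), of "\<psi>1 p"] c1(2) i1 by simp
  show "smooth_on {y \<in> \<psi>2 ` U2. F (p, inv_into U2 \<psi>2 y) \<in> U3} (\<lambda>y. \<psi>3 (F (p, inv_into U2 \<psi>2 y)))"
    using smooth_on_slice[OF coord, of "\<psi>1 p"] c1(2) i1 by simp
qed

section \<open>Meagerness on the manifold\<close>

text \<open>Projection along a compact factor is a closed map. A nonempty \<open>I\<close> keeps the
  intersection of the zero sets inside \<open>C \<times> B\<close>.\<close>

lemma closedin_projection:
  fixes F :: "'i \<Rightarrow> 'x::topological_space \<times> 'y::topological_space \<Rightarrow> 'z::t1_space"
  assumes "compact C" "\<And>i. i \<in> I \<Longrightarrow> continuous_on (C \<times> B) (F i)" "I \<noteq> {}"
  shows "closedin (top_of_set B) {y \<in> B. \<exists>x\<in>C. \<forall>i\<in>I. F i (x, y) = z}"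
proof -
  let ?Q = "\<Inter>i\<in>I. {p \<in> C \<times> B. F i p = z}"
  have "closedin (top_of_set (C \<times> B)) ?Q"
    using assms(2,3) by (intro closedin_Inter) (auto intro: continuous_closedin_preimage_constant)
  then have "closedin (prod_topology (top_of_set C) (top_of_set B)) ?Q"
    by (simp add: prod_topology_subtopology(1,2) subtopology_subtopology Times_Int_Times)
  moreover have "closed_map (prod_topology (top_of_set C) (top_of_set B)) (top_of_set B) snd"
    using assms(1) by (intro closed_map_snd) (simp add: compact_space_subtopology)
  ultimately have "closedin (top_of_set B) (snd ` ?Q)"
    by (simp add: closed_map_def)
  moreover have "snd ` ?Q = {y \<in> B. \<exists>x\<in>C. \<forall>i\<in>I. F i (x, y) = z}"
  proof (intro equalityI subsetI)
    fix y assume "y \<in> {y \<in> B. \<exists>x\<in>C. \<forall>i\<in>I. F i (x, y) = z}"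
    then obtain x where "x \<in> C" "y \<in> B" "\<forall>i\<in>I. F i (x, y) = z" by blast
    then show "y \<in> snd ` ?Q" by (intro image_eqI[of _ _ "(x, y)"]) auto
  next
    fix y assume "y \<in> snd ` ?Q"
    then obtain p where p: "p \<in> ?Q" "y = snd p" by (rule imageE)
    obtain x y' where "p = (x, y')" by (cases p)
    with p have "(x, y) \<in> ?Q" by (simp only: snd_conv)
    then show "y \<in> {y \<in> B. \<exists>x\<in>C. \<forall>i\<in>I. F i (x, y) = z}" using assms(3) by blast
  qed
  ultimately show ?thesis by simp
qed

lemma second_countable_base:
  assumes "second_countable X"
  obtains \<B> where "countable \<B>"
    "\<And>V x. openin X V \<Longrightarrow> x \<in> V \<Longrightarrow> \<exists>W\<in>\<B>. x \<in> W \<and> W \<subseteq> V"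
proof -
  from assms obtain \<B> where *: "countable \<B> \<and> (\<forall>V\<in>\<B>. openin X V) \<and>
      (\<forall>U x. openin X U \<and> x \<in> U \<longrightarrow> (\<exists>V\<in>\<B>. x \<in> V \<and> V \<subseteq> U))"
    unfolding second_countable_def by (elim exE)
  show ?thesis by (rule that[of \<B>]) (use * in simp_all)
qed

section \<open>The action in charts and the points fixed to high order\<close>

context smooth_action
begin

lemma manifold_M: "smooth_manifold M" and manifold_G: "smooth_manifold \<G>"
  by unfold_locales

lemma act_one: "x \<in> mspace M \<Longrightarrow> act \<one> x = x"
  using id_eq_one by (metis restrict_apply')

definition act_coord :: "'g set \<Rightarrow> ('g \<Rightarrow> 'v) \<Rightarrow> 'm set \<Rightarrow> ('m \<Rightarrow> 'e) \<Rightarrow> 'v \<times> 'e \<Rightarrow> 'e" where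
  "act_coord V \<eta> U \<psi> = (\<lambda>p. \<psi> (act (inv_into V \<eta> (fst p)) (inv_into U \<psi> (snd p))))"

text \<open>The same chart is used before and after acting, so that \<open>act_coord - snd\<close>
  is a displacement. The points whose image leaves \<open>U\<close> are lost, but near a fixed point
  there are none.\<close>

definition act_dom :: "'g set \<Rightarrow> ('g \<Rightarrow> 'v) \<Rightarrow> 'm set \<Rightarrow> ('m \<Rightarrow> 'e) \<Rightarrow> ('v \<times> 'e) set" where
  "act_dom V \<eta> U \<psi> = {p \<in> \<eta> ` V \<times> \<psi> ` U. act (inv_into V \<eta> (fst p)) (inv_into U \<psi> (snd p)) \<in> U}"

lemma act_coord_smooth:
  assumes "(V, \<eta>) \<in> charts \<G>" "(U, \<psi>) \<in> charts M"
  shows "open (act_dom V \<eta> U \<psi>)" "smooth_on (act_dom V \<eta> U \<psi>) (act_coord V \<eta> U \<psi>)"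
  using smooth_map_prod_coordinates[OF manifold_G manifold_M manifold_M smooth_act assms assms(2)]
  by (simp_all add: act_coord_def act_dom_def)

lemma act_slice_smooth:
  assumes "g \<in> carrier G" "(U, \<psi>) \<in> charts M" "(U', \<psi>') \<in> charts M"
  shows "open {y \<in> \<psi> ` U. act g (inv_into U \<psi> y) \<in> U'}"
    and "smooth_on {y \<in> \<psi> ` U. act g (inv_into U \<psi> y) \<in> U'} (\<lambda>y. \<psi>' (act g (inv_into U \<psi> y)))"
  using smooth_map_prod_slice[OF manifold_G manifold_M manifold_M smooth_act _ assms(2,3), of g] assms(1)
  by (simp_all add: mspace_eq_carrier)

lemma mult_slice_smooth:
  assumes "h \<in> carrier G" "(V, \<eta>) \<in> charts \<G>" "(V', \<eta>') \<in> charts \<G>"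
  shows "open {v \<in> \<eta> ` V. h \<otimes> inv_into V \<eta> v \<in> V'}"
    and "smooth_on {v \<in> \<eta> ` V. h \<otimes> inv_into V \<eta> v \<in> V'} (\<lambda>v. \<eta>' (h \<otimes> inv_into V \<eta> v))"
  using smooth_map_prod_slice[OF manifold_G manifold_G manifold_G smooth_mult _ assms(2,3), of h] assms(1)
  by (simp_all add: mspace_eq_carrier)

text \<open>In charts, (h g) x = h (g x) becomes the relation of
  \<open>jker_translate_subset\<close>, with \<tau> the left multiplication by \<open>h\<close> and
  c the action of \<open>h\<close>. The reverse inequality is the same lemma for the inverse of
  \<open>h\<close>.\<close>

lemma jker_dim_translate:
  assumes V: "(V, \<eta>) \<in> charts \<G>" and V': "(V', \<eta>') \<in> charts \<G>" and U: "(U, \<psi>) \<in> charts M"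
    and g: "g \<in> V" "h \<in> carrier G" "h \<otimes> g \<in> V'" and x: "x \<in> U" "act g x \<in> U" "act (h \<otimes> g) x \<in> U"
  shows "dim (jker k (act_coord V \<eta> U \<psi>) (\<eta> g, \<psi> x)) \<le>
    dim (jker k (act_coord V' \<eta>' U \<psi>) (\<eta>' (h \<otimes> g), \<psi> x))"
proof -
  note iV = smooth_manifold.chart_inv[OF manifold_G V] and iV' = smooth_manifold.chart_inv[OF manifold_G V']
    and iU = smooth_manifold.chart_inv[OF manifold_M U]
  have VG: "V \<subseteq> carrier G" and UM: "U \<subseteq> mspace M"
    using smooth_manifold.chart_subset[OF manifold_G V] smooth_manifold.chart_subset[OF manifold_M U]
    by (simp_all add: mspace_eq_carrier)
  let ?\<tau> = "\<lambda>v. \<eta>' (h \<otimes> inv_into V \<eta> v)" and ?\<mu> = "\<lambda>v. \<eta> (inv h \<otimes> inv_into V' \<eta>' v)"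
  let ?c = "\<lambda>y. \<psi> (act h (inv_into U \<psi> y))"
  let ?W = "{v \<in> \<eta> ` V. h \<otimes> inv_into V \<eta> v \<in> V'}"
  let ?W' = "{v \<in> \<eta>' ` V'. inv h \<otimes> inv_into V' \<eta>' v \<in> V}"
  let ?C = "{y \<in> \<psi> ` U. act h (inv_into U \<psi> y) \<in> U}"
  let ?S = "act_dom V \<eta> U \<psi>" and ?S' = "act_dom V' \<eta>' U \<psi>"
  let ?a = "act_coord V \<eta> U \<psi>" and ?a' = "act_coord V' \<eta>' U \<psi>"
  \<comment> \<open>Here g, h g, x, g x and h (g x) all lie in the domains of their charts.\<close>
  let ?N = "(?S \<inter> ?a -` ?C) \<inter> (?W \<times> UNIV)"
  note W = mult_slice_smooth[OF g(2) V V'] and W' = mult_slice_smooth[OF inv_closed[OF g(2)] V' V]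
    and C = act_slice_smooth[OF g(2) U U]
  note S = act_coord_smooth[OF V U] and S' = act_coord_smooth[OF V' U]
  have gW: "\<eta> g \<in> ?W" using g iV by simp
  have gW': "?\<tau> (\<eta> g) \<in> ?W'"
    using g iV iV' VG by (auto simp: inv_solve_left' m_assoc[symmetric])
  have comp: "act (h \<otimes> g') x' = act h (act g' x')" if "g' \<in> V" "x' \<in> U" for g' x'
    using composition_rule[of x' h g'] g(2) that VG UM by blast
  have "dim (jker k ?a (\<eta> g, \<psi> x)) \<le> dim (jker k ?a' (?\<tau> (\<eta> g), \<psi> x))"
  proof (rule jker_translate_dim[OF S _ S' _ C, where N = ?N and \<mu> = ?\<mu> and W = ?W])
    show p: "(\<eta> g, \<psi> x) \<in> ?S"
      using g x iV iU by (auto simp: act_dom_def)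
    show "?\<tau> differentiable (at (\<eta> g))"
      by (rule smooth_on_differentiable[OF W(2) gW])
    show "?\<mu> differentiable (at (?\<tau> (\<eta> g)))"
      by (rule smooth_on_differentiable[OF W'(2) gW'])
    show "open ?N"
      by (intro open_Int open_Times continuous_open_preimage smooth_on_continuous S C W open_UNIV)
    show "(\<eta> g, \<psi> x) \<in> ?N"
      using p gW g x iV iU comp[of g x] by (auto simp: act_coord_def)
    show "(v, y) \<in> ?S \<and> (?\<tau> v, y) \<in> ?S' \<and> ?a (v, y) \<in> ?C \<and> ?a' (?\<tau> v, y) = ?c (?a (v, y))"
      if vy: "(v, y) \<in> ?N" for v y
    proof -
      have v: "v \<in> \<eta> ` V" "h \<otimes> inv_into V \<eta> v \<in> V'" and y: "y \<in> \<psi> ` U"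
        and au: "act (inv_into V \<eta> v) (inv_into U \<psi> y) \<in> U"
        and aC: "act h (inv_into U \<psi> (?a (v, y))) \<in> U"
        using vy by (auto simp: act_dom_def)
      have ia: "inv_into U \<psi> (?a (v, y)) = act (inv_into V \<eta> v) (inv_into U \<psi> y)"
        using iU(1)[OF au] by (simp add: act_coord_def)
      have ab: "act (inv_into V' \<eta>' (?\<tau> v)) (inv_into U \<psi> y) = act h (inv_into U \<psi> (?a (v, y)))"
        using comp[OF iV(3)[OF v(1)] iU(3)[OF y]] iV'(1)[OF v(2)] ia by simp
      show ?thesis
        using vy v y aC ab by (auto simp: act_dom_def) (auto simp: act_coord_def)
    qed
    show "open ?W" "\<eta> g \<in> ?W" by (rule W gW)+
    show "?\<mu> (?\<tau> v) = v" if "v \<in> ?W" for v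
    proof -
      have "inv_into V \<eta> v \<in> carrier G" using that iV(3) VG by blast
      then have "inv h \<otimes> (h \<otimes> inv_into V \<eta> v) = inv_into V \<eta> v"
        using g(2) by (simp add: m_assoc[symmetric])
      then show ?thesis using that iV iV' by simp
    qed
  qed
  then show ?thesis using iV(1)[OF g(1)] by simp
qed

text \<open>Charts are arbitrary outside their domains, so agreement in a chart alone would not
  force \<open>act g x = x\<close>; hence the separate clause.\<close>

definition jet_fixed :: "nat \<Rightarrow> 'g \<Rightarrow> 'm \<Rightarrow> bool" where
  "jet_fixed n g x \<longleftrightarrow> act g x = x \<and>
    (\<forall>(U, \<psi>) \<in> charts M. x \<in> U \<longrightarrow> agree n (\<lambda>y. \<psi> (act g (inv_into U \<psi> y))) (\<lambda>y. y) (\<psi> x))"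

text \<open>A single nowhere dense set must serve all elements near \<open>g\<close>, so that
  countably many boxes suffice later. The assumption \<open>const\<close> is the regularity of
  \<open>x\<close> that holds off a nowhere dense set.\<close>

lemma jet_fixed_box:
  assumes rare: "fixpoint_rare G (mtop M) act" and n: "n = mdim \<G>"
    and V1: "(V1, \<eta>1) \<in> charts \<G>" "\<one> \<in> V1" and U: "(U, \<psi>) \<in> charts M"
    and g: "g \<in> carrier G" "g \<noteq> \<one>" and x: "x \<in> U" "act g x = x"
  defines "\<delta> \<equiv> \<lambda>k y. dim (jker k (act_coord V1 \<eta>1 U \<psi>) (\<eta>1 \<one>, y))"
  assumes const: "\<forall>\<^sub>F y in nhds (\<psi> x). \<forall>k\<in>{..Suc n}. \<delta> k y = \<delta> k (\<psi> x)"
  shows "\<exists>Og Ox T. openin (mtop \<G>) Og \<and> g \<in> Og \<and> openin (mtop M) Ox \<and> x \<in> Ox \<and>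
    nowhere_dense_in (mtop M) T \<and> (\<forall>g'\<in>Og. \<forall>x'\<in>Ox. jet_fixed n g' x' \<longrightarrow> x' \<in> T)"
proof -
  obtain V \<eta> where V: "(V, \<eta>) \<in> charts \<G>" "g \<in> V"
    using smooth_manifold.chart_cover[OF manifold_G] g(1) by (metis (no_types, lifting) case_prodE mspace_eq_carrier)
  note iV = smooth_manifold.chart_inv[OF manifold_G V(1)] and iU = smooth_manifold.chart_inv[OF manifold_M U]
  have VG: "V \<subseteq> carrier G" and UM: "U \<subseteq> mspace M"
    using smooth_manifold.chart_subset[OF manifold_G V(1)] smooth_manifold.chart_subset[OF manifold_M U]
    by (simp_all add: mspace_eq_carrier)
  let ?S = "act_dom V \<eta> U \<psi>" and ?a = "act_coord V \<eta> U \<psi>"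
  note S = act_coord_smooth[OF V(1) U]
  define f where "f = (\<lambda>p. ?a p - snd p)"
  have smooth_f: "smooth_on ?S f"
    unfolding f_def by (intro smooth_on_diff S smooth_on_linear[OF S(1) linear_snd smooth_on_id])
  obtain B0 where B0: "open B0" "\<psi> x \<in> B0" "\<And>y k. y \<in> B0 \<Longrightarrow> k \<le> Suc n \<Longrightarrow> \<delta> k y = \<delta> k (\<psi> x)"
    using const unfolding eventually_nhds by auto
  have "closedin (mtop \<G>) {\<one>}"
    using smooth_manifold.Hausdorff[OF manifold_G]
    by (simp add: closedin_Hausdorff_sing_eq mspace_eq_carrier)
  \<comment> \<open>The identity is removed from the parameters, so that an element found to fix an
    open set contradicts fixpoint rarity.\<close>
  then have V1open: "open (\<eta> ` (V - {\<one>}))"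
    by (intro smooth_manifold.chart_open_image[OF manifold_G V(1)] openin_diff
        smooth_manifold.chart_domain[OF manifold_G V(1)]) auto
  have p0: "(\<eta> g, \<psi> x) \<in> ?S \<inter> (\<eta> ` (V - {\<one>}) \<times> B0)"
    using g x V(2) iV iU B0(2) by (auto simp: act_dom_def)
  obtain A B where AB: "open A" "open B" "(\<eta> g, \<psi> x) \<in> A \<times> B" "A \<times> B \<subseteq> ?S \<inter> (\<eta> ` (V - {\<one>}) \<times> B0)"
    by (rule open_prod_elim[OF open_Int[OF S(1) open_Times[OF V1open B0(1)]] p0])
  \<comment> \<open>Translating from the identity to \<open>g'\<close> and back gives both
    inequalities, so the dimension depends only on the point, and there it is constant on
    \<open>B0\<close>.\<close>
  have dims: "dim (jker k f p) = \<delta> k (\<psi> x)" if p: "p \<in> A \<times> B" and k: "k \<le> Suc n" for p k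
  proof -
    have pS: "p \<in> ?S" using p AB(4) by blast
    then obtain g' x' where p': "p = (\<eta> g', \<psi> x')" "g' \<in> V" "x' \<in> U" "act g' x' \<in> U"
      using iV iU by (auto simp: act_dom_def)
    have g': "g' \<in> carrier G" using p'(2) VG by blast
    have ac1: "act \<one> x' \<in> U" using act_one p'(3) UM by (metis subsetD)
    have "\<delta> k (\<psi> x') \<le> dim (jker k ?a p)"
      using jker_dim_translate[OF V1(1) V(1) U V1(2) g' _ p'(3) ac1, of k] g' p' by (simp add: \<delta>_def)
    moreover have "dim (jker k ?a p) \<le> \<delta> k (\<psi> x')"
      using jker_dim_translate[OF V(1) V1(1) U p'(2) inv_closed[OF g'] _ p'(3,4), of k] g' p' V1(2) ac1
      by (simp add: \<delta>_def)
    moreover have "\<delta> k (\<psi> x') = \<delta> k (\<psi> x)"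
      using B0(3)[OF _ k] p AB(4) p'(1) by blast
    ultimately show ?thesis
      unfolding f_def jker_diff_snd[OF S pS] by simp
  qed
  have sub: "subspace (jker k f p)" if "p \<in> A \<times> B" for k p
    using that AB(4) by (intro subspace_jker[OF smooth_f]) blast
  have "\<exists>k\<le>n. \<delta> (Suc k) (\<psi> x) = \<delta> k (\<psi> x)"
  proof (rule antimono_nat_stabilizes)
    show "\<delta> 0 (\<psi> x) \<le> n" by (simp add: \<delta>_def n mdim_def)
    show "\<delta> (Suc k) (\<psi> x) \<le> \<delta> k (\<psi> x)" for k
      unfolding \<delta>_def by (rule findim.dim_subset[OF jker_mono]) simp
  qed
  then obtain k where k: "k \<le> n" "\<delta> (Suc k) (\<psi> x) = \<delta> k (\<psi> x)" by blast
  interpret constant_rank A B f k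
  proof
    show "open A" "open B" by fact+
    show "smooth_on (A \<times> B) f" using smooth_on_subset[OF smooth_f] AB(4) by blast
    show "dim (jker k f p) = dim (jker k f q)" if "p \<in> A \<times> B" "q \<in> A \<times> B" for p q
      using dims that k(1) by simp
    show "jker (Suc k) f p = jker k f p" if "p \<in> A \<times> B" for p
      by (rule findim.subspace_dim_equal[OF sub sub jker_mono])
        (use that dims[OF that] k in auto)
  qed
  have gx: "\<eta> g \<in> A" "\<psi> x \<in> B" using AB(3) by auto
  obtain r where r: "r > 0" "cball (\<eta> g) r \<subseteq> A" "ball (\<psi> x) r \<subseteq> B"
    "\<forall>W. open W \<longrightarrow> W \<noteq> {} \<longrightarrow> W \<subseteq> ball (\<psi> x) r \<longrightarrow>
      (\<forall>y\<in>W. \<exists>v\<in>cball (\<eta> g) r. \<forall>vs. length vs \<le> k \<longrightarrow> xderiv vs f (v, y) = 0) \<longrightarrow>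
      (\<exists>v\<in>A. \<exists>W'\<subseteq>W. open W' \<and> W' \<noteq> {} \<and> (\<forall>y\<in>W'. f (v, y) = 0))"
    using constant_parameter[OF gx] by (elim exE conjE) (rule that)
  let ?C = "cball (\<eta> g) r" and ?B = "ball (\<psi> x) r"
  \<comment> \<open>Only orders up to \<open>k\<close> are imposed, and k <= n, so \<open>T\<close>
    contains all points of the ball that some parameter in \<open>?C\<close> fixes to order
    \<open>n\<close>. Compactness of \<open>?C\<close> makes \<open>T\<close> relatively
    closed.\<close>
  define T where "T = {y \<in> ?B. \<exists>v\<in>?C. \<forall>vs\<in>{vs. length vs \<le> k}. xderiv vs f (v, y) = 0}"
  have CB: "?C \<times> ?B \<subseteq> A \<times> B" using r by blast
  have "closedin (top_of_set ?B) T"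
    unfolding T_def
  proof (rule closedin_projection[OF compact_cball])
    show "continuous_on (?C \<times> ?B) (xderiv vs f)" for vs
      by (rule continuous_on_subset[OF smooth_on_continuous[OF smooth_on_iter_deriv[OF smooth]] CB])
  qed (auto intro: exI[of _ "[]"])
  then have "openin (top_of_set ?B) (?B - T)"
    by (simp add: closedin_def)
  then have openT: "open (?B - T)"
    using openin_open_trans by blast
  have noopen: False if W: "open W" "W \<noteq> {}" "W \<subseteq> T" for W
  proof -
    have "W \<subseteq> ?B" "\<forall>y\<in>W. \<exists>v\<in>?C. \<forall>vs. length vs \<le> k \<longrightarrow> xderiv vs f (v, y) = 0"
      using W(3) unfolding T_def by auto
    with r(4) W(1,2) obtain v W' where v: "v \<in> A"
      and W': "W' \<subseteq> W" "open W'" "W' \<noteq> {}" "\<And>y. y \<in> W' \<Longrightarrow> f (v, y) = 0"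
      by metis
    have vy: "(v, y) \<in> ?S \<inter> (\<eta> ` (V - {\<one>}) \<times> B0)" if "y \<in> W'" for y
      using that v W'(1) W(3) AB(4) r(3) unfolding T_def by blast
    then have "v \<in> \<eta> ` (V - {\<one>})" using W'(3) by blast
    then have "inv_into V \<eta> v \<in> V - {\<one>}" using iV(1) by auto
    then have g': "inv_into V \<eta> v \<in> carrier G - {\<one>}" using VG by blast
    have W'U: "W' \<subseteq> \<psi> ` U" using vy by (auto simp: act_dom_def)
    have fixes_z: "act (inv_into V \<eta> v) z = z" if z: "z \<in> U" "\<psi> z \<in> W'" for z
    proof -
      have "act (inv_into V \<eta> v) z \<in> U" "\<psi> (act (inv_into V \<eta> v) z) = \<psi> z"
        using vy[OF z(2)] W'(4)[OF z(2)] iU(1)[OF z(1)] by (auto simp: act_dom_def act_coord_def f_def)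
      then show ?thesis using iU(1) z(1) by metis
    qed
    have "openin (mtop M) {z \<in> U. \<psi> z \<in> W'}"
      by (rule smooth_manifold.chart_open_preimage[OF manifold_M U W'(2)])
    moreover have "{z \<in> U. \<psi> z \<in> W'} \<subseteq> {z \<in> mspace M. act (inv_into V \<eta> v) z = z}"
      using fixes_z UM by blast
    moreover have "{z \<in> U. \<psi> z \<in> W'} \<noteq> {}" using W'U W'(3) by blast
    moreover have "mtop M interior_of {z \<in> mspace M. act (inv_into V \<eta> v) z = z} = {}"
      using rare g' unfolding fixpoint_rare_def by blast
    ultimately show False
      using interior_of_eq_empty by blast
  qed
  have nd: "nowhere_dense_in (mtop M) {z \<in> U. \<psi> z \<in> T}"
    by (rule smooth_manifold.nowhere_dense_in_chart[OF manifold_M U open_ball _ openT noopen])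
      (auto simp: T_def)
  have mem: "z \<in> {z \<in> U. \<psi> z \<in> T}"
    if g': "g' \<in> V" "\<eta> g' \<in> ball (\<eta> g) r" and z: "z \<in> U" "\<psi> z \<in> ?B" and jf: "jet_fixed n g' z" for g' z
  proof -
    have inA: "\<eta> g' \<in> A" "\<eta> g' \<in> ?C" using g'(2) r(2) by auto
    have inS: "(\<eta> g', y) \<in> ?S" if "y \<in> B" for y using that inA(1) AB(4) by blast
    have zB: "\<psi> z \<in> B" using z(2) r(3) by blast
    have "agree n (\<lambda>y. \<psi> (act g' (inv_into U \<psi> y))) (\<lambda>y. y) (\<psi> z)"
      using jf U z(1) unfolding jet_fixed_def by blast
    then have "agree n (\<lambda>y. ?a (\<eta> g', y)) (\<lambda>y. y) (\<psi> z)"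
      by (simp add: act_coord_def iV(1)[OF g'(1)])
    then have "agree n (\<lambda>y. ?a (\<eta> g', y) - y) (\<lambda>y. 0) (\<psi> z)"
      by (subst agree_zero_iff[OF AB(2) zB smooth_on_subset[OF smooth_on_slice[OF S, of "\<eta> g'"]]
            smooth_on_id[OF AB(2)]]) (use inS in auto)
    then have "xderiv vs f (\<eta> g', \<psi> z) = 0" if "length vs \<le> n" for vs
      using that iter_deriv_slice[OF S(1) smooth_f inS[OF zB], of vs]
      by (simp add: agree_def f_def iter_deriv_zero)
    then show ?thesis
      using z inA(2) k(1) by (auto simp: T_def intro!: bexI[of _ "\<eta> g'"])
  qed
  show ?thesis
    by (intro exI[of _ "{g' \<in> V. \<eta> g' \<in> ball (\<eta> g) r}"] exI[of _ "{z \<in> U. \<psi> z \<in> ?B}"]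
        exI[of _ "{z \<in> U. \<psi> z \<in> T}"] conjI nd
        smooth_manifold.chart_open_preimage[OF manifold_G V(1) open_ball]
        smooth_manifold.chart_open_preimage[OF manifold_M U open_ball])
      (use mem V(2) x(1) r(1) in auto)
qed

text \<open>Points where some kernel dimension fails to be locally constant form one nowhere dense
  set, by semicontinuity. The remaining pairs of element and point are covered by the boxes of
  \<open>jet_fixed_box\<close>.\<close>

lemma jet_fixed_chart_meager:
  assumes rare: "fixpoint_rare G (mtop M) act" and n: "n = mdim \<G>" and U: "(U, \<psi>) \<in> charts M"
  shows "\<exists>\<N>. countable \<N> \<and> (\<forall>N\<in>\<N>. nowhere_dense_in (mtop M) N) \<and>
    (\<forall>g\<in>carrier G - {\<one>}. \<forall>x\<in>U. jet_fixed n g x \<longrightarrow> x \<in> \<Union>\<N>)"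
proof -
  obtain V1 \<eta>1 where V1: "(V1, \<eta>1) \<in> charts \<G>" "\<one> \<in> V1"
    using smooth_manifold.chart_cover[OF manifold_G] one_closed
    by (metis (no_types, lifting) case_prodE mspace_eq_carrier)
  note iU = smooth_manifold.chart_inv[OF manifold_M U] and iV1 = smooth_manifold.chart_inv[OF manifold_G V1(1)]
  note E = smooth_manifold.chart_range[OF manifold_M U]
  define \<delta> where "\<delta> = (\<lambda>k y. dim (jker k (act_coord V1 \<eta>1 U \<psi>) (\<eta>1 \<one>, y)))"
  \<comment> \<open>The kernels are taken at the identity, where the action in charts is defined
    over all of \<open>U\<close>. Orders up to n+1 enter because k and k+1 are compared for k <=
    n.\<close>
  define R where "R = {y \<in> \<psi> ` U. \<forall>\<^sub>F y' in nhds y. \<forall>k\<in>{..Suc n}. \<delta> k y' = \<delta> k y}"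
  have openR: "open R"
    unfolding open_subopen[of R]
  proof
    fix y assume y: "y \<in> R"
    then have "\<forall>\<^sub>F y' in nhds y. y' \<in> \<psi> ` U \<and> (\<forall>k\<in>{..Suc n}. \<delta> k y' = \<delta> k y)"
      using eventually_nhds_in_open[OF E] by (auto simp: R_def intro: eventually_conj)
    then obtain W where W: "open W" "y \<in> W"
      "\<And>y'. y' \<in> W \<Longrightarrow> y' \<in> \<psi> ` U \<and> (\<forall>k\<in>{..Suc n}. \<delta> k y' = \<delta> k y)"
      unfolding eventually_nhds by blast
    have "W \<subseteq> R"
    proof
      fix y' assume y': "y' \<in> W"
      have "\<forall>\<^sub>F y'' in nhds y'. \<forall>k\<in>{..Suc n}. \<delta> k y'' = \<delta> k y'"
        using eventually_nhds_in_open[OF W(1) y'] by (rule eventually_mono) (use W(3) y' in auto)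
      then show "y' \<in> R" using W(3)[OF y'] by (simp add: R_def)
    qed
    then show "\<exists>T. open T \<and> y \<in> T \<and> T \<subseteq> R" using W by blast
  qed
  have usc: "\<forall>\<^sub>F y' in nhds y. \<delta> k y' \<le> \<delta> k y" if y: "y \<in> \<psi> ` U" for k y
  proof -
    have "act \<one> (inv_into U \<psi> y) \<in> U"
      using act_one iU(3)[OF y] smooth_manifold.chart_subset[OF manifold_M U] by (metis subsetD)
    then have "(\<eta>1 \<one>, y) \<in> act_dom V1 \<eta>1 U \<psi>"
      using y V1(2) iV1 by (auto simp: act_dom_def)
    from jker_dim_upper_semicontinuous[OF act_coord_smooth[OF V1(1) U] this, of k]
    obtain r where r: "r > 0" "\<And>y'. y' \<in> cball y r \<Longrightarrow> \<delta> k y' \<le> \<delta> k y"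
      unfolding \<delta>_def by (meson centre_in_cball less_imp_le)
    then show ?thesis
      using eventually_nhds_ball[OF r(1), of y] by (auto elim: eventually_mono)
  qed
  define N0 where "N0 = {x \<in> U. \<psi> x \<in> \<psi> ` U - R}"
  have N0: "nowhere_dense_in (mtop M) N0"
    unfolding N0_def
  proof (rule smooth_manifold.nowhere_dense_in_chart[OF manifold_M U E])
    show "open (\<psi> ` U - (\<psi> ` U - R))"
      using openR by (simp add: Diff_Diff_Int Int_absorb1 R_def)
    fix W assume W: "open W" "W \<noteq> {}" "W \<subseteq> \<psi> ` U - R"
    have "\<exists>y\<in>W. \<forall>\<^sub>F y' in nhds y. \<forall>k\<in>{..Suc n}. \<delta> k y' = \<delta> k y"
      by (rule upper_semicontinuous_locally_constant[OF _ E usc W(1,2)]) (use W in auto)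
    then show False using W(3) by (auto simp: R_def)
  qed simp
  obtain \<B>G where BG: "countable \<B>G"
    "\<And>V x. openin (mtop \<G>) V \<Longrightarrow> x \<in> V \<Longrightarrow> \<exists>W\<in>\<B>G. x \<in> W \<and> W \<subseteq> V"
    by (rule second_countable_base[OF smooth_manifold.second_countable[OF manifold_G]]) (rule that)
  obtain \<B>M where BM: "countable \<B>M"
    "\<And>V x. openin (mtop M) V \<Longrightarrow> x \<in> V \<Longrightarrow> \<exists>W\<in>\<B>M. x \<in> W \<and> W \<subseteq> V"
    by (rule second_countable_base[OF smooth_manifold.second_countable[OF manifold_M]]) (rule that)
  \<comment> \<open>One set is chosen per pair of basic open sets that admits one. Every box
    contains such a pair around its centre, so countably many choices suffice.\<close>
  define good where "good = (\<lambda>b T. nowhere_dense_in (mtop M) T \<and>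
    (\<forall>g\<in>fst b. \<forall>x\<in>snd b. jet_fixed n g x \<longrightarrow> x \<in> T))"
  define \<N> where "\<N> = insert N0 ((\<lambda>b. SOME T. good b T) ` {b \<in> \<B>G \<times> \<B>M. \<exists>T. good b T})"
  have good: "good b (SOME T. good b T)" if "\<exists>T. good b T" for b
    using someI_ex[OF that] .
  have "countable \<N>"
    unfolding \<N>_def using BG(1) BM(1)
    by (intro countable_insert countable_image countable_subset[OF _ countable_SIGMA[of \<B>G "\<lambda>_. \<B>M"]]) auto
  moreover have "nowhere_dense_in (mtop M) N" if "N \<in> \<N>" for N
    using that N0 good unfolding \<N>_def good_def by blast
  moreover have "x \<in> \<Union>\<N>" if g: "g \<in> carrier G - {\<one>}" and x: "x \<in> U" and jf: "jet_fixed n g x" for g x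
  proof (cases "\<psi> x \<in> R")
    case False
    then have "x \<in> N0" using x by (simp add: N0_def)
    then show ?thesis by (auto simp: \<N>_def)
  next
    case True
    then have "\<forall>\<^sub>F y in nhds (\<psi> x). \<forall>k\<in>{..Suc n}. \<delta> k y = \<delta> k (\<psi> x)" by (simp add: R_def)
    moreover have "act g x = x" using jf by (simp add: jet_fixed_def)
    ultimately obtain Og Ox T where T: "openin (mtop \<G>) Og" "g \<in> Og" "openin (mtop M) Ox" "x \<in> Ox"
      "nowhere_dense_in (mtop M) T" "\<forall>g'\<in>Og. \<forall>x'\<in>Ox. jet_fixed n g' x' \<longrightarrow> x' \<in> T"
      using jet_fixed_box[OF rare n V1 U _ _ x, of g] g unfolding \<delta>_def by blast
    obtain b1 b2 where b: "b1 \<in> \<B>G" "g \<in> b1" "b1 \<subseteq> Og" "b2 \<in> \<B>M" "x \<in> b2" "b2 \<subseteq> Ox"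
      using BG(2)[OF T(1,2)] BM(2)[OF T(3,4)] by blast
    have "good (b1, b2) T" unfolding good_def using T b by auto
    then have ex: "\<exists>T. good (b1, b2) T" by blast
    then have "x \<in> (SOME T. good (b1, b2) T)"
      using good[OF ex] b jf unfolding good_def by auto
    then show ?thesis using ex b unfolding \<N>_def by blast
  qed
  ultimately show ?thesis by blast
qed

text \<open>The atlas may be uncountable, so the families found for charts are indexed by basic open
  sets contained in chart domains.\<close>

lemma jet_fixed_meager:
  assumes rare: "fixpoint_rare G (mtop M) act" and n: "n = mdim \<G>"
  shows "\<exists>\<N>. countable \<N> \<and> (\<forall>N\<in>\<N>. nowhere_dense_in (mtop M) N) \<and>
    (\<forall>g\<in>carrier G - {\<one>}. \<forall>x\<in>mspace M. jet_fixed n g x \<longrightarrow> x \<in> \<Union>\<N>)"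
proof -
  obtain \<B> where B: "countable \<B>"
    "\<And>V x. openin (mtop M) V \<Longrightarrow> x \<in> V \<Longrightarrow> \<exists>W\<in>\<B>. x \<in> W \<and> W \<subseteq> V"
    by (rule second_countable_base[OF smooth_manifold.second_countable[OF manifold_M]]) (rule that)
  define good where "good = (\<lambda>b \<N>. countable \<N> \<and> (\<forall>N\<in>\<N>. nowhere_dense_in (mtop M) N) \<and>
    (\<forall>g\<in>carrier G - {\<one>}. \<forall>x\<in>b. jet_fixed n g x \<longrightarrow> x \<in> \<Union>\<N>))"
  define \<N> where "\<N> = (\<Union>b\<in>{b \<in> \<B>. \<exists>\<N>. good b \<N>}. SOME \<N>. good b \<N>)"
  have good: "good b (SOME \<N>. good b \<N>)" if "\<exists>\<N>. good b \<N>" for b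
    using someI_ex[OF that] .
  have "countable \<N>"
    unfolding \<N>_def
  proof (rule countable_UN)
    show "countable {b \<in> \<B>. \<exists>\<N>. good b \<N>}" by (rule countable_subset[OF _ B(1)]) blast
    show "countable (SOME \<N>. good b \<N>)" if "b \<in> {b \<in> \<B>. \<exists>\<N>. good b \<N>}" for b
      using good[of b] that unfolding good_def by blast
  qed
  moreover have "nowhere_dense_in (mtop M) N" if "N \<in> \<N>" for N
    using that good unfolding \<N>_def good_def by blast
  moreover have "x \<in> \<Union>\<N>"
    if g: "g \<in> carrier G - {\<one>}" and x: "x \<in> mspace M" and jf: "jet_fixed n g x" for g x
  proof -
    obtain U \<psi> where U: "(U, \<psi>) \<in> charts M" "x \<in> U"
      using smooth_manifold.chart_cover[OF manifold_M x] by blast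
    obtain b where b: "b \<in> \<B>" "x \<in> b" "b \<subseteq> U"
      using B(2)[OF smooth_manifold.chart_domain[OF manifold_M U(1)] U(2)] by blast
    obtain \<N>' where "good U \<N>'"
      using jet_fixed_chart_meager[OF rare n U(1)] unfolding good_def by blast
    then have "good b \<N>'" using b(3) unfolding good_def by blast
    then have ex: "\<exists>\<N>. good b \<N>" by blast
    then have "x \<in> \<Union>(SOME \<N>. good b \<N>)"
      using good[OF ex] g b(2) jf unfolding good_def by blast
    then show ?thesis using ex b(1) unfolding \<N>_def by blast
  qed
  ultimately show ?thesis by blast
qed

end

section \<open>The frame bundle\<close>

lemma jet_coord_eq_iff: "jet_coord k \<psi> \<phi> = jet_coord k \<psi> \<phi>' \<longleftrightarrow> agree k (\<lambda>u. \<psi> (\<phi> u)) (\<lambda>u. \<psi> (\<phi>' u)) 0"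
  by (auto simp: jet_coord_def agree_def fun_eq_iff o_def)

lemma nowhere_dense_in_subset:
  assumes "nowhere_dense_in X T" "S \<subseteq> T"
  shows "nowhere_dense_in X S"
  using assms interior_of_mono[OF closure_of_mono[OF assms(2), of X], of X]
  by (auto simp: nowhere_dense_in_def)

text \<open>\<open>local_diffeos\<close> with its witnesses exposed and smoothness stated through
  the charts of \<open>M\<close> rather than restricted charts. The identity on \<open>W\<close>
  fixes the inverse on the image, which yields the opposite identity.\<close>

definition local_diffeo_on :: "('m, 'e::findim_inner) manifold \<Rightarrow> 'e set \<Rightarrow> ('m \<Rightarrow> 'e) \<Rightarrow> ('e \<Rightarrow> 'm) \<Rightarrow> bool" where
  "local_diffeo_on M W \<gamma> \<phi> \<longleftrightarrow> open W \<and> 0 \<in> W \<and> openin (mtop M) (\<phi> ` W) \<and>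
    continuous_map (top_of_set W) (mtop M) \<phi> \<and>
    continuous_map (subtopology (mtop M) (\<phi> ` W)) (top_of_set W) \<gamma> \<and> (\<forall>u\<in>W. \<gamma> (\<phi> u) = u) \<and>
    (\<forall>(U, \<psi>) \<in> charts M. smooth_on {u \<in> W. \<phi> u \<in> U} (\<lambda>u. \<psi> (\<phi> u))) \<and>
    (\<forall>(U, \<psi>) \<in> charts M. smooth_on (\<psi> ` (U \<inter> \<phi> ` W)) (\<lambda>y. \<gamma> (inv_into U \<psi> y)))"

lemma ball_singleton: "(\<forall>x\<in>{a}. P x) \<longleftrightarrow> P a"
  by simp

lemma ball_restricted_charts:
  "(\<forall>(V, \<eta>) \<in> {(U \<inter> X, \<psi>) |U \<psi>. (U, \<psi>) \<in> C}. R V \<eta>) \<longleftrightarrow> (\<forall>(U, \<psi>) \<in> C. R (U \<inter> X) \<psi>)"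
  by auto

lemma open_submanifold_simps:
  "mtop (open_submanifold M X) = subtopology (mtop M) X"
  "charts (open_submanifold M X) = {(U \<inter> X, \<psi>) |U \<psi>. (U, \<psi>) \<in> charts M}"
  "mtop (open_submanifold model_manifold W) = top_of_set W"
  "charts (open_submanifold model_manifold W) = {(UNIV \<inter> W, id)}"
  by (auto simp: open_submanifold_def model_manifold_def)

context smooth_manifold
begin

lemma open_chart_preimage_map:
  assumes "open W" "continuous_map (top_of_set W) (mtop M) \<phi>" "openin (mtop M) V"
  shows "open {u \<in> W. \<phi> u \<in> V}"
  using openin_continuous_map_preimage[OF assms(2,3)] assms(1) openin_open_trans by simp blast

lemma open_chart_image_Int:
  assumes "(U, \<psi>) \<in> charts M" "openin (mtop M) V"
  shows "open (\<psi> ` (U \<inter> V))"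
  by (rule chart_open_image[OF assms(1)]) (use assms chart_domain in auto)

lemma smooth_map_from_model_iff:
  assumes "open W" "openin (mtop M) (\<phi> ` W)"
  shows "smooth_map (open_submanifold model_manifold W) (open_submanifold M (\<phi> ` W)) \<phi> \<longleftrightarrow>
    continuous_map (top_of_set W) (mtop M) \<phi> \<and>
    (\<forall>(U, \<psi>) \<in> charts M. smooth_on {u \<in> W. \<phi> u \<in> U} (\<lambda>u. \<psi> (\<phi> u)))"
proof -
  have set: "id ` {u \<in> UNIV \<inter> W. \<phi> u \<in> U \<inter> \<phi> ` W} = {u \<in> W. \<phi> u \<in> U}" for U by auto
  have fn: "smooth_on {u \<in> W. \<phi> u \<in> U} (\<psi> \<circ> \<phi> \<circ> inv_into (UNIV \<inter> W) id) \<longleftrightarrow>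
      smooth_on {u \<in> W. \<phi> u \<in> U} (\<lambda>u. \<psi> (\<phi> u))"
    if "continuous_map (top_of_set W) (mtop M) \<phi>" "(U, \<psi>) \<in> charts M" for U \<psi>
  proof (rule smooth_on_cong)
    show "open {u \<in> W. \<phi> u \<in> U}"
      by (rule open_chart_preimage_map[OF assms(1) that(1) chart_domain[OF that(2)]])
    show "(\<psi> \<circ> \<phi> \<circ> inv_into (UNIV \<inter> W) id) u = \<psi> (\<phi> u)" if "u \<in> {u \<in> W. \<phi> u \<in> U}" for u
      using that inv_into_f_f[of id "UNIV \<inter> W" u] by simp
  qed
  have "continuous_map (subtopology euclidean W) (subtopology (mtop M) (\<phi> ` W)) \<phi> \<longleftrightarrow>
      continuous_map (top_of_set W) (mtop M) \<phi>"
    by (auto simp: continuous_map_in_subtopology)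
  moreover have "(\<forall>c\<in>charts M. case c of (U, \<psi>) \<Rightarrow> smooth_on {u \<in> W. \<phi> u \<in> U} (\<psi> \<circ> \<phi> \<circ> inv_into (UNIV \<inter> W) id)) \<longleftrightarrow>
      (\<forall>c\<in>charts M. case c of (U, \<psi>) \<Rightarrow> smooth_on {u \<in> W. \<phi> u \<in> U} (\<lambda>u. \<psi> (\<phi> u)))"
    if "continuous_map (top_of_set W) (mtop M) \<phi>"
    by (rule ball_cong[OF refl], clarify, rule fn[OF that])
  ultimately show ?thesis
    unfolding smooth_map_def open_submanifold_simps(3,4) unfolding open_submanifold_simps(1,2)
      ball_restricted_charts ball_singleton prod.case set by blast
qed

lemma smooth_map_to_model_iff:
  assumes "open W" "openin (mtop M) (\<phi> ` W)"
  shows "smooth_map (open_submanifold M (\<phi> ` W)) (open_submanifold model_manifold W) \<gamma> \<longleftrightarrow>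
    continuous_map (subtopology (mtop M) (\<phi> ` W)) (top_of_set W) \<gamma> \<and>
    (\<forall>(U, \<psi>) \<in> charts M. smooth_on (\<psi> ` (U \<inter> \<phi> ` W)) (\<lambda>y. \<gamma> (inv_into U \<psi> y)))"
proof -
  have set: "\<psi> ` {x \<in> U \<inter> \<phi> ` W. \<gamma> x \<in> UNIV \<inter> W} = \<psi> ` (U \<inter> \<phi> ` W)"
    if "continuous_map (subtopology (mtop M) (\<phi> ` W)) (top_of_set W) \<gamma>" for U \<psi>
  proof -
    have "\<gamma> x \<in> W" if "x \<in> \<phi> ` W" for x
      using continuous_map_image_subset_topspace[OF \<open>continuous_map _ _ \<gamma>\<close>] that
        openin_subset[OF assms(2)] by (auto simp: image_subset_iff)
    then show ?thesis by auto
  qed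
  have fn: "smooth_on (\<psi> ` (U \<inter> \<phi> ` W)) (id \<circ> \<gamma> \<circ> inv_into (U \<inter> \<phi> ` W) \<psi>) \<longleftrightarrow>
      smooth_on (\<psi> ` (U \<inter> \<phi> ` W)) (\<lambda>y. \<gamma> (inv_into U \<psi> y))" if "(U, \<psi>) \<in> charts M" for U \<psi>
  proof (rule smooth_on_cong)
    show "open (\<psi> ` (U \<inter> \<phi> ` W))" by (rule open_chart_image_Int[OF that assms(2)])
    have inj: "inj_on \<psi> (U \<inter> \<phi> ` W)"
      using chart_inj[OF that] inj_on_subset by blast
    show "(id \<circ> \<gamma> \<circ> inv_into (U \<inter> \<phi> ` W) \<psi>) y = \<gamma> (inv_into U \<psi> y)" if "y \<in> \<psi> ` (U \<inter> \<phi> ` W)" for y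
      using that inv_into_f_f[OF inj] chart_inv(1)[OF \<open>(U, \<psi>) \<in> charts M\<close>] by fastforce
  qed
  have "(\<forall>c\<in>charts M. case c of (U, \<psi>) \<Rightarrow>
        smooth_on (\<psi> ` {x \<in> U \<inter> \<phi> ` W. \<gamma> x \<in> UNIV \<inter> W}) (id \<circ> \<gamma> \<circ> inv_into (U \<inter> \<phi> ` W) \<psi>)) \<longleftrightarrow>
      (\<forall>c\<in>charts M. case c of (U, \<psi>) \<Rightarrow> smooth_on (\<psi> ` (U \<inter> \<phi> ` W)) (\<lambda>y. \<gamma> (inv_into U \<psi> y)))"
    if "continuous_map (subtopology (mtop M) (\<phi> ` W)) (top_of_set W) \<gamma>"
    unfolding set[OF that] by (rule ball_cong[OF refl], clarify, rule fn)
  then show ?thesis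
    unfolding smooth_map_def open_submanifold_simps(3,4) unfolding open_submanifold_simps(1,2)
      ball_restricted_charts ball_singleton prod.case by blast
qed

lemma local_diffeos_iff: "\<phi> \<in> local_diffeos M \<longleftrightarrow> (\<exists>W \<gamma>. local_diffeo_on M W \<gamma> \<phi>)"
proof -
  have top: "Defs.mspace (open_submanifold model_manifold W) = W" for W :: "'e set"
    by (simp add: open_submanifold_simps(3))
  have top': "Defs.mspace (open_submanifold M (\<phi> ` W)) = \<phi> ` W" if "openin (mtop M) (\<phi> ` W)" for W
    using openin_subset[OF that] by (auto simp: open_submanifold_simps(1))
  have iff: "diffeomorphism (open_submanifold model_manifold W) (open_submanifold M (\<phi> ` W)) \<phi> \<and> 0 \<in> W
      \<longleftrightarrow> (\<exists>\<gamma>. local_diffeo_on M W \<gamma> \<phi>)"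
    if W: "open W" "openin (mtop M) (\<phi> ` W)" for W
  proof -
    have inv: "(\<forall>x\<in>W. \<gamma> (\<phi> x) = x) \<and> (\<forall>y\<in>\<phi> ` W. \<phi> (\<gamma> y) = y) \<longleftrightarrow> (\<forall>u\<in>W. \<gamma> (\<phi> u) = u)" for \<gamma>
      by auto
    show ?thesis
      unfolding diffeomorphism_def smooth_map_from_model_iff[OF W] smooth_map_to_model_iff[OF W]
        local_diffeo_on_def top top'[OF W(2)] inv
      using W by blast
  qed
  show ?thesis
  proof
    assume "\<phi> \<in> local_diffeos M"
    then obtain W where "open W" "0 \<in> W" "openin (mtop M) (\<phi> ` W)"
      "diffeomorphism (open_submanifold model_manifold W) (open_submanifold M (\<phi> ` W)) \<phi>"
      unfolding local_diffeos_def by blast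
    then show "\<exists>W \<gamma>. local_diffeo_on M W \<gamma> \<phi>" using iff[of W] by blast
  next
    assume "\<exists>W \<gamma>. local_diffeo_on M W \<gamma> \<phi>"
    then obtain W \<gamma> where ld: "local_diffeo_on M W \<gamma> \<phi>" by blast
    then have W: "open W" "openin (mtop M) (\<phi> ` W)" by (simp_all add: local_diffeo_on_def)
    then show "\<phi> \<in> local_diffeos M"
      unfolding local_diffeos_def using iff[OF W] ld by blast
  qed
qed

lemma local_diffeo_onD:
  assumes "local_diffeo_on M W \<gamma> \<phi>"
  shows "open W" "0 \<in> W" "openin (mtop M) (\<phi> ` W)" "continuous_map (top_of_set W) (mtop M) \<phi>"
    "continuous_map (subtopology (mtop M) (\<phi> ` W)) (top_of_set W) \<gamma>" "u \<in> W \<Longrightarrow> \<gamma> (\<phi> u) = u"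
    "(U, \<psi>) \<in> charts M \<Longrightarrow> smooth_on {u \<in> W. \<phi> u \<in> U} (\<lambda>u. \<psi> (\<phi> u))"
    "(U, \<psi>) \<in> charts M \<Longrightarrow> smooth_on (\<psi> ` (U \<inter> \<phi> ` W)) (\<lambda>y. \<gamma> (inv_into U \<psi> y))"
    "u \<in> W \<Longrightarrow> \<phi> u \<in> mspace M"
  using assms openin_subset[of "mtop M" "\<phi> ` W"] unfolding local_diffeo_on_def by auto

lemma local_diffeo_image_open:
  assumes "local_diffeo_on M W \<gamma> \<phi>" "open Y" "Y \<subseteq> W"
  shows "openin (mtop M) (\<phi> ` Y)"
proof -
  note D = local_diffeo_onD[OF assms(1)]
  have sub: "\<phi> ` W \<subseteq> mspace M" using D(9) by blast
  have "openin (top_of_set W) Y" using assms(2,3) by (simp add: open_subset)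
  from openin_continuous_map_preimage[OF D(5) this]
  have "openin (subtopology (mtop M) (\<phi> ` W)) {z \<in> \<phi> ` W. \<gamma> z \<in> Y}"
    using sub by (simp add: Int_absorb1 inf.absorb2)
  moreover have "{z \<in> \<phi> ` W. \<gamma> z \<in> Y} = \<phi> ` Y"
    using D(6) assms(3) by (auto simp: image_iff)
  ultimately show ?thesis
    using openin_trans_full[OF _ D(3)] by simp
qed

lemma local_diffeo_near:
  assumes "\<phi> \<in> local_diffeos M" "(U, \<psi>) \<in> charts M" "\<phi> 0 \<in> U" "open Y" "\<psi> (\<phi> 0) \<in> Y"
  obtains S where "open S" "0 \<in> S" "smooth_on S (\<lambda>u. \<psi> (\<phi> u))"
    "\<And>u. u \<in> S \<Longrightarrow> \<phi> u \<in> U" "\<And>u. u \<in> S \<Longrightarrow> \<psi> (\<phi> u) \<in> Y"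
proof -
  obtain W \<gamma> where "local_diffeo_on M W \<gamma> \<phi>" using assms(1) local_diffeos_iff by blast
  note D = local_diffeo_onD[OF this]
  let ?S = "{u \<in> W. \<phi> u \<in> {x \<in> U. \<psi> x \<in> Y}}"
  show ?thesis
  proof (rule that[of ?S])
    show "open ?S"
      by (rule open_chart_preimage_map[OF D(1,4) chart_open_preimage[OF assms(2,4)]])
    show "smooth_on ?S (\<lambda>u. \<psi> (\<phi> u))"
      by (rule smooth_on_subset[OF D(7)[OF assms(2)]]) auto
  qed (use D(2) assms(3,5) in auto)
qed

text \<open>Shifting the source turns a local diffeomorphism into frames over all nearby points,
  that is, a local section of the frame bundle.\<close>

lemma local_diffeo_translate:
  assumes "local_diffeo_on M W \<gamma> \<phi>" "y \<in> W"
  shows "(\<lambda>u. \<phi> (u + y)) \<in> local_diffeos M"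
proof -
  note D = local_diffeo_onD[OF assms(1)]
  let ?W = "{u. u + y \<in> W}"
  have im: "(\<lambda>u. \<phi> (u + y)) ` ?W = \<phi> ` W"
    by (auto simp: image_iff) (metis diff_add_cancel)
  have W: "open ?W"
    using open_vimage[OF D(1), of "\<lambda>u. u + y"] by (simp add: vimage_def continuous_intros)
  have "local_diffeo_on M ?W (\<lambda>z. \<gamma> z - y) (\<lambda>u. \<phi> (u + y))"
    unfolding local_diffeo_on_def im
  proof (intro conjI ballI)
    show "continuous_map (top_of_set ?W) (mtop M) (\<lambda>u. \<phi> (u + y))"
      using continuous_map_compose[OF _ D(4), of "top_of_set ?W" "\<lambda>u. u + y"]
      by (simp add: o_def continuous_intros)
    have "continuous_map (top_of_set W) (top_of_set ?W) (\<lambda>u. u - y)"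
      by (simp add: continuous_intros Pi_def)
    from continuous_map_compose[OF D(5) this]
    show "continuous_map (subtopology (mtop M) (\<phi> ` W)) (top_of_set ?W) (\<lambda>z. \<gamma> z - y)"
      by (simp add: o_def)
    fix c assume c: "c \<in> charts M"
    obtain U \<psi> where [simp]: "c = (U, \<psi>)" by (cases c)
    have c: "(U, \<psi>) \<in> charts M" using c by simp
    have S: "open {u \<in> W. \<phi> u \<in> U}"
      by (rule open_chart_preimage_map[OF D(1,4) chart_domain[OF c]])
    have S': "open {u \<in> ?W. \<phi> (u + y) \<in> U}"
      using open_vimage[OF S, of "\<lambda>u. u + y"] by (simp add: vimage_def continuous_intros)
    have "smooth_on {u \<in> ?W. \<phi> (u + y) \<in> U} (\<lambda>u. u + y)"
      by (intro smooth_on_add smooth_on_id smooth_on_const S')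
    then have "smooth_on {u \<in> ?W. \<phi> (u + y) \<in> U} (\<lambda>u. \<psi> (\<phi> (u + y)))"
      by (rule smooth_on_compose[OF S' S _ D(7)[OF c]]) auto
    then show "case c of (U, \<psi>) \<Rightarrow> smooth_on {u \<in> ?W. \<phi> (u + y) \<in> U} (\<lambda>u. \<psi> (\<phi> (u + y)))" by simp
    have O: "open (\<psi> ` (U \<inter> \<phi> ` W))" by (rule open_chart_image_Int[OF c D(3)])
    show "case c of (U, \<psi>) \<Rightarrow> smooth_on (\<psi> ` (U \<inter> \<phi> ` W)) (\<lambda>z. \<gamma> (inv_into U \<psi> z) - y)"
      by (auto intro: smooth_on_diff[OF O D(8)[OF c] smooth_on_const[OF O]])
  qed (use W assms(2) D in auto)
  then show ?thesis using local_diffeos_iff by blast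
qed

lemma jet_eq_iff:
  assumes "\<phi> \<in> local_diffeos M" "\<phi>' \<in> local_diffeos M"
  shows "jet k M \<phi> = jet k M \<phi>' \<longleftrightarrow> (\<phi>, \<phi>') \<in> jet_rel k M"
  unfolding jet_def by (rule eq_equiv_class_iff[OF equiv_jet_rel assms])

lemma jet_relD:
  assumes "(\<phi>, \<phi>') \<in> jet_rel k M"
  shows "\<phi> \<in> local_diffeos M" "\<phi>' \<in> local_diffeos M" "\<phi> 0 = \<phi>' 0"
    "(U, \<psi>) \<in> charts M \<Longrightarrow> \<phi> 0 \<in> U \<Longrightarrow> agree k (\<lambda>u. \<psi> (\<phi> u)) (\<lambda>u. \<psi> (\<phi>' u)) 0"
  using assms by (auto simp: jet_rel_def jet_coord_eq_iff)

lemma jet_relI: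
  assumes "\<phi> \<in> local_diffeos M" "\<phi>' \<in> local_diffeos M" "\<phi> 0 = \<phi>' 0"
    "\<And>U \<psi>. (U, \<psi>) \<in> charts M \<Longrightarrow> \<phi> 0 \<in> U \<Longrightarrow> agree k (\<lambda>u. \<psi> (\<phi> u)) (\<lambda>u. \<psi> (\<phi>' u)) 0"
  shows "(\<phi>, \<phi>') \<in> jet_rel k M"
  using assms by (auto simp: jet_rel_def jet_coord_eq_iff)

lemma jet_cong:
  assumes "\<phi> \<in> local_diffeos M" "\<phi>' \<in> local_diffeos M" "open W" "0 \<in> W" "\<And>u. u \<in> W \<Longrightarrow> \<phi> u = \<phi>' u"
  shows "jet k M \<phi> = jet k M \<phi>'"
  unfolding jet_eq_iff[OF assms(1,2)]
proof (rule jet_relI[OF assms(1,2)])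
  fix U \<psi>
  have "agree k (\<lambda>u. \<psi> (\<phi>' u)) (\<lambda>u. \<psi> (\<phi>' u)) 0" by simp
  then show "agree k (\<lambda>u. \<psi> (\<phi> u)) (\<lambda>u. \<psi> (\<phi>' u)) 0"
    using agree_cong[OF assms(3,4), of "\<lambda>u. \<psi> (\<phi> u)" "\<lambda>u. \<psi> (\<phi>' u)"] assms(5) by simp
qed (use assms in auto)

lemma framesE:
  assumes "J \<in> frames k M"
  obtains \<phi> where "\<phi> \<in> local_diffeos M" "J = jet k M \<phi>"
  using assms by (auto simp: frames_def jet_def quotient_def)

lemma jet_in_frames: "\<phi> \<in> local_diffeos M \<Longrightarrow> jet k M \<phi> \<in> frames k M"
  by (simp add: frames_def jet_def quotientI)

text \<open>Continuity of the projection to \<open>M\<close>. The entry of \<open>jet_coord\<close>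
  at \<open>[]\<close> is the chart value of the base point, so the condition is open in the product
  topology.\<close>

lemma frame_bundle_over_open:
  assumes "openin (mtop M) V"
  shows "openin (frame_bundle k M) {jet k M \<phi> |\<phi>. \<phi> \<in> local_diffeos M \<and> \<phi> 0 \<in> V}"
proof -
  define B where "B = (\<lambda>(U, \<psi>). {jet k M \<phi> |\<phi>. \<phi> \<in> local_diffeos M \<and> \<phi> 0 \<in> U \<and>
    jet_coord k \<psi> \<phi> \<in> {c. c [] \<in> \<psi> ` (U \<inter> V)}})"
  have "openin (frame_bundle k M) (B c)" if "c \<in> charts M" for c
  proof -
    obtain U \<psi> where c: "c = (U, \<psi>)" by (cases c)
    with that have U: "(U, \<psi>) \<in> charts M" by simp
    have "open {c. c ([] :: 'e list) \<in> \<psi> ` (U \<inter> V)}"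
      using open_vimage[OF open_chart_image_Int[OF U assms], of "\<lambda>c. c ([] :: 'e list)"]
      by (simp add: vimage_def continuous_on_product_coordinates)
    then show ?thesis
      unfolding frame_bundle_def B_def c prod.case using U
      by (intro topology_generated_by_Basis) blast
  qed
  then have "openin (frame_bundle k M) (\<Union>c\<in>charts M. B c)" by blast
  moreover have "(\<Union>c\<in>charts M. B c) = {jet k M \<phi> |\<phi>. \<phi> \<in> local_diffeos M \<and> \<phi> 0 \<in> V}"
  proof (intro equalityI subsetI)
    fix J assume "J \<in> (\<Union>c\<in>charts M. B c)"
    then obtain U \<psi> \<phi> where *: "(U, \<psi>) \<in> charts M" "J = jet k M \<phi>" "\<phi> \<in> local_diffeos M" "\<phi> 0 \<in> U"
      "\<psi> (\<phi> 0) \<in> \<psi> ` (U \<inter> V)"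
      by (auto simp: B_def jet_coord_def)
    then have "\<phi> 0 \<in> V" using chart_inj[OF *(1)] by (auto dest: inj_onD)
    then show "J \<in> {jet k M \<phi> |\<phi>. \<phi> \<in> local_diffeos M \<and> \<phi> 0 \<in> V}" using * by blast
  next
    fix J assume "J \<in> {jet k M \<phi> |\<phi>. \<phi> \<in> local_diffeos M \<and> \<phi> 0 \<in> V}"
    then obtain \<phi> where \<phi>: "J = jet k M \<phi>" "\<phi> \<in> local_diffeos M" "\<phi> 0 \<in> V" by blast
    then obtain U \<psi> where U: "(U, \<psi>) \<in> charts M" "\<phi> 0 \<in> U"
      using chart_cover[of "\<phi> 0"] openin_subset[OF assms] by blast
    then have "J \<in> B (U, \<psi>)"
      using \<phi> by (auto simp: B_def jet_coord_def)
    then show "J \<in> (\<Union>c\<in>charts M. B c)" using U(1) by blast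
  qed
  ultimately show ?thesis by simp
qed

text \<open>In a chart, the coordinates of the section are the iterated derivatives at
  \<open>y\<close> of one smooth map, hence continuous in \<open>y\<close>. Such sections through
  every frame take over the role of openness of the projection.\<close>

lemma continuous_map_jet_translate:
  assumes "local_diffeo_on M W \<gamma> \<phi>"
  shows "continuous_map (top_of_set W) (frame_bundle k M) (\<lambda>y. jet k M (\<lambda>u. \<phi> (u + y)))"
  unfolding frame_bundle_def
proof (rule continuous_on_generated_topo)
  note D = local_diffeo_onD[OF assms]
  let ?j = "\<lambda>y. jet k M (\<lambda>u. \<phi> (u + y))"
  note ld = local_diffeo_translate[OF assms]
  fix B assume "B \<in> {{jet k M \<phi> |\<phi>. \<phi> \<in> local_diffeos M \<and> \<phi> 0 \<in> U \<and> jet_coord k \<psi> \<phi> \<in> T} |U \<psi> T.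
          (U, \<psi>) \<in> charts M \<and> open T}"
  then obtain U \<psi> T where B: "B = {jet k M \<phi> |\<phi>. \<phi> \<in> local_diffeos M \<and> \<phi> 0 \<in> U \<and> jet_coord k \<psi> \<phi> \<in> T}"
    and U: "(U, \<psi>) \<in> charts M" and T: "open T" by blast
  let ?S = "{u \<in> W. \<phi> u \<in> U}"
  have S: "open ?S" by (rule open_chart_preimage_map[OF D(1,4) chart_domain[OF U]])
  have coord: "jet_coord k \<psi> (\<lambda>u. \<phi> (u + y)) =
      (\<lambda>vs. if length vs \<le> k then iter_deriv vs (\<lambda>u. \<psi> (\<phi> u)) y else 0)" for y
    using iter_deriv_translate[of _ "\<lambda>u. \<psi> (\<phi> u)" y 0] by (auto simp: jet_coord_def o_def)
  have mem: "?j y \<in> B \<longleftrightarrow> \<phi> y \<in> U \<and> jet_coord k \<psi> (\<lambda>u. \<phi> (u + y)) \<in> T" if y: "y \<in> W" for y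
  proof
    assume "?j y \<in> B"
    then obtain \<phi>' where \<phi>': "?j y = jet k M \<phi>'" "\<phi>' \<in> local_diffeos M" "\<phi>' 0 \<in> U" "jet_coord k \<psi> \<phi>' \<in> T"
      unfolding B by blast
    have "((\<lambda>u. \<phi> (u + y)), \<phi>') \<in> jet_rel k M"
      using \<phi>'(1) unfolding jet_eq_iff[OF ld[OF y] \<phi>'(2)] .
    then have "\<phi> (0 + y) = \<phi>' 0"
      "\<forall>(U, \<psi>)\<in>charts M. \<phi> (0 + y) \<in> U \<longrightarrow> jet_coord k \<psi> (\<lambda>u. \<phi> (u + y)) = jet_coord k \<psi> \<phi>'"
      unfolding jet_rel_def by blast+
    then show "\<phi> y \<in> U \<and> jet_coord k \<psi> (\<lambda>u. \<phi> (u + y)) \<in> T"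
      using \<phi>' U by auto
  next
    assume *: "\<phi> y \<in> U \<and> jet_coord k \<psi> (\<lambda>u. \<phi> (u + y)) \<in> T"
    show "?j y \<in> B"
      unfolding B using ld[OF y] * by (intro CollectI exI[of _ "\<lambda>u. \<phi> (u + y)"]) simp
  qed
  have cont: "continuous_on ?S (\<lambda>y. jet_coord k \<psi> (\<lambda>u. \<phi> (u + y)))"
    unfolding coord
  proof (rule continuous_on_coordinatewise_then_product)
    show "continuous_on ?S (\<lambda>y. if length vs \<le> k then iter_deriv vs (\<lambda>u. \<psi> (\<phi> u)) y else 0)" for vs
      using smooth_on_continuous[OF smooth_on_iter_deriv[OF D(7)[OF U]], of vs]
      by (cases "length vs \<le> k") auto
  qed
  have "?j -` B \<inter> topspace (top_of_set W) = ?S \<inter> (\<lambda>y. jet_coord k \<psi> (\<lambda>u. \<phi> (u + y))) -` T"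
    using mem by auto
  moreover have "open (?S \<inter> (\<lambda>y. jet_coord k \<psi> (\<lambda>u. \<phi> (u + y))) -` T)"
    by (rule continuous_open_preimage[OF cont S T])
  ultimately show "openin (top_of_set W) (?j -` B \<inter> topspace (top_of_set W))"
    by (simp add: open_subset Int_assoc subset_iff)
next
  have "jet k M (\<lambda>u. \<phi> (u + y)) \<in> topspace (frame_bundle k M)" if "y \<in> W" for y
    using jet_in_frames[OF local_diffeo_translate[OF assms that]] by (simp add: topspace_frame_bundle)
  then show "(\<lambda>y. jet k M (\<lambda>u. \<phi> (u + y))) ` topspace (top_of_set W) \<subseteq>
      \<Union> {{jet k M \<phi> |\<phi>. \<phi> \<in> local_diffeos M \<and> \<phi> 0 \<in> U \<and> jet_coord k \<psi> \<phi> \<in> T} |U \<psi> T.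
          (U, \<psi>) \<in> charts M \<and> open T}"
    unfolding frame_bundle_def topology_generated_by_topspace by (simp add: image_subset_iff)
qed

lemma local_diffeo_base: "\<phi> \<in> local_diffeos M \<Longrightarrow> \<phi> 0 \<in> mspace M"
  using local_diffeos_iff local_diffeo_onD(2,9) by metis

lemma jet_base: "jet k M \<phi> = jet k M \<phi>' \<Longrightarrow> \<phi> \<in> local_diffeos M \<Longrightarrow> \<phi>' \<in> local_diffeos M \<Longrightarrow> \<phi> 0 = \<phi>' 0"
  using jet_eq_iff jet_relD(3) by blast

text \<open>Continuity of the projection puts the base points of frames in the closure into the
  closure of \<open>N\<close>. A frame interior to the closure would, along a section through it,
  give an open set of such base points.\<close>

lemma nowhere_dense_in_frame_bundle:
  assumes "nowhere_dense_in (mtop M) N"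
  shows "nowhere_dense_in (frame_bundle k M) {jet k M \<phi> |\<phi>. \<phi> \<in> local_diffeos M \<and> \<phi> 0 \<in> N}"
    (is "nowhere_dense_in _ ?N")
proof -
  define C where "C = (mtop M) closure_of N"
  define C' where "C' = (frame_bundle k M) closure_of ?N"
  define I where "I = (frame_bundle k M) interior_of C'"
  have N: "N \<subseteq> mspace M" and empty: "(mtop M) interior_of C = {}"
    using assms by (simp_all add: nowhere_dense_in_def C_def)
  have sub: "?N \<subseteq> topspace (frame_bundle k M)"
    unfolding topspace_frame_bundle using jet_in_frames by blast
  have NC: "N \<subseteq> C" unfolding C_def by (rule closure_of_subset[OF N])
  have openC: "openin (mtop M) (mspace M - C)"
    unfolding C_def by (intro openin_diff closedin_closure_of openin_topspace)
  have meets: "\<exists>J'. J' \<in> ?N \<and> J' \<in> V" if "J \<in> C'" "J \<in> V" "openin (frame_bundle k M) V" for J V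
    using that(1)[unfolded C'_def in_closure_of] that(2,3) by simp
  have base: "\<phi> 0 \<in> C" if \<phi>: "\<phi> \<in> local_diffeos M" "jet k M \<phi> \<in> C'" for \<phi>
  proof (rule ccontr)
    assume "\<phi> 0 \<notin> C"
    then have "jet k M \<phi> \<in> {jet k M \<phi> |\<phi>. \<phi> \<in> local_diffeos M \<and> \<phi> 0 \<in> mspace M - C}"
      using \<phi>(1) local_diffeo_base by blast
    from meets[OF \<phi>(2) this frame_bundle_over_open[OF openC]]
    obtain J where J: "J \<in> ?N" "J \<in> {jet k M \<phi> |\<phi>. \<phi> \<in> local_diffeos M \<and> \<phi> 0 \<in> mspace M - C}"
      by (elim exE conjE) (rule that)
    then obtain \<phi>1 \<phi>2 where *: "J = jet k M \<phi>1" "\<phi>1 \<in> local_diffeos M" "\<phi>1 0 \<in> N"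
      "J = jet k M \<phi>2" "\<phi>2 \<in> local_diffeos M" "\<phi>2 0 \<notin> C" by blast
    then show False using jet_base[of k \<phi>1 \<phi>2] NC by auto
  qed
  have I: "openin (frame_bundle k M) I" "I \<subseteq> C'"
    by (auto simp: I_def openin_interior_of interior_of_subset)
  have "I = {}"
  proof (rule ccontr)
    assume "I \<noteq> {}"
    then obtain J where J: "J \<in> I" by blast
    then have "J \<in> frames k M" using openin_subset[OF I(1)] topspace_frame_bundle by blast
    then obtain \<phi> where \<phi>: "\<phi> \<in> local_diffeos M" "J = jet k M \<phi>" by (rule framesE)
    obtain W \<gamma> where W: "local_diffeo_on M W \<gamma> \<phi>" using \<phi>(1) local_diffeos_iff by blast
    note D = local_diffeo_onD[OF W]
    define Y where "Y = {y \<in> W. jet k M (\<lambda>u. \<phi> (u + y)) \<in> I}"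
    have "openin (top_of_set W) Y"
      using openin_continuous_map_preimage[OF continuous_map_jet_translate[OF W] I(1)]
      by (simp add: Y_def)
    then have Y: "open Y" using D(1) openin_open_trans by blast
    have "openin (mtop M) (\<phi> ` Y)"
      by (rule local_diffeo_image_open[OF W Y]) (auto simp: Y_def)
    moreover have "\<phi> ` Y \<subseteq> C"
    proof
      fix z assume "z \<in> \<phi> ` Y"
      then obtain y where y: "z = \<phi> y" "y \<in> W" "jet k M (\<lambda>u. \<phi> (u + y)) \<in> I" by (auto simp: Y_def)
      then show "z \<in> C" using base[OF local_diffeo_translate[OF W y(2)]] I(2) by auto
    qed
    moreover have "0 \<in> Y" using D(2) J \<phi>(2) by (simp add: Y_def)
    ultimately show False
      using empty interior_of_eq_empty[of "mtop M" C] by blast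
  qed
  then show ?thesis using sub by (simp add: nowhere_dense_in_def I_def C'_def)
qed

end

section \<open>The prolonged action on frames\<close>

context smooth_action
begin

lemma act_in: "g \<in> carrier G \<Longrightarrow> x \<in> mspace M \<Longrightarrow> act g x \<in> mspace M"
  using element_image by blast

lemma act_inv: "g \<in> carrier G \<Longrightarrow> x \<in> mspace M \<Longrightarrow> act (inv g) (act g x) = x"
  using orbit_sym_aux by blast

lemma continuous_map_act:
  assumes "g \<in> carrier G"
  shows "continuous_map (mtop M) (mtop M) (act g)"
proof -
  have "continuous_map (mtop M) (prod_topology (mtop \<G>) (mtop M)) (\<lambda>x. (g, x))"
    using assms by (simp add: continuous_map_pairwise o_def mspace_eq_carrier)
  moreover have "continuous_map (prod_topology (mtop \<G>) (mtop M)) (mtop M) (\<lambda>(g, x). act g x)"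
    using smooth_act by (simp add: smooth_map_def prod_manifold_def)
  ultimately have "continuous_map (mtop M) (mtop M) ((\<lambda>(g, x). act g x) \<circ> (\<lambda>x. (g, x)))"
    by (rule continuous_map_compose)
  then show ?thesis by (simp add: o_def)
qed

lemmas local_diffeos_iff_M = smooth_manifold.local_diffeos_iff[OF manifold_M]
lemmas local_diffeo_onD_M = smooth_manifold.local_diffeo_onD[OF manifold_M]

text \<open>The inverse is \<gamma> after the action of the inverse element. Smoothness is checked
  locally through an intermediate chart, because the action is known to be smooth only from chart to
  chart.\<close>

lemma act_local_diffeo:
  assumes g: "g \<in> carrier G" and \<phi>: "\<phi> \<in> local_diffeos M"
  shows "(\<lambda>u. act g (\<phi> u)) \<in> local_diffeos M"
proof -
  obtain W \<gamma> where W: "local_diffeo_on M W \<gamma> \<phi>" using \<phi> local_diffeos_iff_M by blast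
  note D = local_diffeo_onD_M[OF W]
  note g' = inv_closed[OF g]
  let ?\<phi> = "\<lambda>u. act g (\<phi> u)"
  have sub: "\<phi> ` W \<subseteq> mspace M" using D(9) by blast
  have im: "?\<phi> ` W = {x \<in> mspace M. act (inv g) x \<in> \<phi> ` W}"
  proof (intro equalityI subsetI)
    fix x assume "x \<in> {x \<in> mspace M. act (inv g) x \<in> \<phi> ` W}"
    then obtain u where u: "x \<in> mspace M" "u \<in> W" "act (inv g) x = \<phi> u" by auto
    then have "x = act g (\<phi> u)" using act_inv[OF g' u(1)] g by simp
    then show "x \<in> ?\<phi> ` W" using u by blast
  qed (use D(9) act_inv[OF g] act_in[OF g] in auto)
  have im_open: "openin (mtop M) (?\<phi> ` W)"
    unfolding im by (rule openin_continuous_map_preimage[OF continuous_map_act[OF g'] D(3)])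
  have cont: "continuous_map (top_of_set W) (mtop M) ?\<phi>"
    using continuous_map_compose[OF D(4) continuous_map_act[OF g]] by (simp add: o_def)
  have "continuous_map (subtopology (mtop M) (?\<phi> ` W)) (subtopology (mtop M) (\<phi> ` W)) (act (inv g))"
    using continuous_map_act[OF g'] unfolding im
    by (auto simp: continuous_map_in_subtopology continuous_map_from_subtopology)
  from continuous_map_compose[OF this D(5)]
  have cont': "continuous_map (subtopology (mtop M) (?\<phi> ` W)) (top_of_set W) (\<lambda>x. \<gamma> (act (inv g) x))"
    by (simp add: o_def)
  have sm: "smooth_on {u \<in> W. ?\<phi> u \<in> U} (\<lambda>u. \<psi> (?\<phi> u))" if c: "(U, \<psi>) \<in> charts M" for U \<psi>
  proof (rule smooth_on_local)
    fix u assume u: "u \<in> {u \<in> W. ?\<phi> u \<in> U}"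
    have "\<phi> u \<in> mspace M" using D(9) u by simp
    from smooth_manifold.chart_cover[OF manifold_M this]
    obtain U0 \<psi>0 where c0: "(U0, \<psi>0) \<in> charts M" "\<phi> u \<in> U0" by blast
    note i0 = smooth_manifold.chart_inv[OF manifold_M c0(1)]
    note C = act_slice_smooth[OF g c0(1) c]
    let ?T = "{u \<in> W. \<phi> u \<in> U0} \<inter> {u \<in> W. ?\<phi> u \<in> U}"
    have T: "open ?T"
      by (intro open_Int smooth_manifold.open_chart_preimage_map[OF manifold_M D(1)] D(4) cont
          smooth_manifold.chart_domain[OF manifold_M c0(1)] smooth_manifold.chart_domain[OF manifold_M c])
    have "smooth_on ?T (\<lambda>u. \<psi> (act g (inv_into U0 \<psi>0 (\<psi>0 (\<phi> u)))))"
      by (rule smooth_on_compose[OF T C(1) smooth_on_subset[OF D(7)[OF c0(1)]] C(2)])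
        (use i0 in auto)
    moreover have "\<psi> (act g (inv_into U0 \<psi>0 (\<psi>0 (\<phi> u)))) = \<psi> (?\<phi> u)" if "u \<in> ?T" for u
      using that i0 by simp
    ultimately have "smooth_on ?T (\<lambda>u. \<psi> (?\<phi> u))"
      by (rule smooth_on_transform[OF T])
    then show "\<exists>T. open T \<and> u \<in> T \<and> smooth_on T (\<lambda>u. \<psi> (?\<phi> u))"
      using T u c0(2) by (intro exI[of _ ?T]) auto
  qed
  have sm': "smooth_on (\<psi> ` (U \<inter> ?\<phi> ` W)) (\<lambda>y. \<gamma> (act (inv g) (inv_into U \<psi> y)))"
    if c: "(U, \<psi>) \<in> charts M" for U \<psi>
  proof (rule smooth_on_local)
    note i = smooth_manifold.chart_inv[OF manifold_M c]
    fix y assume y: "y \<in> \<psi> ` (U \<inter> ?\<phi> ` W)"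
    then have z: "act (inv g) (inv_into U \<psi> y) \<in> \<phi> ` W" and yU: "y \<in> \<psi> ` U"
      unfolding im using i by auto
    from smooth_manifold.chart_cover[OF manifold_M subsetD[OF sub z]]
    obtain U0 \<psi>0 where c0: "(U0, \<psi>0) \<in> charts M" "act (inv g) (inv_into U \<psi> y) \<in> U0" by blast
    note i0 = smooth_manifold.chart_inv[OF manifold_M c0(1)]
    let ?C = "{y \<in> \<psi> ` U. act (inv g) (inv_into U \<psi> y) \<in> U0}"
    let ?c = "\<lambda>y. \<psi>0 (act (inv g) (inv_into U \<psi> y))"
    note C = act_slice_smooth[OF g' c c0(1)]
    note P = smooth_manifold.open_chart_image_Int[OF manifold_M c0(1) D(3)]
    let ?T = "?C \<inter> ?c -` (\<psi>0 ` (U0 \<inter> \<phi> ` W))"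
    have T: "open ?T"
      by (rule continuous_open_preimage[OF smooth_on_continuous[OF C(2)] C(1) P])
    have "smooth_on ?T (\<lambda>y. \<gamma> (inv_into U0 \<psi>0 (?c y)))"
      by (rule smooth_on_compose[OF T P smooth_on_subset[OF C(2)] D(8)[OF c0(1)]]) auto
    moreover have "\<gamma> (inv_into U0 \<psi>0 (?c y)) = \<gamma> (act (inv g) (inv_into U \<psi> y))" if "y \<in> ?T" for y
      using that i0 by simp
    ultimately have "smooth_on ?T (\<lambda>y. \<gamma> (act (inv g) (inv_into U \<psi> y)))"
      by (rule smooth_on_transform[OF T])
    then show "\<exists>T. open T \<and> y \<in> T \<and> smooth_on T (\<lambda>y. \<gamma> (act (inv g) (inv_into U \<psi> y)))"
      using T yU c0(2) z by (intro exI[of _ ?T]) auto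
  qed
  have "local_diffeo_on M W (\<lambda>x. \<gamma> (act (inv g) x)) ?\<phi>"
    unfolding local_diffeo_on_def
    using D(1,2) im_open cont cont' sm sm' D(6,9) act_inv[OF g] by auto
  then show ?thesis using local_diffeos_iff_M by blast
qed

text \<open>In charts both sides are composites with the same outer map, so
  \<open>agree_compose\<close> applies; this makes the union in \<open>frame_act\<close> a single
  class.\<close>

lemma act_jet_rel:
  assumes g: "g \<in> carrier G" and rel: "(\<phi>, \<phi>') \<in> jet_rel k M"
  shows "((\<lambda>u. act g (\<phi> u)), (\<lambda>u. act g (\<phi>' u))) \<in> jet_rel k M"
proof (rule smooth_manifold.jet_relI[OF manifold_M])
  note R = smooth_manifold.jet_relD[OF manifold_M rel]
  show "(\<lambda>u. act g (\<phi> u)) \<in> local_diffeos M" "(\<lambda>u. act g (\<phi>' u)) \<in> local_diffeos M"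
    using act_local_diffeo[OF g] R by auto
  show "act g (\<phi> 0) = act g (\<phi>' 0)" using R(3) by simp
  fix U \<psi> assume c: "(U, \<psi>) \<in> charts M" and U: "act g (\<phi> 0) \<in> U"
  obtain U0 \<psi>0 where c0: "(U0, \<psi>0) \<in> charts M" "\<phi> 0 \<in> U0"
    using smooth_manifold.chart_cover[OF manifold_M smooth_manifold.local_diffeo_base[OF manifold_M R(1)]]
    by blast
  note i0 = smooth_manifold.chart_inv[OF manifold_M c0(1)]
  note C = act_slice_smooth[OF g c0(1) c]
  let ?C = "{y \<in> \<psi>0 ` U0. act g (inv_into U0 \<psi>0 y) \<in> U}"
  have in_C: "\<psi>0 (\<phi> 0) \<in> ?C" "\<psi>0 (\<phi>' 0) \<in> ?C" "\<phi>' 0 \<in> U0"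
    using c0(2) U i0 R(3) by auto
  obtain S where S: "open S" "0 \<in> S" "smooth_on S (\<lambda>u. \<psi>0 (\<phi> u))"
    "\<And>u. u \<in> S \<Longrightarrow> \<phi> u \<in> U0" "\<And>u. u \<in> S \<Longrightarrow> \<psi>0 (\<phi> u) \<in> ?C"
    using smooth_manifold.local_diffeo_near[OF manifold_M R(1) c0 C(1) in_C(1)] by blast
  obtain S' where S': "open S'" "0 \<in> S'" "smooth_on S' (\<lambda>u. \<psi>0 (\<phi>' u))"
    "\<And>u. u \<in> S' \<Longrightarrow> \<phi>' u \<in> U0" "\<And>u. u \<in> S' \<Longrightarrow> \<psi>0 (\<phi>' u) \<in> ?C"
    using smooth_manifold.local_diffeo_near[OF manifold_M R(2) c0(1) in_C(3) C(1) in_C(2)] by blast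
  have T: "open (S \<inter> S')" "0 \<in> S \<inter> S'" using S S' by auto
  have "agree k (\<lambda>u. \<psi> (act g (inv_into U0 \<psi>0 (\<psi>0 (\<phi> u)))))
      (\<lambda>u. \<psi> (act g (inv_into U0 \<psi>0 (\<psi>0 (\<phi>' u))))) 0"
    by (rule agree_compose[OF T smooth_on_subset[OF S(3)] smooth_on_subset[OF S'(3)] _ _ C C(2)
          R(4)[OF c0] agree_refl]) (use S(5) S'(5) in auto)
  then show "agree k (\<lambda>u. \<psi> (act g (\<phi> u))) (\<lambda>u. \<psi> (act g (\<phi>' u))) 0"
    by (subst (asm) agree_cong[OF T, of _ "\<lambda>u. \<psi> (act g (\<phi> u))" _ "\<lambda>u. \<psi> (act g (\<phi>' u))"])
      (use i0(1) S(4) S'(4) in auto)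
qed

lemma frame_act_jet:
  assumes g: "g \<in> carrier G" and \<phi>: "\<phi> \<in> local_diffeos M"
  shows "frame_act k M act g (jet k M \<phi>) = jet k M (\<lambda>u. act g (\<phi> u))"
proof -
  have "jet k M (\<lambda>u. act g (\<phi>' u)) = jet k M (\<lambda>u. act g (\<phi> u))" if "\<phi>' \<in> jet k M \<phi>" for \<phi>'
  proof -
    have rel: "(\<phi>, \<phi>') \<in> jet_rel k M" using that by (simp add: jet_def)
    from act_jet_rel[OF g this] show ?thesis
      using smooth_manifold.jet_eq_iff[OF manifold_M] act_local_diffeo[OF g]
        smooth_manifold.jet_relD(1,2)[OF manifold_M rel] by metis
  qed
  moreover have "\<phi> \<in> jet k M \<phi>"
    unfolding jet_def by (rule equiv_class_self[OF equiv_jet_rel \<phi>])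
  ultimately show ?thesis unfolding frame_act_def by blast
qed

lemma frame_act_in_frames:
  "g \<in> carrier G \<Longrightarrow> J \<in> frames k M \<Longrightarrow> frame_act k M act g J \<in> frames k M"
  by (metis frame_act_jet smooth_manifold.framesE[OF manifold_M] act_local_diffeo
      smooth_manifold.jet_in_frames[OF manifold_M])

text \<open>Representatives are arbitrary away from 0, where the laws of the action may fail; the
  two sides agree on \<open>W\<close>, and \<open>jet_cong\<close> needs no more.\<close>

lemma frame_act_mult:
  assumes g: "g \<in> carrier G" "h \<in> carrier G" and J: "J \<in> frames k M"
  shows "frame_act k M act (g \<otimes> h) J = frame_act k M act g (frame_act k M act h J)"
proof -
  obtain \<phi> where \<phi>: "\<phi> \<in> local_diffeos M" "J = jet k M \<phi>"
    by (rule smooth_manifold.framesE[OF manifold_M J])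
  obtain W \<gamma> where W: "local_diffeo_on M W \<gamma> \<phi>" using \<phi>(1) local_diffeos_iff_M by blast
  note D = local_diffeo_onD_M[OF W]
  note ld = act_local_diffeo[OF g(2) \<phi>(1)]
  have "jet k M (\<lambda>u. act (g \<otimes> h) (\<phi> u)) = jet k M (\<lambda>u. act g (act h (\<phi> u)))"
    by (rule smooth_manifold.jet_cong[OF manifold_M act_local_diffeo[OF m_closed[OF g] \<phi>(1)]
          act_local_diffeo[OF g(1) ld] D(1,2) composition_rule[OF D(9) g]])
  then show ?thesis
    using frame_act_jet[OF m_closed[OF g] \<phi>(1)] frame_act_jet[OF g(2) \<phi>(1)] frame_act_jet[OF g(1) ld] \<phi>(2)
    by simp
qed

lemma frame_act_one:
  assumes J: "J \<in> frames k M"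
  shows "frame_act k M act \<one> J = J"
proof -
  obtain \<phi> where \<phi>: "\<phi> \<in> local_diffeos M" "J = jet k M \<phi>"
    by (rule smooth_manifold.framesE[OF manifold_M J])
  obtain W \<gamma> where W: "local_diffeo_on M W \<gamma> \<phi>" using \<phi>(1) local_diffeos_iff_M by blast
  note D = local_diffeo_onD_M[OF W]
  have "jet k M (\<lambda>u. act \<one> (\<phi> u)) = jet k M \<phi>"
    by (rule smooth_manifold.jet_cong[OF manifold_M act_local_diffeo[OF one_closed \<phi>(1)] \<phi>(1) D(1,2)])
      (rule act_one[OF D(9)])
  then show ?thesis using frame_act_jet[OF one_closed \<phi>(1)] \<phi>(2) by simp
qed

text \<open>Composing both representatives with the inverse of \<phi> in the chart turns the
  agreement of g \<phi> with \<phi> at 0 into agreement of \<open>g\<close> with the identity at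
  \<phi> 0.\<close>

lemma frame_fixed_imp_jet_fixed:
  assumes g: "g \<in> carrier G" and \<phi>: "\<phi> \<in> local_diffeos M"
    and fixed: "frame_act k M act g (jet k M \<phi>) = jet k M \<phi>"
  shows "jet_fixed k g (\<phi> 0)"
  unfolding jet_fixed_def
proof (intro conjI ballI, safe)
  note ld = act_local_diffeo[OF g \<phi>]
  have "((\<lambda>u. act g (\<phi> u)), \<phi>) \<in> jet_rel k M"
    using fixed smooth_manifold.jet_eq_iff[OF manifold_M ld \<phi>] frame_act_jet[OF g \<phi>] by simp
  note R = smooth_manifold.jet_relD[OF manifold_M this]
  show fix0: "act g (\<phi> 0) = \<phi> 0" by (rule R(3))
  fix U \<psi> assume c: "(U, \<psi>) \<in> charts M" and U: "\<phi> 0 \<in> U"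
  note i = smooth_manifold.chart_inv[OF manifold_M c]
  obtain W \<gamma> where W: "local_diffeo_on M W \<gamma> \<phi>" using \<phi> local_diffeos_iff_M by blast
  note D = local_diffeo_onD_M[OF W]
  obtain S where S: "open S" "0 \<in> S" "smooth_on S (\<lambda>u. \<psi> (\<phi> u))" "\<And>u. u \<in> S \<Longrightarrow> \<phi> u \<in> U"
    by (rule smooth_manifold.local_diffeo_near[OF manifold_M \<phi> c U open_UNIV UNIV_I]) (rule that; simp)
  have U': "act g (\<phi> 0) \<in> U" using U fix0 by simp
  obtain S' where S': "open S'" "0 \<in> S'" "smooth_on S' (\<lambda>u. \<psi> (act g (\<phi> u)))"
    by (rule smooth_manifold.local_diffeo_near[OF manifold_M ld c U' open_UNIV UNIV_I]) (rule that; simp)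
  let ?\<Psi> = "\<lambda>y. \<gamma> (inv_into U \<psi> y)"
  let ?P = "\<psi> ` (U \<inter> \<phi> ` W)"
  let ?T = "S \<inter> S'"
  note P = smooth_manifold.open_chart_image_Int[OF manifold_M c D(3)]
  have T: "open ?T" "0 \<in> ?T" using S S' by auto
  \<comment> \<open>Coordinates that the inverse of \<phi> sends to where both representatives are
    smooth in the chart.\<close>
  let ?Q = "?P \<inter> ?\<Psi> -` ?T"
  have Q: "open ?Q"
    by (rule continuous_open_preimage[OF smooth_on_continuous[OF D(8)[OF c]] P T(1)])
  have \<Psi>0: "?\<Psi> (\<psi> (\<phi> 0)) = 0" using i(1)[OF U] D(6)[OF D(2)] by simp
  have y0: "\<psi> (\<phi> 0) \<in> ?Q" using U D(2) \<Psi>0 T(2) by auto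
  have \<Psi>: "\<phi> (?\<Psi> y) = inv_into U \<psi> y" if "y \<in> ?Q" for y
    using that i(1) D(6) by auto
  have sm: "smooth_on ?Q ?\<Psi>" by (rule smooth_on_subset[OF D(8)[OF c]]) auto
  have "agree k (\<lambda>y. \<psi> (act g (\<phi> (?\<Psi> y)))) (\<lambda>y. \<psi> (\<phi> (?\<Psi> y))) (\<psi> (\<phi> 0))"
  proof (rule agree_compose[OF Q y0 sm sm _ _ T(1) smooth_on_subset[OF S'(3)] smooth_on_subset[OF S(3)]])
    show "agree k (\<lambda>u. \<psi> (act g (\<phi> u))) (\<lambda>u. \<psi> (\<phi> u)) (?\<Psi> (\<psi> (\<phi> 0)))"
      unfolding \<Psi>0 by (rule R(4)[OF c U'])
  qed auto
  then show "agree k (\<lambda>y. \<psi> (act g (inv_into U \<psi> y))) (\<lambda>y. y) (\<psi> (\<phi> 0))"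
  proof (subst (asm) agree_cong[OF Q y0])
    show "\<psi> (act g (\<phi> (?\<Psi> y))) = \<psi> (act g (inv_into U \<psi> y))" if "y \<in> ?Q" for y
      using \<Psi>[OF that] by simp
    show "\<psi> (\<phi> (?\<Psi> y)) = y" if "y \<in> ?Q" for y
      using \<Psi>[OF that] i(2)[of y] that by auto
  qed
qed

end

section \<open>Frames with nontrivial stabilizer\<close>

theorem theorem9p1:
  fixes G :: "('g, 'b) monoid_scheme"
    and \<G> :: "('g, 'v::findim_inner) manifold"
    and M :: "('m, 'e::findim_inner) manifold"
    and act :: "'g \<Rightarrow> 'm \<Rightarrow> 'm"
    and n :: nat
  assumes "smooth_action G \<G> M act"
    and "fixpoint_rare G (mtop M) act"
    and "n = mdim \<G>"
  shows "\<exists>Z. meager_in (frame_bundle n M) Z \<and>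
             invariant_under G (frame_act n M act) Z \<and>
             free_on G (topspace (frame_bundle n M) - Z) (frame_act n M act)"
proof -
  interpret smooth_action G \<G> M act by fact
  note top = smooth_manifold.topspace_frame_bundle[OF manifold_M, of n]
  let ?act = "frame_act n M act"
  \<comment> \<open>The smallest possible choice: off \<open>Z\<close> the action is free by
    construction.\<close>
  define Z where "Z = {J \<in> frames n M. \<exists>g\<in>carrier G - {\<one>\<^bsub>G\<^esub>}. ?act g J = J}"
  obtain \<N> where N: "countable \<N>" "\<And>N. N \<in> \<N> \<Longrightarrow> nowhere_dense_in (mtop M) N"
    "\<And>g x. g \<in> carrier G - {\<one>\<^bsub>G\<^esub>} \<Longrightarrow> x \<in> mspace M \<Longrightarrow> jet_fixed n g x \<Longrightarrow> x \<in> \<Union>\<N>"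
    using jet_fixed_meager[OF assms(2,3)] by metis
  \<comment> \<open>The intersection with \<open>Z\<close> is taken because \<open>meager_in\<close>
    asks for \<open>Z\<close> to equal the union, not merely to be covered.\<close>
  define over where "over = (\<lambda>N. {jet n M \<phi> |\<phi>. \<phi> \<in> local_diffeos M \<and> \<phi> 0 \<in> N} \<inter> Z)"
  have "meager_in (frame_bundle n M) Z"
    unfolding meager_in_def
  proof (intro exI[of _ "over ` \<N>"] conjI ballI)
    show "countable (over ` \<N>)" using N(1) by simp
    show "nowhere_dense_in (frame_bundle n M) T" if "T \<in> over ` \<N>" for T
    proof -
      from that obtain N where "N \<in> \<N>" "T = over N" by blast
      then show ?thesis
        unfolding over_def
        by (intro nowhere_dense_in_subset[OF smooth_manifold.nowhere_dense_in_frame_bundle[OF manifold_M N(2)]])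
          auto
    qed
    show "Z = \<Union> (over ` \<N>)"
    proof (intro equalityI subsetI)
      fix J assume J: "J \<in> Z"
      then obtain g where g: "J \<in> frames n M" "g \<in> carrier G - {\<one>\<^bsub>G\<^esub>}" "?act g J = J"
        unfolding Z_def by blast
      obtain \<phi> where \<phi>: "\<phi> \<in> local_diffeos M" "J = jet n M \<phi>"
        by (rule smooth_manifold.framesE[OF manifold_M g(1)])
      have "jet_fixed n g (\<phi> 0)"
        using frame_fixed_imp_jet_fixed[OF _ \<phi>(1), of g n] g \<phi>(2) by blast
      then obtain N where "N \<in> \<N>" "\<phi> 0 \<in> N"
        using N(3)[OF g(2) smooth_manifold.local_diffeo_base[OF manifold_M \<phi>(1)]] by blast
      then show "J \<in> \<Union> (over ` \<N>)" using \<phi> J unfolding over_def by blast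
    qed (auto simp: over_def)
  qed
  moreover have "invariant_under G ?act Z"
    unfolding invariant_under_def
  proof
    have sub: "?act h J \<in> Z" if h: "h \<in> carrier G" and J: "J \<in> Z" for h J
    proof -
      obtain g where g: "J \<in> frames n M" "g \<in> carrier G" "g \<noteq> \<one>\<^bsub>G\<^esub>" "?act g J = J"
        using J unfolding Z_def by blast
      \<comment> \<open>The stabilizer of the moved frame contains the conjugate of
        \<open>g\<close>.\<close>
      let ?g = "h \<otimes>\<^bsub>G\<^esub> g \<otimes>\<^bsub>G\<^esub> inv\<^bsub>G\<^esub> h"
      have "?g \<otimes>\<^bsub>G\<^esub> h = h \<otimes>\<^bsub>G\<^esub> g"
        using g(2) h by (simp add: m_assoc)
      then have "?act ?g (?act h J) = ?act h J"
        using frame_act_mult[of ?g h J n] frame_act_mult[of h g J n] g h by simp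
      moreover have "?g \<noteq> \<one>\<^bsub>G\<^esub>"
      proof
        assume "?g = \<one>\<^bsub>G\<^esub>"
        then have "h \<otimes>\<^bsub>G\<^esub> g = h \<otimes>\<^bsub>G\<^esub> \<one>\<^bsub>G\<^esub>"
          using \<open>?g \<otimes>\<^bsub>G\<^esub> h = h \<otimes>\<^bsub>G\<^esub> g\<close> h by simp
        then show False using g(2,3) h by simp
      qed
      ultimately show ?thesis
        using frame_act_in_frames[OF h g(1)] g(2) h unfolding Z_def by blast
    qed
    fix h assume h: "h \<in> carrier G"
    have "J \<in> ?act h ` Z" if J: "J \<in> Z" for J
    proof -
      have "J \<in> frames n M" using J by (simp add: Z_def)
      then have "?act h (?act (inv\<^bsub>G\<^esub> h) J) = J"
        using frame_act_mult[of h "inv\<^bsub>G\<^esub> h" J n] h frame_act_one by simp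
      then show ?thesis using sub[OF inv_closed[OF h] J] by (metis imageI)
    qed
    then show "?act h ` Z = Z" using sub[OF h] by blast
  qed
  moreover have "free_on G (topspace (frame_bundle n M) - Z) ?act"
    unfolding free_on_def top Z_def by blast
  ultimately show ?thesis by blast
qed

end
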